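(* Let $G$ be a non-elementary word-hyperbolic group with finite symmetric generating set $S$, let $L\subset S^*$ be a combing of $G$ with respect to $S$, and let $\phi:G\to\mathbb{Z}$ be a quasimorphism which is bicombable with respect to $S,L$. Let $\overline{\phi}_n$ be the value of $\phi$ on a random element of $G_n=\{g\in G:|g|=n\}$ chosen with respect to the measure $\widehat{\nu}$ on $G_n$ (normalized to be a probability measure). Then there is some $\sigma\ge0$ such that, in the sense of distribution, $$n^{-1/2}\,\overline{\phi}_n\to N(0,\sigma)\quad\text{as }n\to\infty.$$
   Context: $S$ generates $G$ as a semigroup; $|g|$ denotes word length with respect to $S$. A word-hyperbolic group is elementary if it contains a finite index cyclic subgroup. $N(0,\sigma)$ is the normal distribution with mean $0$ and standard deviation $\sigma$ (the Dirac measure at $0$ if $\sigma=0$). A quasimorphism is a real-valued function $\phi$ on $G$ for which there is $D$ with $|\phi(a)+\phi(b)-\phi(ab)|\le D$ for all $a,b\in G$. Combings. $S^*$ is the set of finite words in $S$; for $w\in S^*$, $|w|$ is its length and $\overline{w}\in G$ its evaluation. A finite digraph $\Gamma$ with initial vertex $v_1$, whose edges are labeled by letters of $S$ with at most one outgoing edge with any given label at each vertex, parameterizes a prefix-closed language $L\subset S^*$ if $L$ is exactly the set of words read along directed paths starting at $v_1$; a prefix-closed language is regular iff it is parameterized by some such $\Gamma$. A combing of $G$ with respect to $S$ is a prefix-closed regular language $L\subset S^*$ such that evaluation $L\to G$ is a bijection and every $w\in L$ is geodesic ($|w|=|\overline{w}|$). Bicombable. $\phi:G\to\mathbb{Z}$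 is weakly combable with respect to $S,L$ if there are a digraph $\Gamma$ parameterizing $L$ and a function $d\phi$ from its vertices to $\mathbb{Z}$ with $\phi(\overline{w})=\sum_{i=0}^{|w|}d\phi(\gamma(i))$ for all $w\in L$, where $\gamma$ is the path in $\Gamma$ starting at $v_1$ corresponding to $w$ and $\gamma(i)$ is the vertex reached after $i$ edges ($\gamma(0)=v_1$). It is bicombable if moreover there is $C$ with $|\phi(as)-\phi(a)|\le C$ and $|\phi(sa)-\phi(a)|\le C$ for all $a\in G$, $s\in S$. The measure $\widehat{\nu}$. There are $\lambda>1$, $K\ge1$ with $K^{-1}\lambda^n\le|G_n|\le K\lambda^n$ for all $n\ge1$ (Coornaert). Let $\widehat{\nu}_m=\frac1m\sum_{|g|\le m}\lambda^{-|g|}\delta_g$. For $g\in G$, $\mathrm{cone}(g)$ is the set of $g'\in G$ such that the word of $L$ representing $g'$ has the word of $L$ representing $g$ as a prefix. The measure $\widehat{\nu}$ on $G_n$ is given by $\widehat{\nu}(\{g\})=\lim_{m\to\infty}\widehat{\nu}_m(\mathrm{cone}(g))$ (the limit exists). *)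

theory Defs
  imports
    "HOL-Probability.Probability"
    "HOL-Algebra.Algebra"
    "HOL-Library.Sublist"
begin

section \<open>Generating sets, word length, hyperbolicity\<close>

definition eval_word :: "('a, 'b) monoid_scheme \<Rightarrow> 'a list \<Rightarrow> 'a" where
  "eval_word G w = foldr (\<lambda>x y. x \<otimes>\<^bsub>G\<^esub> y) w \<one>\<^bsub>G\<^esub>"

text \<open>The empty word is allowed and represents the identity, which has word length 0.\<close>

definition semigroup_generates :: "('a, 'b) monoid_scheme \<Rightarrow> 'a set \<Rightarrow> bool" where
  "semigroup_generates G S \<longleftrightarrow> S \<subseteq> carrier G \<and> eval_word G ` lists S = carrier G"

definition symmetric_subset :: "('a, 'b) monoid_scheme \<Rightarrow> 'a set \<Rightarrow> bool" where
  "symmetric_subset G S \<longleftrightarrow> (\<forall>s\<in>S. inv\<^bsub>G\<^esub> s \<in> S)"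

definition word_length :: "('a, 'b) monoid_scheme \<Rightarrow> 'a set \<Rightarrow> 'a \<Rightarrow> nat" where
  "word_length G S g = (LEAST n. \<exists>w\<in>lists S. length w = n \<and> eval_word G w = g)"

definition word_dist :: "('a, 'b) monoid_scheme \<Rightarrow> 'a set \<Rightarrow> 'a \<Rightarrow> 'a \<Rightarrow> nat" where
  "word_dist G S x y = word_length G S (inv\<^bsub>G\<^esub> x \<otimes>\<^bsub>G\<^esub> y)"

definition word_sphere :: "('a, 'b) monoid_scheme \<Rightarrow> 'a set \<Rightarrow> nat \<Rightarrow> 'a set" where
  "word_sphere G S n = {g \<in> carrier G. word_length G S g = n}"

text \<open>A geodesic edge path in the Cayley graph, given by its list of vertices.\<close>

definition cayley_geodesic ::
  "('a, 'b) monoid_scheme \<Rightarrow> 'a set \<Rightarrow> 'a \<Rightarrow> 'a \<Rightarrow> 'a list \<Rightarrow> bool" where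
  "cayley_geodesic G S x y p \<longleftrightarrow>
     p \<noteq> [] \<and> set p \<subseteq> carrier G \<and> hd p = x \<and> last p = y \<and>
     (\<forall>j<length p. \<forall>i\<le>j. word_dist G S (p ! i) (p ! j) = j - i)"

text \<open>
  Slim triangles. Triangles have their corners at group elements and their sides are compared
  vertex by vertex; replacing these by arbitrary geodesic triangles in the geometric realization
  of the Cayley graph only changes the constant \<open>\<delta>\<close>.
\<close>

definition cayley_hyperbolic :: "('a, 'b) monoid_scheme \<Rightarrow> 'a set \<Rightarrow> nat \<Rightarrow> bool" where
  "cayley_hyperbolic G S \<delta> \<longleftrightarrow>
     (\<forall>x y z p q r.
        cayley_geodesic G S x y p \<and> cayley_geodesic G S y z q \<and> cayley_geodesic G S x z r \<longrightarrow>
        (\<forall>u\<in>set p. \<exists>v\<in>set q \<union> set r. word_dist G S u v \<le> \<delta>))"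

definition word_hyperbolic :: "('a, 'b) monoid_scheme \<Rightarrow> bool" where
  "word_hyperbolic G \<longleftrightarrow>
     (\<exists>S \<delta>. finite S \<and> symmetric_subset G S \<and> semigroup_generates G S \<and> cayley_hyperbolic G S \<delta>)"

definition elementary :: "('a, 'b) monoid_scheme \<Rightarrow> bool" where
  "elementary G \<longleftrightarrow> (\<exists>x\<in>carrier G. finite (rcosets\<^bsub>G\<^esub> (generate G {x})))"


section \<open>Combings\<close>

text \<open>
  Digraphs with edges labeled by letters. Vertices are natural numbers, which is no restriction
  since the digraphs are finite.
\<close>

record 'a labeled_digraph =
  vertices :: "nat set"
  edges :: "(nat \<times> 'a \<times> nat) set"
  initial :: nat

definition finite_labeled_digraph :: "'a set \<Rightarrow> 'a labeled_digraph \<Rightarrow> bool" where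
  "finite_labeled_digraph S \<Gamma> \<longleftrightarrow>
     finite (vertices \<Gamma>) \<and> finite (edges \<Gamma>) \<and> initial \<Gamma> \<in> vertices \<Gamma> \<and>
     edges \<Gamma> \<subseteq> vertices \<Gamma> \<times> S \<times> vertices \<Gamma> \<and>
     (\<forall>u s v v'. (u, s, v) \<in> edges \<Gamma> \<and> (u, s, v') \<in> edges \<Gamma> \<longrightarrow> v = v')"

text \<open>\<open>\<gamma>\<close> is the list of vertices visited when reading \<open>w\<close> from the initial vertex.\<close>

definition reads :: "'a labeled_digraph \<Rightarrow> 'a list \<Rightarrow> nat list \<Rightarrow> bool" where
  "reads \<Gamma> w \<gamma> \<longleftrightarrow>
     length \<gamma> = Suc (length w) \<and> \<gamma> ! 0 = initial \<Gamma> \<and>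
     (\<forall>i<length w. (\<gamma> ! i, w ! i, \<gamma> ! Suc i) \<in> edges \<Gamma>)"

definition parameterizes :: "'a set \<Rightarrow> 'a labeled_digraph \<Rightarrow> 'a list set \<Rightarrow> bool" where
  "parameterizes S \<Gamma> L \<longleftrightarrow> finite_labeled_digraph S \<Gamma> \<and> L = {w. \<exists>\<gamma>. reads \<Gamma> w \<gamma>}"

definition prefix_closed :: "'a list set \<Rightarrow> bool" where
  "prefix_closed L \<longleftrightarrow> (\<forall>w\<in>L. \<forall>u. prefix u w \<longrightarrow> u \<in> L)"

definition regular_language :: "'a set \<Rightarrow> 'a list set \<Rightarrow> bool" where
  "regular_language S L \<longleftrightarrow> (\<exists>\<Gamma>. parameterizes S \<Gamma> L)"

definition combing :: "('a, 'b) monoid_scheme \<Rightarrow> 'a set \<Rightarrow> 'a list set \<Rightarrow> bool" where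
  "combing G S L \<longleftrightarrow>
     L \<subseteq> lists S \<and> prefix_closed L \<and> regular_language S L \<and>
     bij_betw (eval_word G) L (carrier G) \<and>
     (\<forall>w\<in>L. length w = word_length G S (eval_word G w))"


section \<open>Bicombable functions and quasimorphisms\<close>

definition weakly_combable ::
  "('a, 'b) monoid_scheme \<Rightarrow> 'a set \<Rightarrow> 'a list set \<Rightarrow> ('a \<Rightarrow> int) \<Rightarrow> bool" where
  "weakly_combable G S L \<phi> \<longleftrightarrow>
     (\<exists>\<Gamma> (d\<phi> :: nat \<Rightarrow> int). parameterizes S \<Gamma> L \<and>
        (\<forall>w\<in>L. \<forall>\<gamma>. reads \<Gamma> w \<gamma> \<longrightarrow> \<phi> (eval_word G w) = (\<Sum>i = 0..length w. d\<phi> (\<gamma> ! i))))"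

definition bicombable ::
  "('a, 'b) monoid_scheme \<Rightarrow> 'a set \<Rightarrow> 'a list set \<Rightarrow> ('a \<Rightarrow> int) \<Rightarrow> bool" where
  "bicombable G S L \<phi> \<longleftrightarrow>
     weakly_combable G S L \<phi> \<and>
     (\<exists>C. \<forall>a\<in>carrier G. \<forall>s\<in>S.
        \<bar>\<phi> (a \<otimes>\<^bsub>G\<^esub> s) - \<phi> a\<bar> \<le> C \<and> \<bar>\<phi> (s \<otimes>\<^bsub>G\<^esub> a) - \<phi> a\<bar> \<le> C)"

definition quasimorphism :: "('a, 'b) monoid_scheme \<Rightarrow> ('a \<Rightarrow> real) \<Rightarrow> bool" where
  "quasimorphism G \<phi> \<longleftrightarrow>
     (\<exists>D. \<forall>a\<in>carrier G. \<forall>b\<in>carrier G. \<bar>\<phi> a + \<phi> b - \<phi> (a \<otimes>\<^bsub>G\<^esub> b)\<bar> \<le> D)"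


section \<open>The measure on spheres\<close>

text \<open>
  The exponential growth base \<open>\<lambda>\<close>. The two-sided bound determines it uniquely; its existence for
  non-elementary hyperbolic groups is a theorem of Coornaert.
\<close>

definition growth_base :: "('a, 'b) monoid_scheme \<Rightarrow> 'a set \<Rightarrow> real" where
  "growth_base G S =
     (THE l. l > 1 \<and>
        (\<exists>K\<ge>1. \<forall>n\<ge>1. inverse K * l ^ n \<le> real (card (word_sphere G S n)) \<and>
                       real (card (word_sphere G S n)) \<le> K * l ^ n))"

definition combing_cone :: "('a, 'b) monoid_scheme \<Rightarrow> 'a list set \<Rightarrow> 'a \<Rightarrow> 'a set" where
  "combing_cone G L g =
     {g' \<in> carrier G. \<exists>w\<in>L. \<exists>w'\<in>L. eval_word G w = g \<and> eval_word G w' = g' \<and> prefix w w'}"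

definition nu_hat_approx :: "('a, 'b) monoid_scheme \<Rightarrow> 'a set \<Rightarrow> nat \<Rightarrow> 'a set \<Rightarrow> real" where
  "nu_hat_approx G S m A =
     1 / real m *
     (\<Sum>g | g \<in> carrier G \<and> word_length G S g \<le> m. inverse (growth_base G S ^ word_length G S g) * indicator A g)"

text \<open>The mass of the singleton \<open>{g}\<close>.\<close>

definition nu_hat :: "('a, 'b) monoid_scheme \<Rightarrow> 'a set \<Rightarrow> 'a list set \<Rightarrow> 'a \<Rightarrow> real" where
  "nu_hat G S L g = lim (\<lambda>m. nu_hat_approx G S m (combing_cone G L g))"

definition nu_hat_sphere ::
  "('a, 'b) monoid_scheme \<Rightarrow> 'a set \<Rightarrow> 'a list set \<Rightarrow> nat \<Rightarrow> 'a measure" where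
  "nu_hat_sphere G S L n =
     point_measure (word_sphere G S n)
       (\<lambda>g. ennreal (nu_hat G S L g / (\<Sum>h\<in>word_sphere G S n. nu_hat G S L h)))"

definition normal_distribution :: "real \<Rightarrow> real \<Rightarrow> real measure" where
  "normal_distribution \<mu> \<sigma> =
     (if \<sigma> = 0 then return borel \<mu> else density lborel (\<lambda>x. ennreal (normal_density \<mu> \<sigma> x)))"

end

theory Submission
  imports Defs
begin

text \<open>
  Reading a random element of \<open>G\<^sub>n\<close> along the combing gives a finite Markov chain on the vertices of the digraph:
  by the mean ergodic theorem for the adjacency matrix, the mass of \<open>g\<close> is \<open>\<rho>(v) / \<lambda>\<^sup>n\<close> for the vertex \<open>v\<close> reached
  by the word of \<open>g\<close>, where \<open>\<rho>\<close> is a nonnegative eigenvector. A central limit theorem holds on each recurrent class,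
  by second order perturbation of the twisted transition operator. It remains to see that all recurrent classes have
  mean \<open>0\<close> and the same variance. Instead of ergodicity on the boundary this uses growth tightness: the paths inside a
  recurrent class grow like \<open>\<lambda>\<^sup>n\<close>, hence every element of \<open>G\<close> is read by such a path up to a bounded error on both
  sides. In particular the inverse of a random path of one class is a path of any other class, at bounded cost for \<open>\<phi>\<close>
  (which changes sign) and for probabilities. So means of any two classes are opposite to each other, and the normal
  limits have comparable tails.
\<close>

section \<open>The word metric\<close>

text \<open>The digraph may have several recurrent classes, and nothing in the chain itself relates
  them; without such a relation the limit would be a mixture of normal laws. The relation has to
  come from the group. A class whose paths missed some element, even up to bounded errors, could be
  enlarged by inserting that element at many positions, which would produce on the order of
  \<open>n * lam ^ n\<close> elements in a ball that has room for only \<open>lam ^ n\<close>. Since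
  all paths of length \<open>n\<close> from a fixed vertex have probability
  \<open>lam ^ (- n)\<close> up to bounded factors, a boundedly-many-to-one map of words compares
  probabilities up to a constant. Such a constant cannot hide a nonzero mean (the windows become
  disjoint) nor different variances (the ratio of Gaussian tails is unbounded). The perturbed
  eigenfunction stays within order \<theta> of the constant 1, so periodic classes cause no trouble,
  and once means and variances agree its coefficients extend to the transient vertices.
  Hyperbolicity is given for some generating set but used for \<open>S\<close>; this is what the
  Morse lemma is for.\<close>

locale marked_group = group G for G :: "('a, 'b) monoid_scheme" (structure) +
  fixes S :: "'a set"
  assumes fin_S: "finite S"
    and sym_S: "symmetric_subset G S"
    and gen_S: "semigroup_generates G S"
begin

abbreviation ev where "ev \<equiv> eval_word G"
abbreviation len where "len \<equiv> word_length G S"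
abbreviation dst where "dst \<equiv> word_dist G S"

lemma S_carrier: "S \<subseteq> carrier G"
  using gen_S by (simp add: semigroup_generates_def)

lemma ev_Nil [simp]: "ev [] = \<one>"
  and ev_Cons [simp]: "ev (s # w) = s \<otimes> ev w"
  by (simp_all add: eval_word_def)

lemma ev_closed [simp, intro]: "w \<in> lists S \<Longrightarrow> ev w \<in> carrier G"
  using S_carrier by (induction w) auto

lemma ev_append: "u \<in> lists S \<Longrightarrow> w \<in> lists S \<Longrightarrow> ev (u @ w) = ev u \<otimes> ev w"
  using S_carrier by (induction u) (auto simp: m_assoc subset_iff)

lemma word_exists:
  assumes "g \<in> carrier G"
  obtains w where "w \<in> lists S" "ev w = g" "length w = len g"
proof -
  have "\<exists>n. \<exists>w\<in>lists S. length w = n \<and> ev w = g"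
    using gen_S assms unfolding semigroup_generates_def by (metis imageE)
  from LeastI_ex[OF this] show ?thesis
    using that unfolding word_length_def by blast
qed

lemma len_le: "w \<in> lists S \<Longrightarrow> len (ev w) \<le> length w"
  unfolding word_length_def by (rule Least_le) blast

lemma len_one [simp]: "len \<one> = 0"
  using len_le[of "[]"] by simp

lemma len_mult: 
  assumes "g \<in> carrier G" "h \<in> carrier G"
  shows "len (g \<otimes> h) \<le> len g + len h"
proof -
  obtain u w where "u \<in> lists S" "ev u = g" "length u = len g" "w \<in> lists S" "ev w = h" "length w = len h"
    using word_exists assms by metis
  then show ?thesis
    using len_le[of "u @ w"] by (simp add: ev_append)
qed

lemma inv_word: "w \<in> lists S \<Longrightarrow> \<exists>w'\<in>lists S. length w' = length w \<and> ev w' = inv (ev w)"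
proof (induction w)
  case Nil
  then show ?case by (intro bexI[of _ "[]"]) auto
next
  case (Cons s w)
  then obtain w' where w': "w' \<in> lists S" "length w' = length w" "ev w' = inv (ev w)" by auto
  have s: "s \<in> S" "inv s \<in> S" using Cons.prems sym_S by (auto simp: symmetric_subset_def)
  have "ev (w' @ [inv s]) = inv (ev (s # w))"
    using w' s S_carrier Cons.prems by (subst ev_append) (auto simp: inv_mult_group subset_iff)
  then show ?case
    using w' s by (intro bexI[of _ "w' @ [inv s]"]) auto
qed

lemma len_inv [simp]: 
  assumes "g \<in> carrier G" shows "len (inv g) = len g"
proof -
  have "len (inv h) \<le> len h" if "h \<in> carrier G" for h
    using that word_exists inv_word len_le by metis
  from this[of g] this[of "inv g"] show ?thesis using assms by simp
qed

lemma finite_ball: "finite {g \<in> carrier G. len g \<le> n}"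
proof (rule finite_subset)
  show "{g \<in> carrier G. len g \<le> n} \<subseteq> ev ` {w. set w \<subseteq> S \<and> length w \<le> n}"
  proof
    fix g assume g: "g \<in> {g \<in> carrier G. len g \<le> n}"
    then obtain w where w: "w \<in> lists S" "ev w = g" "length w = len g" using word_exists by blast
    then show "g \<in> ev ` {w. set w \<subseteq> S \<and> length w \<le> n}" using g by auto
  qed
  show "finite (ev ` {w. set w \<subseteq> S \<and> length w \<le> n})"
    using finite_lists_length_le[OF fin_S] by blast
qed

lemma finite_sphere: "finite (word_sphere G S n)"
  by (rule finite_subset[OF _ finite_ball[of n]]) (auto simp: word_sphere_def)

lemma dst_self [simp]: "x \<in> carrier G \<Longrightarrow> dst x x = 0"
  by (simp add: word_dist_def)

lemma dst_sym:
  assumes "x \<in> carrier G" "y \<in> carrier G" shows "dst x y = dst y x"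
proof -
  have "inv (inv x \<otimes> y) = inv y \<otimes> x" using assms by (simp add: inv_mult_group)
  then show ?thesis using assms len_inv[of "inv x \<otimes> y"] by (simp add: word_dist_def)
qed

lemma dst_triangle:
  assumes "x \<in> carrier G" "y \<in> carrier G" "z \<in> carrier G"
  shows "dst x z \<le> dst x y + dst y z"
proof -
  have "inv x \<otimes> z = (inv x \<otimes> y) \<otimes> (inv y \<otimes> z)"
    using assms by (metis inv_closed inv_solve_left m_assoc m_closed)
  then show ?thesis using assms len_mult[of "inv x \<otimes> y" "inv y \<otimes> z"] by (simp add: word_dist_def)
qed

lemma dst_left:
  assumes "x \<in> carrier G" "y \<in> carrier G" "a \<in> carrier G"
  shows "dst (a \<otimes> x) (a \<otimes> y) = dst x y"
proof -
  have "inv a \<otimes> (a \<otimes> y) = y" using assms by (simp add: m_assoc[symmetric])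
  then show ?thesis using assms by (simp add: word_dist_def inv_mult_group m_assoc)
qed

lemma dst_one [simp]: "x \<in> carrier G \<Longrightarrow> dst \<one> x = len x" "x \<in> carrier G \<Longrightarrow> dst x \<one> = len x"
  by (simp_all add: word_dist_def)

lemma dst_mult [simp]: "x \<in> carrier G \<Longrightarrow> y \<in> carrier G \<Longrightarrow> dst x (x \<otimes> y) = len y"
  by (simp add: word_dist_def m_assoc[symmetric])

lemma dst_mult' : "x \<in> carrier G \<Longrightarrow> y \<in> carrier G \<Longrightarrow> dst (x \<otimes> y) x = len y"
  by (metis dst_mult dst_sym m_closed)

text \<open>Word length is subadditive and never exceeds the number of letters, so equality for the
  whole word forces equality in every factor.\<close>

lemma geodesic_factor:
  assumes "u @ v @ w \<in> lists S" "length (u @ v @ w) = len (ev (u @ v @ w))"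
  shows "length v = len (ev v)"
proof -
  have *: "u \<in> lists S" "v \<in> lists S" "w \<in> lists S" using assms by auto
  have "len (ev (u @ v @ w)) \<le> len (ev u) + (len (ev v) + len (ev w))"
    using * by (simp add: ev_append) (meson add_left_mono ev_closed len_mult le_trans m_closed)
  then show ?thesis
    using assms(2) len_le[OF *(1)] len_le[OF *(2)] len_le[OF *(3)] by simp
qed

lemma dst_take:
  assumes "w \<in> lists S" "length w = len (ev w)" "i \<le> j" "j \<le> length w"
  shows "dst (ev (take i w)) (ev (take j w)) = j - i"
proof -
  have w: "w = take i w @ take (j - i) (drop i w) @ drop j w"
    by (metis append.assoc append_take_drop_id assms(3) le_add_diff_inverse take_add)
  have l: "take i w \<in> lists S" "take (j - i) (drop i w) \<in> lists S"
    using assms(1) by (auto dest: in_set_takeD in_set_dropD)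
  have "take j w = take i w @ take (j - i) (drop i w)"
    by (metis assms(3) le_add_diff_inverse take_add)
  then have "ev (take j w) = ev (take i w) \<otimes> ev (take (j - i) (drop i w))"
    using l by (simp add: ev_append)
  then have "dst (ev (take i w)) (ev (take j w)) = len (ev (take (j - i) (drop i w)))"
    using l by simp
  also have "\<dots> = length (take (j - i) (drop i w))"
    using geodesic_factor[of "take i w" "take (j - i) (drop i w)" "drop j w"] w assms by simp
  finally show ?thesis using assms by simp
qed

end

section \<open>Slim triangles and quasi-isometries\<close>

text \<open>Discrete substitute for connectedness: just before the first failure of \<open>P\<close>
  the condition \<open>P\<close> still holds, and at the failure \<open>Q\<close> has taken over. It
  yields a point of a geodesic that is close to two sets at once, up to one step.\<close>

lemma discrete_crossing:
  fixes n :: nat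
  assumes "P 0" "Q n" "\<And>t. t \<le> n \<Longrightarrow> P t \<or> Q t"
  obtains t t' where "t \<le> n" "t' \<le> n" "t' = t \<or> t' = Suc t" "P t" "Q t'"
proof (cases "\<forall>t\<le>n. P t")
  case True
  then show ?thesis using assms(2) that[of n n] by auto
next
  case False
  define s where "s = (LEAST t. \<not> P t)"
  have s: "\<not> P s" "s \<le> n" using False unfolding s_def by (metis LeastI, metis LeastI Least_le le_trans)
  have "s \<noteq> 0" using s assms(1) by metis
  then obtain r where r: "s = Suc r" by (cases s) auto
  have "P r" using not_less_Least[of r "\<lambda>t. \<not> P t"] r unfolding s_def by simp
  moreover have "Q s" using assms(3) s by blast
  ultimately show ?thesis using that[of r s] r s by simp
qed

text \<open>The metric is abstract because two word metrics on the same carrier have to be compared: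
  the one for which slimness is known and the one of the given generating set.\<close>

locale geo_space =
  fixes M :: "'a set" and d :: "'a \<Rightarrow> 'a \<Rightarrow> nat"
  assumes d_self [simp]: "x \<in> M \<Longrightarrow> d x x = 0"
    and d_sym: "x \<in> M \<Longrightarrow> y \<in> M \<Longrightarrow> d x y = d y x"
    and d_tri: "x \<in> M \<Longrightarrow> y \<in> M \<Longrightarrow> z \<in> M \<Longrightarrow> d x z \<le> d x y + d y z"
    and d_geo: "x \<in> M \<Longrightarrow> y \<in> M \<Longrightarrow> \<exists>p. p 0 = x \<and> p (d x y) = y \<and> (\<forall>i\<le>d x y. p i \<in> M) \<and>
        (\<forall>i j. i \<le> j \<longrightarrow> j \<le> d x y \<longrightarrow> d (p i) (p j) = j - i)"
begin

definition geo :: "'a \<Rightarrow> 'a \<Rightarrow> (nat \<Rightarrow> 'a) \<Rightarrow> bool" where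
  "geo x y p \<longleftrightarrow> p 0 = x \<and> p (d x y) = y \<and> (\<forall>i\<le>d x y. p i \<in> M) \<and>
        (\<forall>i j. i \<le> j \<longrightarrow> j \<le> d x y \<longrightarrow> d (p i) (p j) = j - i)"

definition seg :: "'a \<Rightarrow> 'a \<Rightarrow> 'a set \<Rightarrow> bool" where
  "seg x y A \<longleftrightarrow> (\<exists>p. geo x y p \<and> A = p ` {..d x y})"

definition slim :: "nat \<Rightarrow> bool" where
  "slim \<delta> \<longleftrightarrow> (\<forall>x y z A B C. seg x y A \<and> seg y z B \<and> seg x z C \<longrightarrow> (\<forall>u\<in>A. \<exists>v\<in>B \<union> C. d u v \<le> \<delta>))"

text \<open>Gromov's four-point condition, written with sums of distances rather than Gromov
  products in order to avoid halves of integers.\<close>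

definition four_point :: "nat \<Rightarrow> bool" where
  "four_point \<kappa> \<longleftrightarrow> (\<forall>w\<in>M. \<forall>x\<in>M. \<forall>y\<in>M. \<forall>z\<in>M. d x z + d w y \<le> max (d x y + d w z) (d y z + d w x) + \<kappa>)"

lemma geo_exists: "x \<in> M \<Longrightarrow> y \<in> M \<Longrightarrow> \<exists>p. geo x y p"
  using d_geo unfolding geo_def by blast

lemma seg_exists: "x \<in> M \<Longrightarrow> y \<in> M \<Longrightarrow> \<exists>A. seg x y A"
  using geo_exists unfolding seg_def by blast

lemma geo_in: "geo x y p \<Longrightarrow> i \<le> d x y \<Longrightarrow> p i \<in> M"
  by (auto simp: geo_def)

lemma geo_ends: "geo x y p \<Longrightarrow> x \<in> M" "geo x y p \<Longrightarrow> y \<in> M"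
  unfolding geo_def by (metis le0, metis order_refl)

lemma geo_d: "geo x y p \<Longrightarrow> i \<le> j \<Longrightarrow> j \<le> d x y \<Longrightarrow> d (p i) (p j) = j - i"
  by (auto simp: geo_def)

lemma geo_start: "geo x y p \<Longrightarrow> i \<le> d x y \<Longrightarrow> d x (p i) = i"
  and geo_end: "geo x y p \<Longrightarrow> i \<le> d x y \<Longrightarrow> d (p i) y = d x y - i"
  unfolding geo_def by (metis diff_zero le0, metis order_refl)

lemma geo_rev: 
  assumes "geo x y p" shows "geo y x (\<lambda>i. p (d x y - i))"
proof -
  have e: "x \<in> M" "y \<in> M" using geo_ends assms by auto
  have s: "d y x = d x y" using e d_sym by simp
  have "d (p (d x y - i)) (p (d x y - j)) = j - i" if "i \<le> j" "j \<le> d x y" for i j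
    using that geo_d[OF assms, of "d x y - j" "d x y - i"]
      d_sym[OF geo_in[OF assms, of "d x y - i"] geo_in[OF assms, of "d x y - j"]] by simp
  then show ?thesis using assms unfolding geo_def s by auto
qed

lemma seg_sym: assumes "seg x y A" shows "seg y x A"
proof -
  from assms obtain p where p: "geo x y p" "A = p ` {..d x y}" unfolding seg_def by blast
  have "d y x = d x y" using geo_ends[OF p(1)] d_sym by simp
  moreover have "A = (\<lambda>i. p (d x y - i)) ` {..d x y}"
  proof -
    have "i \<in> (\<lambda>i. d x y - i) ` {..d x y}" if "i \<le> d x y" for i
      using that by (intro image_eqI[of _ _ "d x y - i"]) auto
    then have "(\<lambda>i. d x y - i) ` {..d x y} = {..d x y}" by auto
    then show ?thesis unfolding p(2) image_image[of p "\<lambda>i. d x y - i", symmetric] by simp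
  qed
  ultimately show ?thesis unfolding seg_def using geo_rev[OF p(1)] by metis
qed

lemma seg_in: "seg x y A \<Longrightarrow> u \<in> A \<Longrightarrow> u \<in> M"
  by (auto simp: seg_def geo_in)

lemma seg_ends: "seg x y A \<Longrightarrow> x \<in> M" "seg x y A \<Longrightarrow> y \<in> M"
  by (auto simp: seg_def dest: geo_ends)

lemma seg_ends_in: "seg x y A \<Longrightarrow> x \<in> A" "seg x y A \<Longrightarrow> y \<in> A"
  unfolding seg_def geo_def by (metis atMost_iff image_eqI le0, metis atMost_iff image_eqI order_refl)

lemma seg_d: "seg x y A \<Longrightarrow> u \<in> A \<Longrightarrow> d x u + d u y = d x y"
  unfolding seg_def by (auto simp: geo_start geo_end)

lemma seg_sub:
  assumes "geo x y p" "a \<le> b" "b \<le> d x y"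
  shows "seg (p a) (p b) (p ` {a..b})"
proof -
  have db: "d (p a) (p b) = b - a" using geo_d assms by blast
  have "p ` {a..b} = (\<lambda>i. p (a + i)) ` {..b - a}"
  proof -
    have "(\<lambda>i. a + i) ` {..b - a} = {a..b}"
      using assms(2) image_add_atLeastAtMost[of a 0 "b - a"] by (simp add: atMost_atLeast0)
    then show ?thesis unfolding image_image[of p "\<lambda>i. a + i", symmetric] by simp
  qed
  moreover have "geo (p a) (p b) (\<lambda>i. p (a + i))"
    unfolding geo_def db using assms by (auto simp: geo_in geo_d)
  ultimately show ?thesis unfolding seg_def db by blast
qed

lemma slimD: "slim \<delta> \<Longrightarrow> seg x y A \<Longrightarrow> seg y z B \<Longrightarrow> seg x z C \<Longrightarrow> u \<in> A \<Longrightarrow> \<exists>v\<in>B \<union> C. d u v \<le> \<delta>"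
  unfolding slim_def by blast

lemma slim_mono: "slim \<delta> \<Longrightarrow> \<delta> \<le> \<epsilon> \<Longrightarrow> slim \<epsilon>"
  unfolding slim_def by (meson le_trans)

text \<open>Bisection: splitting the chain at its midpoint replaces the segment by the two other
  sides of a triangle and costs \<delta>. After \<open>N\<close> halvings at most one step of length
  \<open>k\<close> is left, so the distance grows only logarithmically with the number of
  steps.\<close>

lemma slim_log:
  assumes "slim \<delta>" "m \<le> 2 ^ N" "\<And>i. i \<le> m \<Longrightarrow> c i \<in> M" "\<And>i. i < m \<Longrightarrow> d (c i) (c (Suc i)) \<le> k"
    "seg (c 0) (c m) A" "u \<in> A"
  shows "\<exists>i\<le>m. d u (c i) \<le> N * \<delta> + k"
  using assms(2-)
proof (induction N arbitrary: m c A u)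
  case 0
  have uX: "u \<in> M" using 0 seg_in by blast
  have "d (c 0) (c m) \<le> k"
  proof (cases "m = 0")
    case True then show ?thesis using 0 by simp
  next
    case False
    then have "m = 1" using 0 by simp
    then show ?thesis using 0(3)[of 0] by simp
  qed
  then have "d u (c 0) \<le> k" using seg_d[OF 0(4,5)] d_sym[OF uX, of "c 0"] 0(2)[of 0] by simp
  then show ?case by (intro exI[of _ 0]) simp
next
  case (Suc N)
  define h where "h = m div 2"
  have h: "h \<le> m" "h \<le> 2 ^ N" "m - h \<le> 2 ^ N" using Suc.prems(1) unfolding h_def by auto
  obtain B where B: "seg (c 0) (c h) B" using seg_exists Suc.prems(2) h by blast
  obtain C where C: "seg (c h) (c m) C" using seg_exists Suc.prems(2) h by blast
  obtain v where v: "v \<in> B \<union> C" "d u v \<le> \<delta>"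
    using slimD[OF assms(1) Suc.prems(4) seg_sym[OF C] B Suc.prems(5)] by blast
  have M: "u \<in> M" "v \<in> M" using v(1) B C Suc.prems seg_in by blast+
  have "\<exists>i\<le>m. d v (c i) \<le> N * \<delta> + k"
  proof (cases "v \<in> B")
    case True
    have "\<exists>i\<le>h. d v (c i) \<le> N * \<delta> + k"
      using h B True by (intro Suc.IH[of h c B v]) (auto intro: Suc.prems(2,3))
    then show ?thesis using h(1) le_trans by blast
  next
    case False
    then have "v \<in> C" using v by blast
    then have "\<exists>i\<le>m-h. d v (c (h + i)) \<le> N * \<delta> + k"
      using Suc.IH[of "m - h" "\<lambda>i. c (h + i)" C v] C h Suc.prems(2,3) by simp
    then obtain i where "i \<le> m - h" "d v (c (h + i)) \<le> N * \<delta> + k" by blast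
    then show ?thesis using h(1) by (intro exI[of _ "h + i"]) auto
  qed
  then obtain i where i: "i \<le> m" "d v (c i) \<le> N * \<delta> + k" by blast
  have "d u (c i) \<le> d u v + d v (c i)" using d_tri M i Suc.prems(2) by blast
  then show ?case using i v by (intro exI[of _ i]) auto
qed

text \<open>Along the side from \<open>x\<close> to \<open>y\<close>, closeness to the side
  \<open>x w\<close> gives way to closeness to the side \<open>y w\<close>. The point
  \<open>u\<close> where this happens is close to both, so its distance to \<open>w\<close> exceeds
  the Gromov product of \<open>x\<close> and \<open>y\<close> at \<open>w\<close> by at most a
  constant.\<close>

lemma slim_imp_projection:
  assumes "slim \<delta>" "seg x y A" "w \<in> M"
  shows "\<exists>u\<in>A. 2 * d w u + d x y \<le> d w x + d w y + (4 * \<delta> + 2)"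
proof -
  obtain p where p: "geo x y p" "A = p ` {..d x y}" using assms unfolding seg_def by blast
  have xy: "x \<in> M" "y \<in> M" using seg_ends assms by auto
  obtain B where B: "seg x w B" using seg_exists xy assms by blast
  obtain C where C: "seg y w C" using seg_exists xy assms by blast
  let ?P = "\<lambda>t. \<exists>v\<in>B. d (p t) v \<le> \<delta>" let ?Q = "\<lambda>t. \<exists>v\<in>C. d (p t) v \<le> \<delta>"
  have "d (p 0) x \<le> \<delta>" "d (p (d x y)) y \<le> \<delta>" using p xy unfolding geo_def by auto
  then have "?P 0" "?Q (d x y)" using seg_ends_in[OF B] seg_ends_in[OF C] by blast+
  moreover have "?P t \<or> ?Q t" if "t \<le> d x y" for t
    using slimD[OF assms(1) assms(2) C B, of "p t"] p that by blast
  ultimately obtain t t' where t: "t \<le> d x y" "t' \<le> d x y" "t' = t \<or> t' = Suc t" "?P t" "?Q t'"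
    by (rule discrete_crossing)
  obtain v v' where v: "v \<in> B" "d (p t) v \<le> \<delta>" "v' \<in> C" "d (p t') v' \<le> \<delta>" using t by blast
  have M: "p t \<in> M" "p t' \<in> M" "v \<in> M" "v' \<in> M" using t v seg_in[OF B] seg_in[OF C] geo_in[OF p(1)] by auto
  have "d (p t) (p t') \<le> 1" using t geo_d[OF p(1), of t t'] M by auto
  moreover have "d x v + d v w = d x w" "d y v' + d v' w = d y w" using seg_d[OF B] seg_d[OF C] v by auto
  moreover have "d x (p t) = t" "d (p t) y = d x y - t" using geo_start geo_end p t by auto
  moreover have "d x (p t) \<le> d x v + d v (p t)" "d y (p t) \<le> d y v' + d v' (p t)"
     "d w (p t) \<le> d w v + d v (p t)" "d w (p t) \<le> d w v' + d v' (p t)"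
     "d v' (p t) \<le> d v' (p t') + d (p t') (p t)"
    using d_tri M xy assms by auto
  moreover have "d x w = d w x" "d y w = d w y" "d v w = d w v" "d v' w = d w v'" "d v (p t) = d (p t) v"
    "d v' (p t') = d (p t') v'" "d (p t) (p t') = d (p t') (p t)" "d (p t) y = d y (p t)"
    using d_sym M xy assms by auto
  ultimately have "2 * d w (p t) + d x y \<le> d w x + d w y + (4 * \<delta> + 2)"
    using v t(1) by linarith
  then show ?thesis using p t by blast
qed

text \<open>Project \<open>w\<close> to the segment from \<open>x\<close> to \<open>z\<close> and
  move on to a point \<open>v\<close> of one of the other two sides. Passing through
  \<open>v\<close> bounds the sum of the distances from \<open>w\<close> to both ends of that side.
  The move costs \<delta>, counted twice, on top of the \<open>4 * \<delta> + 2\<close> of the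
  projection.\<close>

lemma slim_imp_four_point:
  assumes "slim \<delta>"
  shows "four_point (6 * \<delta> + 2)"
  unfolding four_point_def
proof (intro ballI)
  fix w x y z assume M: "w \<in> M" "x \<in> M" "y \<in> M" "z \<in> M"
  obtain A where A: "seg x z A" using seg_exists M by blast
  obtain B where B: "seg x y B" using seg_exists M by blast
  obtain C where C: "seg y z C" using seg_exists M by blast
  obtain u where u: "u \<in> A" "2 * d w u + d x z \<le> d w x + d w z + (4 * \<delta> + 2)"
    using slim_imp_projection[OF assms A M(1)] by blast
  obtain v where v: "v \<in> B \<union> C" "d u v \<le> \<delta>"
    using slimD[OF assms A seg_sym[OF C] B u(1)] by blast
  have uv: "u \<in> M" "v \<in> M" using u v A B C seg_in by blast+
  have "d w v \<le> d w u + d u v" using d_tri M uv by blast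
  have tri: "d w x \<le> d w v + d x v" "d w y \<le> d w v + d v y" "d w y \<le> d w v + d y v" "d w z \<le> d w v + d v z"
    using d_tri[OF M(1) uv(2)] d_sym[OF _ uv(2)] M by metis+
  show "d x z + d w y \<le> max (d x y + d w z) (d y z + d w x) + (6 * \<delta> + 2)"
  proof (cases "v \<in> B")
    case True
    have "d x v + d v y = d x y" using seg_d[OF B True] .
    then have "d w x + d w y \<le> 2 * d w v + d x y" using tri by linarith
    then have "d x z + d w y \<le> (d x y + d w z) + (6 * \<delta> + 2)"
      using u v \<open>d w v \<le> d w u + d u v\<close> by linarith
    then show ?thesis by (rule order_trans) simp
  next
    case False
    then have "d y v + d v z = d y z" using v seg_d[OF C] by blast
    then have "d w y + d w z \<le> 2 * d w v + d y z" using tri by linarith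
    then have "d x z + d w y \<le> (d y z + d w x) + (6 * \<delta> + 2)"
      using u v \<open>d w v \<le> d w u + d u v\<close> by linarith
    then show ?thesis by (rule order_trans) simp
  qed
qed

end

lemma square_le_two_power: "4 \<le> n \<Longrightarrow> n * n \<le> (2::nat) ^ n"
proof (induction n rule: dec_induct)
  case base then show ?case by simp
next
  case (step n)
  have "Suc n * Suc n = n * n + (2 * n + 1)" by simp
  also have "2 * n + 1 \<le> 4 * n" using step by simp
  also have "4 * n \<le> n * n" using step by simp
  finally show ?case using step by simp
qed

lemma linear_le_two_power: "\<exists>n0. \<forall>n\<ge>n0. a * n + b \<le> (2::nat) ^ n"
proof (intro exI allI impI)
  fix n assume n: "a + b + 4 \<le> n"
  then have "b \<le> b * n" by (cases n) auto
  moreover have "(a + b + 4) * n = a * n + b * n + 4 * n" by (simp add: algebra_simps)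
  ultimately have "a * n + b \<le> (a + b + 4) * n" by linarith
  also have "\<dots> \<le> n * n" using n by (intro mult_right_mono) auto
  also have "\<dots> \<le> 2 ^ n" using n by (intro square_le_two_power) auto
  finally show "a * n + b \<le> 2 ^ n" .
qed

section \<open>The Morse lemma and transport of slimness between bi-Lipschitz equivalent
  metrics\<close>

locale qi_pair = src: geo_space M d' + tgt: geo_space M d
  for M :: "'a set" and d' d :: "'a \<Rightarrow> 'a \<Rightarrow> nat" +
  fixes k \<delta> :: nat
  assumes d_le: "x \<in> M \<Longrightarrow> y \<in> M \<Longrightarrow> d x y \<le> k * d' x y"
    and d'_le: "x \<in> M \<Longrightarrow> y \<in> M \<Longrightarrow> d' x y \<le> k * d x y"
    and slim_src: "src.slim \<delta>" and \<delta>_pos: "1 \<le> \<delta>"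
begin

text \<open>
  One step of the bootstrap in the Morse lemma: around a point \<open>u\<close> of the \<open>d'\<close>-geodesic \<open>p\<close>, cut out
  the quadrilateral whose corners are two points of \<open>p\<close> at distance \<open>2 D\<close> from \<open>u\<close> and nearby points of \<open>c\<close>.
  Its short sides are too far from \<open>u\<close>, and the long one stays logarithmically close to \<open>c\<close>.
\<close>

lemma morse_step:
  assumes c: "tgt.geo x y c" and p: "src.geo x y p"
    and D: "D = (n + 3) * \<delta> + k" "6 * k * D \<le> 2 ^ n"
    and near: "\<forall>t\<le>d' x y. \<exists>i\<le>d x y. d' (p t) (c i) \<le> D"
    and t: "t \<le> d' x y"
  shows "\<exists>i\<le>d x y. d' (p t) (c i) \<le> (n + 2) * \<delta> + k"
proof -
  let ?u = "p t"
  define t1 where "t1 = t - 2 * D"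
  define t2 where "t2 = min (d' x y) (t + 2 * D)"
  have tt: "t1 \<le> t" "t \<le> t2" "t2 \<le> d' x y" using t unfolding t1_def t2_def by auto
  have xy: "x \<in> M" "y \<in> M" using src.geo_ends p by auto
  have pM: "p i \<in> M" if "i \<le> d' x y" for i using src.geo_in p that by blast
  have cM: "c i \<in> M" if "i \<le> d x y" for i using tgt.geo_in c that by blast
  have cp: "c 0 = p 0" "c (d x y) = p (d' x y)" using c p unfolding src.geo_def tgt.geo_def by auto
  \<comment> \<open>Close to an end of \<open>p\<close> there is no point at distance
    \<open>2 * D\<close>; the corner is then the common endpoint of \<open>p\<close> and
    \<open>c\<close>, and the short side degenerates. The last conjunct records which case
    occurred.\<close>
  obtain i1 where i1: "i1 \<le> d x y" "d' (p t1) (c i1) \<le> D" "2 * D < t \<or> p t1 = c i1"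
  proof (cases "2 * D < t")
    case True
    then show ?thesis using near tt that by (meson le_trans)
  next
    case False
    then have "t1 = 0" unfolding t1_def by simp
    then show ?thesis using that[of 0] cp xy pM[of 0] by simp
  qed
  obtain i2 where i2: "i2 \<le> d x y" "d' (p t2) (c i2) \<le> D" "t + 2 * D < d' x y \<or> p t2 = c i2"
  proof (cases "t + 2 * D < d' x y")
    case True
    then show ?thesis using near tt that by (meson le_trans)
  next
    case False
    then have "t2 = d' x y" unfolding t2_def by simp
    then show ?thesis using that[of "d x y"] cp xy pM[of "d' x y"] by simp
  qed
  have M: "?u \<in> M" "p t1 \<in> M" "p t2 \<in> M" "c i1 \<in> M" "c i2 \<in> M"
    using tt t i1 i2 pM cM by auto
  have seg0: "src.seg (p t1) (p t2) (p ` {t1..t2})" using src.seg_sub[OF p] tt by auto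
  have u0: "?u \<in> p ` {t1..t2}" using tt by auto
  have dt: "d' (p t1) ?u = t - t1" "d' ?u (p t2) = t2 - t" "d' (p t1) (p t2) = t2 - t1"
    using src.geo_d[OF p] tt by auto
  obtain A where A: "src.seg (p t1) (c i1) A" using src.seg_exists M by blast
  obtain B where B: "src.seg (c i1) (c i2) B" using src.seg_exists M by blast
  obtain C where C: "src.seg (c i2) (p t2) C" using src.seg_exists M by blast
  obtain E where E: "src.seg (p t1) (c i2) E" using src.seg_exists M by blast
  have "\<exists>v\<in>A \<union> B \<union> C. d' ?u v \<le> 2 * \<delta>"
  proof -
    obtain v where v: "v \<in> E \<union> C" "d' ?u v \<le> \<delta>"
      using src.slimD[OF slim_src seg0 src.seg_sym[OF C] E u0] by blast
    show ?thesis
    proof (cases "v \<in> C")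
      case True then show ?thesis using v by force
    next
      case False
      then have "v \<in> E" using v by blast
      then obtain v' where v': "v' \<in> A \<union> B" "d' v v' \<le> \<delta>"
        using src.slimD[OF slim_src E src.seg_sym[OF B] A] by blast
      have "v \<in> M" "v' \<in> M" using \<open>v \<in> E\<close> v' E A B src.seg_in by blast+
      then have "d' ?u v' \<le> d' ?u v + d' v v'" using src.d_tri M by blast
      then show ?thesis using v v' by force
    qed
  qed
  then obtain v where v: "v \<in> A \<union> B \<union> C" "d' ?u v \<le> 2 * \<delta>" by blast
  have vM: "v \<in> M" using v A B C src.seg_in by blast
  have D2: "2 * \<delta> < D" unfolding D using \<delta>_pos by (simp add: algebra_simps)
  consider "v \<in> A" | "v \<in> B" | "v \<in> C" using v by blast
  then show ?thesis
  proof cases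
    case 1
    have "d' (p t1) v + d' v (c i1) = d' (p t1) (c i1)" using src.seg_d[OF A 1] .
    moreover have "d' (p t1) ?u \<le> d' (p t1) v + d' v ?u" using src.d_tri M vM by blast
    moreover have "d' v ?u = d' ?u v" using src.d_sym M vM by blast
    moreover have "d' (p t1) ?u = 2 * D" if "2 * D < t" using dt that unfolding t1_def by simp
    ultimately have "p t1 = c i1" using i1 v D2 by linarith
    then have "d' (c i1) v + d' v (c i1) = 0" using src.seg_d[OF A 1] M by simp
    moreover have "d' ?u (c i1) \<le> d' ?u v + d' v (c i1)" using src.d_tri M vM by blast
    ultimately have "d' ?u (c i1) \<le> 2 * \<delta>" using v by linarith
    then show ?thesis using i1 by (intro exI[of _ i1]) (auto simp: algebra_simps)
  next
    case 3
    have "d' (c i2) v + d' v (p t2) = d' (c i2) (p t2)" using src.seg_d[OF C 3] .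
    moreover have "d' ?u (p t2) \<le> d' ?u v + d' v (p t2)" using src.d_tri M vM by blast
    moreover have "d' (c i2) (p t2) = d' (p t2) (c i2)" using src.d_sym M vM by blast
    moreover have "d' ?u (p t2) = 2 * D" if "t + 2 * D < d' x y" using dt that unfolding t2_def by simp
    ultimately have "p t2 = c i2" using i2 v D2 by linarith
    then have "d' (c i2) v + d' v (c i2) = 0" using src.seg_d[OF C 3] M by simp
    moreover have "d' ?u (c i2) \<le> d' ?u v + d' v (c i2)" using src.d_tri M vM by blast
    ultimately have "d' ?u (c i2) \<le> 2 * \<delta>" using v by linarith
    then show ?thesis using i2 by (intro exI[of _ i2]) (auto simp: algebra_simps)
  next
    case 2
    have "t \<le> t1 + 2 * D" "t2 \<le> t + 2 * D" unfolding t1_def t2_def by auto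
    then have "d' (p t1) (p t2) \<le> 4 * D" using dt(3) by linarith
    moreover have "d' (c i1) (c i2) \<le> d' (c i1) (p t1) + d' (p t1) (c i2)"
      "d' (p t1) (c i2) \<le> d' (p t1) (p t2) + d' (p t2) (c i2)" using src.d_tri M by blast+
    moreover have "d' (c i1) (p t1) = d' (p t1) (c i1)" using src.d_sym M by blast
    ultimately have "d' (c i1) (c i2) \<le> 6 * D" using i1 i2 by linarith
    then have "d (c i1) (c i2) \<le> k * (6 * D)" using d_le M by (meson le_trans mult_le_mono2)
    then have le: "d (c i1) (c i2) \<le> 2 ^ n" using D(2) by (simp add: algebra_simps)
    have step: "d' (c i) (c (Suc i)) \<le> k" if "i < d x y" for i
    proof -
      have "d (c i) (c (Suc i)) = 1" using tgt.geo_d[OF c, of i "Suc i"] that by simp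
      then show ?thesis using d'_le[OF cM[of i] cM[of "Suc i"]] that by simp
    qed
    have "\<exists>i\<le>d x y. d' v (c i) \<le> n * \<delta> + k"
    proof (cases "i1 \<le> i2")
      case True
      then have m: "i2 - i1 \<le> 2 ^ n" using le tgt.geo_d[OF c] i2 by simp
      obtain i where "i \<le> i2 - i1" "d' v (c (i1 + i)) \<le> n * \<delta> + k"
        using src.slim_log[OF slim_src m, of "\<lambda>i. c (i1 + i)" k B v] cM step i2 B 2 True by auto
      then show ?thesis using True i2 by (intro exI[of _ "i1 + i"]) auto
    next
      case False
      then have m: "i1 - i2 \<le> 2 ^ n" using le tgt.geo_d[OF c, of i2 i1] i1 M tgt.d_sym[of "c i1" "c i2"] by simp
      obtain i where "i \<le> i1 - i2" "d' v (c (i2 + i)) \<le> n * \<delta> + k"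
        using src.slim_log[OF slim_src m, of "\<lambda>i. c (i2 + i)" k B v] cM step i1 src.seg_sym[OF B] 2 False by auto
      then show ?thesis using False i1 by (intro exI[of _ "i2 + i"]) auto
    qed
    then obtain i where i: "i \<le> d x y" "d' v (c i) \<le> n * \<delta> + k" by blast
    have "d' ?u (c i) \<le> d' ?u v + d' v (c i)" using src.d_tri M vM cM i by blast
    then show ?thesis using i v by (intro exI[of _ i]) (auto simp: algebra_simps)
  qed
qed

text \<open>Each use of \<open>morse_step\<close> lowers the index \<open>n\<close> in the bound
  \<open>(n + 3) * \<delta> + k\<close> by one, as long as the exponential condition holds, which is
  the case from \<open>n0\<close> on. The descent starts from the trivial bound given by the length
  of \<open>p\<close> and stops at a constant that depends on \<open>n0\<close> only.\<close>

lemma morse_near: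
  "\<exists>H. \<forall>x y c p. tgt.geo x y c \<and> src.geo x y p \<longrightarrow> (\<forall>t\<le>d' x y. \<exists>i\<le>d x y. d' (p t) (c i) \<le> H)"
proof -
  obtain n0 where n0: "\<And>n. n0 \<le> n \<Longrightarrow> (6 * k * \<delta>) * n + 6 * k * (3 * \<delta> + k) \<le> 2 ^ n"
    using linear_le_two_power by blast
  show ?thesis
  proof (rule exI[of _ "(n0 + 2) * \<delta> + k"], intro allI impI)
    fix x y c p t assume cp: "tgt.geo x y c \<and> src.geo x y p" and t: "t \<le> d' x y"
    let ?near = "\<lambda>D. \<forall>t\<le>d' x y. \<exists>i\<le>d x y. d' (p t) (c i) \<le> D"
    have "?near ((n0 + 2) * \<delta> + k)" if "?near ((n0 + j + 2) * \<delta> + k)" for j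
      using that
    proof (induction j)
      case (Suc j)
      have "?near ((n0 + j + 2) * \<delta> + k)"
      proof (intro allI impI)
        fix t assume t: "t \<le> d' x y"
        show "\<exists>i\<le>d x y. d' (p t) (c i) \<le> (n0 + j + 2) * \<delta> + k"
        proof (rule morse_step[OF _ _ refl _ _ t])
          show "6 * k * ((n0 + j + 3) * \<delta> + k) \<le> 2 ^ (n0 + j)" 
            using n0[of "n0 + j"] by (simp add: algebra_simps)
          have "n0 + Suc j + 2 = n0 + j + 3" by simp
          then show "?near ((n0 + j + 3) * \<delta> + k)" using Suc.prems by (simp only:)
        qed (use cp in auto)
      qed
      then show ?case using Suc.IH by blast
    qed simp
    moreover have "?near ((n0 + d' x y + 2) * \<delta> + k)"
    proof (intro allI impI)
      fix t assume t: "t \<le> d' x y"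
      have "c 0 = p 0" using cp unfolding src.geo_def tgt.geo_def by simp
      then have "d' (p t) (c 0) = t"
        using src.geo_d[of x y p 0 t] cp t src.d_sym[OF src.geo_in[of x y p t] src.geo_in[of x y p 0]] by simp
      also have "t \<le> (n0 + d' x y + 2) * \<delta>" using t \<delta>_pos
        by (metis le_add1 le_trans mult.right_neutral mult_le_mono2 add.assoc add.commute)
      finally show "\<exists>i\<le>d x y. d' (p t) (c i) \<le> (n0 + d' x y + 2) * \<delta> + k" by (intro exI[of _ 0]) simp
    qed
    ultimately show "\<exists>i\<le>d x y. d' (p t) (c i) \<le> (n0 + 2) * \<delta> + k" using t by blast
  qed
qed

text \<open>Every point of \<open>p\<close> is close to the part of \<open>c\<close> before
  \<open>i\<close> or to the part after \<open>i\<close>; at the crossing, points \<open>c j\<close>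
  and \<open>c j'\<close> on both sides of \<open>i\<close> are within \<open>2 * H + 1\<close> of
  each other. As \<open>c\<close> is a geodesic, \<open>c i\<close> in between is close to
  \<open>c j\<close>. One factor \<open>k\<close> converts to the metric of \<open>c\<close>, the
  other converts back.\<close>

lemma morse_near_converse:
  assumes H: "\<forall>x y c p. tgt.geo x y c \<and> src.geo x y p \<longrightarrow> (\<forall>t\<le>d' x y. \<exists>i\<le>d x y. d' (p t) (c i) \<le> H)"
    and c: "tgt.geo x y c" and p: "src.geo x y p" and i: "i \<le> d x y"
  shows "\<exists>t\<le>d' x y. d' (c i) (p t) \<le> k * (k * (2 * H + 1)) + H"
proof -
  have pM: "p i \<in> M" if "i \<le> d' x y" for i using src.geo_in p that by blast
  have cM: "c i \<in> M" if "i \<le> d x y" for i using tgt.geo_in c that by blast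
  have cp: "c 0 = p 0" "c (d x y) = p (d' x y)" using c p unfolding src.geo_def tgt.geo_def by auto
  let ?P = "\<lambda>t. \<exists>j\<le>i. d' (p t) (c j) \<le> H" 
  let ?Q = "\<lambda>t. \<exists>j. i \<le> j \<and> j \<le> d x y \<and> d' (p t) (c j) \<le> H"
  have "?P 0" using cp pM[of 0] by (intro exI[of _ 0]) simp
  moreover have "?Q (d' x y)" using cp pM[of "d' x y"] i by (intro exI[of _ "d x y"]) simp
  moreover have "?P t \<or> ?Q t" if tt: "t \<le> d' x y" for t
  proof -
    obtain j where "j \<le> d x y" "d' (p t) (c j) \<le> H" using H c p tt by blast
    then show ?thesis using nat_le_linear[of i j] by blast
  qed
  ultimately obtain t t' where t: "t \<le> d' x y" "t' \<le> d' x y" "t' = t \<or> t' = Suc t" "?P t" "?Q t'"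
    by (rule discrete_crossing)
  obtain j j' where j: "j \<le> i" "d' (p t) (c j) \<le> H" "i \<le> j'" "j' \<le> d x y" "d' (p t') (c j') \<le> H"
    using t by blast
  have M: "p t \<in> M" "p t' \<in> M" "c j \<in> M" "c j' \<in> M" "c i \<in> M" using t j i pM cM by auto
  have "d' (p t) (p t') \<le> 1" using t src.geo_d[OF p, of t t'] M by auto
  moreover have "d' (c j) (c j') \<le> d' (c j) (p t) + d' (p t) (c j')" 
    "d' (p t) (c j') \<le> d' (p t) (p t') + d' (p t') (c j')" using src.d_tri M by blast+
  moreover have "d' (c j) (p t) = d' (p t) (c j)" using src.d_sym M by blast
  ultimately have "d' (c j) (c j') \<le> 2 * H + 1" using j by linarith
  then have "d (c j) (c j') \<le> k * (2 * H + 1)" using d_le M by (meson le_trans mult_le_mono2)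
  then have "j' - j \<le> k * (2 * H + 1)" using tgt.geo_d[OF c, of j j'] j by simp
  then have "d (c j) (c i) \<le> k * (2 * H + 1)" using tgt.geo_d[OF c, of j i] j i by simp
  then have "d' (c j) (c i) \<le> k * (k * (2 * H + 1))" using d'_le M by (meson le_trans mult_le_mono2)
  moreover have "d' (c i) (p t) \<le> d' (c i) (c j) + d' (c j) (p t)" using src.d_tri M by blast
  moreover have "d' (c i) (c j) = d' (c j) (c i)" "d' (c j) (p t) = d' (p t) (c j)" using src.d_sym M by blast+
  ultimately show ?thesis using t j by (intro exI[of _ t]) linarith
qed

text \<open>A side of a \<open>d\<close>-triangle stays within \<open>H'\<close> of the
  \<open>d'\<close>-side with the same ends; there slimness costs \<delta>, the way back costs
  \<open>H\<close>, and the factor \<open>k\<close> converts the total.\<close>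

lemma slim_tgt: "\<exists>\<epsilon>. tgt.slim \<epsilon>"
proof -
  obtain H where H: "\<forall>x y c p. tgt.geo x y c \<and> src.geo x y p \<longrightarrow> (\<forall>t\<le>d' x y. \<exists>i\<le>d x y. d' (p t) (c i) \<le> H)"
    using morse_near by blast
  define H' where "H' = k * (k * (2 * H + 1)) + H"
  have toS: "\<exists>v\<in>B. d' u v \<le> H'" if AB: "tgt.seg x y A" "src.seg x y B" "u \<in> A" for x y A B u
  proof -
    obtain c p where cp: "tgt.geo x y c" "A = c ` {..d x y}" "src.geo x y p" "B = p ` {..d' x y}"
      using AB unfolding src.seg_def tgt.seg_def by blast
    obtain i where i: "i \<le> d x y" "u = c i" using cp(2) AB(3) by blast
    obtain t where "t \<le> d' x y" "d' u (p t) \<le> H'"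
      using morse_near_converse[OF H cp(1,3) i(1)] i(2) unfolding H'_def by blast
    then show ?thesis using cp(4) by blast
  qed
  have fromS: "\<exists>v\<in>A. d' u v \<le> H" if AB: "tgt.seg x y A" "src.seg x y B" "u \<in> B" for x y A B u
  proof -
    obtain c p where cp: "tgt.geo x y c" "A = c ` {..d x y}" "src.geo x y p" "B = p ` {..d' x y}"
      using AB unfolding src.seg_def tgt.seg_def by blast
    obtain t where t: "t \<le> d' x y" "u = p t" using cp(4) AB(3) by blast
    obtain i where "i \<le> d x y" "d' u (c i) \<le> H" using H cp(1,3) t by blast
    then show ?thesis using cp(2) by blast
  qed
  have "tgt.slim (k * (H' + \<delta> + H))"
    unfolding tgt.slim_def
  proof (intro allI impI ballI)
    fix x y z A B C u assume ABC: "tgt.seg x y A \<and> tgt.seg y z B \<and> tgt.seg x z C" and u: "u \<in> A"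
    then have xyz: "x \<in> M" "y \<in> M" "z \<in> M" using tgt.seg_ends by blast+
    obtain A' where A': "src.seg x y A'" using src.seg_exists xyz by blast
    obtain B' where B': "src.seg y z B'" using src.seg_exists xyz by blast
    obtain C' where C': "src.seg x z C'" using src.seg_exists xyz by blast
    obtain u' where u': "u' \<in> A'" "d' u u' \<le> H'" using toS ABC A' u by blast
    obtain v' where v': "v' \<in> B' \<union> C'" "d' u' v' \<le> \<delta>" using src.slimD[OF slim_src A' B' C' u'(1)] by blast
    obtain v where v: "v \<in> B \<union> C" "d' v' v \<le> H" using fromS ABC B' C' v'(1) by blast
    have M: "u \<in> M" "u' \<in> M" "v' \<in> M" "v \<in> M"
      using u u' v' v ABC A' B' C' src.seg_in tgt.seg_in by blast+
    have "d' u v \<le> d' u u' + d' u' v" "d' u' v \<le> d' u' v' + d' v' v" using src.d_tri M by blast+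
    then have "d' u v \<le> H' + \<delta> + H" using u' v' v by linarith
    then have "d u v \<le> k * (H' + \<delta> + H)" using d_le M by (meson le_trans mult_le_mono2)
    then show "\<exists>v\<in>B \<union> C. d u v \<le> k * (H' + \<delta> + H)" using v by blast
  qed
  then show ?thesis by blast
qed

end

section \<open>The Cayley graph as a geodesic space, and independence of the generating set\<close>

context marked_group
begin

lemma geo_space_dst: "geo_space (carrier G) dst"
proof
  fix x y assume xy: "x \<in> carrier G" "y \<in> carrier G"
  obtain w where w: "w \<in> lists S" "ev w = inv x \<otimes> y" "length w = len (inv x \<otimes> y)"
    using word_exists xy by (metis inv_closed m_closed)
  let ?p = "\<lambda>i. x \<otimes> ev (take i w)"
  have tk: "ev (take i w) \<in> carrier G" for i using w(1) by (auto dest: in_set_takeD)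
  have dxy: "dst x y = length w" using w by (simp add: word_dist_def)
  have "?p 0 = x" "?p (dst x y) = y"
    using xy w dxy by (auto simp: m_assoc[symmetric])
  moreover have "\<forall>i j. i \<le> j \<longrightarrow> j \<le> dst x y \<longrightarrow> dst (?p i) (?p j) = j - i"
    using dst_take[of w] w tk xy dxy by (simp add: dst_left)
  ultimately show "\<exists>p. p 0 = x \<and> p (dst x y) = y \<and> (\<forall>i\<le>dst x y. p i \<in> carrier G) \<and>
        (\<forall>i j. i \<le> j \<longrightarrow> j \<le> dst x y \<longrightarrow> dst (p i) (p j) = j - i)"
    using xy tk by (intro exI[of _ ?p]) auto
qed (auto simp: dst_sym intro: dst_triangle)

sublocale cay: geo_space "carrier G" dst
  by (rule geo_space_dst)

lemma geo_imp_cayley_geodesic: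
  assumes "cay.geo x y p" 
  shows "cayley_geodesic G S x y (map p [0..<Suc (dst x y)])"
proof -
  have "p i \<in> carrier G" if "i < Suc (dst x y)" for i
    using cay.geo_in[OF assms] that by simp
  then show ?thesis
    using assms unfolding cayley_geodesic_def cay.geo_def
    by (auto simp: hd_map last_map nth_append simp del: upt_Suc)
qed

lemma cayley_hyperbolic_imp_slim:
  assumes "cayley_hyperbolic G S \<delta>"
  shows "cay.slim \<delta>"
  unfolding cay.slim_def
proof (intro allI impI)
  fix x y z A B C assume *: "cay.seg x y A \<and> cay.seg y z B \<and> cay.seg x z C"
  have "\<exists>p. cayley_geodesic G S x y p \<and> set p = A" if "cay.seg x y A" for x y A
    using that geo_imp_cayley_geodesic unfolding cay.seg_def
    by (force simp del: upt_Suc simp: atLeast0_lessThan_Suc atLeast0LessThan lessThan_Suc_atMost)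
  then obtain p q r where "cayley_geodesic G S x y p" "cayley_geodesic G S y z q" "cayley_geodesic G S x z r"
    "set p = A" "set q = B" "set r = C" using * by metis
  then show "\<forall>u\<in>A. \<exists>v\<in>B \<union> C. dst u v \<le> \<delta>"
    using assms unfolding cayley_hyperbolic_def by blast
qed

lemma len_le_other:
  assumes "marked_group G S'"
  shows "\<exists>k. \<forall>g\<in>carrier G. len g \<le> k * word_length G S' g"
proof -
  interpret o: marked_group G S' by fact
  define k where "k = Max (insert 0 (len ` S'))"
  have k: "len s \<le> k" if "s \<in> S'" for s
    unfolding k_def using that o.fin_S by (intro Max_ge) auto
  have *: "len (ev w) \<le> k * length w" if "w \<in> lists S'" for w
    using that
  proof (induction w)
    case (Cons s w)
    then have "s \<in> carrier G" "ev w \<in> carrier G" using o.S_carrier o.ev_closed by auto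
    then have "len (ev (s # w)) \<le> len s + len (ev w)" using len_mult by simp
    then show ?case using k[of s] Cons by simp
  qed simp
  show ?thesis
  proof (intro exI ballI)
    fix g assume "g \<in> carrier G"
    then obtain w where "w \<in> lists S'" "ev w = g" "length w = o.len g" by (rule o.word_exists)
    then show "len g \<le> k * o.len g" using * by metis
  qed
qed

text \<open>\<open>word_hyperbolic\<close> speaks of some generating set, whereas spheres and
  combings refer to \<open>S\<close>. The two word metrics are bi-Lipschitz equivalent, so slimness
  can be transported. The maximum with 1 provides the positive constant that \<open>qi_pair\<close>
  asks for.\<close>

lemma word_hyperbolic_four_point:
  assumes "word_hyperbolic G"
  shows "\<exists>\<kappa>. cay.four_point \<kappa>"
proof -
  obtain S' \<delta> where S': "finite S'" "symmetric_subset G S'" "semigroup_generates G S'" "cayley_hyperbolic G S' \<delta>"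
    using assms unfolding word_hyperbolic_def by blast
  interpret o: marked_group G S' using S' by unfold_locales auto
  obtain k1 where k1: "\<And>g. g \<in> carrier G \<Longrightarrow> len g \<le> k1 * o.len g"
    using len_le_other[OF o.marked_group_axioms] by blast
  obtain k2 where k2: "\<And>g. g \<in> carrier G \<Longrightarrow> o.len g \<le> k2 * len g"
    using o.len_le_other[OF marked_group_axioms] by blast
  interpret qi_pair "carrier G" o.dst dst "k1 + k2" "max 1 \<delta>"
  proof
    fix x y assume "x \<in> carrier G" "y \<in> carrier G"
    then show "dst x y \<le> (k1 + k2) * o.dst x y" "o.dst x y \<le> (k1 + k2) * dst x y"
      using k1[of "inv x \<otimes> y"] k2[of "inv x \<otimes> y"] by (simp_all add: word_dist_def add_mult_distrib)
  next
    show "o.cay.slim (max 1 \<delta>)"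
      by (rule o.cay.slim_mono[OF o.cayley_hyperbolic_imp_slim[OF S'(4)]]) simp
  qed simp
  show ?thesis using slim_tgt cay.slim_imp_four_point by blast
qed

end

section \<open>Growth of spheres\<close>

text \<open>Non-elementarity enters the growth estimates as \<open>superlinear\<close>: balls
  outgrow every linear function of the radius. The factor \<open>2 * R + 1\<close> is the number of
  levels that are counted in \<open>extension\<close>.\<close>

locale hyp_group = marked_group G S for G :: "('a, 'b) monoid_scheme" (structure) and S +
  fixes \<kappa> :: nat
  assumes four_pt: "cay.four_point \<kappa>"
    and superlinear: "\<exists>R. K * (2 * R + 1) < card {g \<in> carrier G. len g \<le> R}"
begin

lemma four_pointD:
  assumes "w \<in> carrier G" "x \<in> carrier G" "y \<in> carrier G" "z \<in> carrier G"
  shows "dst x z + dst w y \<le> dst x y + dst w z + \<kappa> \<or> dst x z + dst w y \<le> dst y z + dst w x + \<kappa>"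
proof -
  have "dst x z + dst w y \<le> max (dst x y + dst w z) (dst y z + dst w x) + \<kappa>"
    using four_pt assms unfolding cay.four_point_def by blast
  then show ?thesis unfolding max_def by (auto split: if_splits)
qed

text \<open>The point \<open>x\<close> lies on a geodesic from the identity to \<open>z\<close>, up
  to the defect \<open>A\<close> in the triangle inequality.\<close>

definition near :: "'a \<Rightarrow> 'a \<Rightarrow> nat \<Rightarrow> bool" where
  "near x z A \<longleftrightarrow> dst x z + len x \<le> len z + A"

text \<open>The four-point condition at the identity, \<open>x\<close>, \<open>z\<close>,
  \<open>y\<close>. As in a tree, points almost on geodesics towards a common \<open>z\<close> are
  ordered along a line by their length, at the cost of \<kappa>.\<close>

lemma near_trans:
  assumes "near x z A" "near y z A" "len x \<le> len y" "x \<in> carrier G" "y \<in> carrier G" "z \<in> carrier G"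
  shows "near x y (A + \<kappa>)"
proof -
  have "dst x y + dst \<one> z \<le> dst x z + dst \<one> y + \<kappa> \<or> dst x y + dst \<one> z \<le> dst z y + dst \<one> x + \<kappa>"
    using four_pointD[of \<one> x z y] assms by simp
  then have "dst x y + len z \<le> dst x z + len y + \<kappa> \<or> dst x y + len z \<le> dst y z + len x + \<kappa>"
    using assms dst_sym[of y z] by simp
  then show ?thesis using assms unfolding near_def by linarith
qed

lemma near_dist:
  assumes "near x z A" "near y z A" "len x = len y" "x \<in> carrier G" "y \<in> carrier G" "z \<in> carrier G"
  shows "dst x y \<le> A + \<kappa>"
  using near_trans[of x z A y] assms unfolding near_def by simp

lemma near_prefix:
  assumes "near x z A" "x \<in> carrier G" "w \<in> lists S" "length w = len (ev w)" "z = ev w" "len x \<le> length w"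
  shows "dst x (ev (take (len x) w)) \<le> A + \<kappa>"
proof -
  let ?y = "ev (take (len x) w)"
  have y: "?y \<in> carrier G" "z \<in> carrier G" using assms by (auto dest: in_set_takeD)
  have "dst (ev (take 0 w)) ?y = len x" "dst ?y (ev (take (length w) w)) = length w - len x"
    using dst_take[of w 0 "len x"] dst_take[of w "len x" "length w"] assms by auto
  then have l: "len ?y = len x" "dst ?y z = length w - len x" using y assms by auto
  then have "near ?y z A" unfolding near_def using assms by simp
  then show ?thesis using near_dist[of x z A ?y] assms y l by simp
qed

text \<open>
  If all \<open>e\<close> in a ball of radius \<open>R\<close> lead to cancellation in \<open>g \<otimes> e \<otimes> g'\<close>, then they all move a point
  of the geodesic from \<open>\<one>\<close> to \<open>g'\<close> close to that same geodesic, and there are too few such elements.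
\<close>

lemma extension:
  "\<exists>R c. \<forall>g\<in>carrier G. \<forall>g'\<in>carrier G. \<exists>e\<in>carrier G. len e \<le> R \<and> len g + len g' \<le> len (g \<otimes> e \<otimes> g') + c"
proof -
  let ?B = "\<lambda>n. {g \<in> carrier G. len g \<le> n}"
  obtain R where R: "card (?B (2 * \<kappa>)) * (2 * R + 1) < card (?B R)" using superlinear by blast
  \<comment> \<open>With this \<open>t\<close> the point \<open>x\<close> lies so far out that the
    second alternative of the first four-point inequality fails. The constant \<open>c\<close> is
    \<open>2 * (t + R) + R + \<kappa>\<close>, which is exactly what the inequality for
    \<open>e \<otimes> g'\<close>, \<open>g'\<close>, \<open>y\<close> consumes, since
    \<open>e \<otimes> x\<close> has length at most \<open>t + R\<close>.\<close>
  define t where "t = R + \<kappa> + 1"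
  define c where "c = 5 * R + 3 * \<kappa> + 2"
  show ?thesis
  proof (intro exI ballI, rule ccontr)
    fix g g' assume g: "g \<in> carrier G" "g' \<in> carrier G"
      and "\<not> (\<exists>e\<in>carrier G. len e \<le> R \<and> len g + len g' \<le> len (g \<otimes> e \<otimes> g') + c)"
    then have short: "len (g \<otimes> e \<otimes> g') + c < len g + len g'" if "e \<in> carrier G" "len e \<le> R" for e
      using that by force
    obtain w where w: "w \<in> lists S" "ev w = g'" "length w = len g'" using word_exists g by blast
    have tk: "ev (take i w) \<in> carrier G" for i using w(1) by (auto dest: in_set_takeD)
    have "len g \<le> len (g \<otimes> g') + len g'"
      using dst_triangle[of \<one> "g \<otimes> g'" g] dst_mult'[of g g'] g by simp
    then have long: "t + R \<le> len g'" using short[of \<one>] g unfolding t_def c_def by simp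
    have wi: "len (ev (take i w)) = i" "dst (ev (take i w)) g' = len g' - i" if "i \<le> len g'" for i
      using dst_take[of w 0 i] dst_take[of w i "length w"] that w tk by auto
    define x where "x = ev (take t w)"
    have x: "x \<in> carrier G" "len x = t" "dst x g' = len g' - t"
      unfolding x_def using tk wi[of t] long by auto
    \<comment> \<open>Four applications of the four-point condition: \<open>e \<otimes> x\<close> is
      almost on a geodesic from the identity to \<open>e \<otimes> g'\<close>; the points
      \<open>e \<otimes> g'\<close> and \<open>g'\<close> have a large Gromov product, both being
      compared with \<open>inv g\<close>; hence the point \<open>y\<close> at level \<open>s\<close>
      on the way to \<open>g'\<close> is also almost on a geodesic to \<open>e \<otimes> g'\<close>;
      and two such points at the same level are close.\<close>
    have key: "dst (e \<otimes> x) (ev (take (len (e \<otimes> x)) w)) \<le> 2 * \<kappa> \<and> len (e \<otimes> x) \<in> {t - R..t + R}"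
      if e: "e \<in> carrier G" "len e \<le> R" for e
    proof -
      define s where "s = len (e \<otimes> x)"
      define y where "y = ev (take s w)"
      have ex: "e \<otimes> x \<in> carrier G" "e \<otimes> g' \<in> carrier G" using e x g by auto
      have "s \<le> t + R" unfolding s_def using len_mult[OF e(1) x(1)] e x by simp
      have "t \<le> R + s" 
        using dst_triangle[of e \<one> "e \<otimes> x"] dst_mult[of e x] e x ex unfolding s_def by simp
      have y: "y \<in> carrier G" "len y = s" "dst y g' = len g' - s"
        unfolding y_def using tk wi[of s] long \<open>s \<le> t + R\<close> by auto
      define l where "l = len (e \<otimes> g')"
      have l: "len g' \<le> R + l"
        using dst_triangle[of e \<one> "e \<otimes> g'"] dst_mult[of e g'] e g ex unfolding l_def by simp
      have dexg: "dst (e \<otimes> x) (e \<otimes> g') = len g' - t" using dst_left x g e by simp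
      have "dst e (e \<otimes> g') + dst \<one> (e \<otimes> x) \<le> dst e (e \<otimes> x) + dst \<one> (e \<otimes> g') + \<kappa> \<or>
            dst e (e \<otimes> g') + dst \<one> (e \<otimes> x) \<le> dst (e \<otimes> x) (e \<otimes> g') + dst \<one> e + \<kappa>"
        using four_pointD[of \<one> e "e \<otimes> x" "e \<otimes> g'"] e ex by simp
      then have "len g' + s \<le> t + l + \<kappa> \<or> len g' + s \<le> len g' - t + len e + \<kappa>"
        using e ex g x dexg unfolding s_def l_def by simp
      then have l2: "len g' + s \<le> t + l + \<kappa>"
        using \<open>t \<le> R + s\<close> e(2) long unfolding t_def by linarith
      have ig: "inv g \<in> carrier G" using g by simp
      have dig: "dst (inv g) h = len (g \<otimes> h)" if "h \<in> carrier G" for h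
        using that g by (simp add: word_dist_def)
      have sh: "dst (inv g) (e \<otimes> g') + c < len g + len g'" "dst (inv g) g' + c < len g + len g'"
        using dig short[OF e] short[of \<one>] g e by (auto simp: m_assoc)
      have "dst (e \<otimes> g') g' + dst \<one> (inv g) \<le> dst (e \<otimes> g') (inv g) + dst \<one> g' + \<kappa> \<or>
            dst (e \<otimes> g') g' + dst \<one> (inv g) \<le> dst (inv g) g' + dst \<one> (e \<otimes> g') + \<kappa>"
        using four_pointD[of \<one> "e \<otimes> g'" "inv g" g'] g ex by simp
      then have "dst (e \<otimes> g') g' + len g \<le> dst (inv g) (e \<otimes> g') + len g' + \<kappa> \<or>
            dst (e \<otimes> g') g' + len g \<le> dst (inv g) g' + l + \<kappa>"
        using g ex dst_sym[OF ig ex(2)] unfolding l_def by simp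
      then have A: "dst (e \<otimes> g') g' + c \<le> l + len g' + \<kappa> + R"
        using sh l by linarith
      have "dst (e \<otimes> g') y + dst \<one> g' \<le> dst (e \<otimes> g') g' + dst \<one> y + \<kappa> \<or>
            dst (e \<otimes> g') y + dst \<one> g' \<le> dst g' y + dst \<one> (e \<otimes> g') + \<kappa>"
        using four_pointD[of \<one> "e \<otimes> g'" g' y] g ex y by simp
      then have "dst (e \<otimes> g') y + len g' \<le> dst (e \<otimes> g') g' + s + \<kappa> \<or>
            dst (e \<otimes> g') y + len g' \<le> len g' - s + l + \<kappa>"
        using g ex y dst_sym[OF g(2) y(1)] unfolding l_def by simp
      then have B: "dst (e \<otimes> g') y + s \<le> l + \<kappa>"
        using A \<open>s \<le> t + R\<close> long unfolding c_def t_def by linarith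
      have "dst (e \<otimes> x) y + dst \<one> (e \<otimes> g') \<le> dst (e \<otimes> x) (e \<otimes> g') + dst \<one> y + \<kappa> \<or>
            dst (e \<otimes> x) y + dst \<one> (e \<otimes> g') \<le> dst (e \<otimes> g') y + dst \<one> (e \<otimes> x) + \<kappa>"
        using four_pointD[of \<one> "e \<otimes> x" "e \<otimes> g'" y] ex y by simp
      then have "dst (e \<otimes> x) y + l \<le> len g' - t + s + \<kappa> \<or>
            dst (e \<otimes> x) y + l \<le> dst (e \<otimes> g') y + s + \<kappa>"
        using ex y dexg by (simp add: s_def l_def)
      then have "dst (e \<otimes> x) y \<le> 2 * \<kappa>" using B l2 long by linarith
      then show ?thesis using \<open>s \<le> t + R\<close> \<open>t \<le> R + s\<close> unfolding y_def s_def by simp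
    qed
    have "?B R \<subseteq> (\<lambda>(s, b). ev (take s w) \<otimes> b \<otimes> inv x) ` ({t - R..t + R} \<times> ?B (2 * \<kappa>))"
    proof
      fix e assume "e \<in> ?B R"
      then have e: "e \<in> carrier G" "len e \<le> R" by auto
      define y where "y = ev (take (len (e \<otimes> x)) w)"
      define b where "b = inv y \<otimes> (e \<otimes> x)"
      have y: "y \<in> carrier G" unfolding y_def by (rule tk)
      have b: "b \<in> carrier G" unfolding b_def using y e x by auto
      have "len b = dst (e \<otimes> x) y" unfolding b_def using dst_sym[of "e \<otimes> x" y] y e x by (simp add: word_dist_def)
      moreover have "y \<otimes> b = e \<otimes> x" unfolding b_def using y e x by (simp add: m_assoc[symmetric])
      then have "e = y \<otimes> b \<otimes> inv x" using e x by (simp add: m_assoc)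
      ultimately show "e \<in> (\<lambda>(s, b). ev (take s w) \<otimes> b \<otimes> inv x) ` ({t - R..t + R} \<times> ?B (2 * \<kappa>))"
        using key[OF e] b unfolding y_def by (intro image_eqI[of _ _ "(len (e \<otimes> x), b)"]) auto
    qed
    then have "card (?B R) \<le> card ({t - R..t + R} \<times> ?B (2 * \<kappa>))"
      using finite_ball by (intro surj_card_le) auto
    also have "\<dots> = (2 * R + 1) * card (?B (2 * \<kappa>))"
      unfolding card_cartesian_product t_def by simp
    finally show False using R by (simp add: mult.commute)
  qed
qed

text \<open>All \<open>g\<close> in \<open>A\<close> have length \<open>n\<close> and lie almost on
  a geodesic to \<open>z = g \<otimes> f \<otimes> h\<close>, so those that lead to the same
  \<open>z\<close> differ by an element of the ball of radius \<open>k + \<kappa>\<close>. Together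
  with \<open>f\<close> and \<open>z\<close> this difference determines the pair of \<open>g\<close>
  and \<open>h\<close>: the product map has bounded fibres, uniformly in \<open>A\<close> and
  \<open>B\<close>.\<close>

lemma product_bound:
  assumes F: "finite F" "F \<subseteq> carrier G" and A: "finite A" "A \<subseteq> word_sphere G S n" 
    and B: "finite B" "B \<subseteq> carrier G"
    and ex: "\<And>g h. g \<in> A \<Longrightarrow> h \<in> B \<Longrightarrow> \<exists>f\<in>F. len g + len f + len h \<le> len (g \<otimes> f \<otimes> h) + k"
  shows "\<exists>Z. finite Z \<and> card A * card B \<le> card F * card {g \<in> carrier G. len g \<le> k + \<kappa>} * card Z \<and>
     (\<forall>z\<in>Z. \<exists>g\<in>A. \<exists>h\<in>B. \<exists>f\<in>F. z = g \<otimes> f \<otimes> h \<and> len g + len f + len h \<le> len z + k)"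
proof -
  obtain f where f: "f g h \<in> F" "len g + len (f g h) + len h \<le> len (g \<otimes> f g h \<otimes> h) + k" if "g \<in> A" "h \<in> B" for g h
    using ex by metis
  define pr where "pr = (\<lambda>(g, h). g \<otimes> f g h \<otimes> h)"
  define Z where "Z = pr ` (A \<times> B)"
  let ?Bl = "{g \<in> carrier G. len g \<le> k + \<kappa>}"
  \<comment> \<open>A reference left factor for each product. Recording \<open>g\<close> relative to
    it, instead of \<open>g\<close> itself, keeps the code within a ball of fixed radius.\<close>
  define sel where "sel z = (SOME g. g \<in> A \<and> (\<exists>h\<in>B. z = pr (g, h)))" for z
  have cA: "g \<in> carrier G" "len g = n" if "g \<in> A" for g using that A by (auto simp: word_sphere_def)
  have near: "near g (pr (g, h)) k" "pr (g, h) \<in> carrier G" if "g \<in> A" "h \<in> B" for g h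
  proof -
    have c: "g \<in> carrier G" "f g h \<in> carrier G" "h \<in> carrier G" using f that F B cA by blast+
    then have "dst g (pr (g, h)) = len (f g h \<otimes> h)" unfolding pr_def by (simp add: m_assoc)
    also have "\<dots> \<le> len (f g h) + len h" using len_mult c by blast
    finally show "near g (pr (g, h)) k" "pr (g, h) \<in> carrier G" 
      using f[OF that] c unfolding near_def pr_def by auto
  qed
  have sel: "sel z \<in> A \<and> (\<exists>h\<in>B. z = pr (sel z, h))" if "g \<in> A" "h \<in> B" "z = pr (g, h)" for g h z
    unfolding sel_def by (rule someI_ex) (use that in blast)
  define enc where "enc = (\<lambda>(g, h). (f g h, inv (sel (pr (g, h))) \<otimes> g, pr (g, h)))"
  have encF: "enc (g, h) \<in> F \<times> ?Bl \<times> Z" if gh: "g \<in> A" "h \<in> B" for g h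
  proof -
    define z where "z = pr (g, h)"
    have "sel z \<in> A \<and> (\<exists>h\<in>B. z = pr (sel z, h))" using sel[OF gh] z_def by blast
    then obtain h' where h': "sel z \<in> A" "h' \<in> B" "z = pr (sel z, h')" by blast
    have nz: "near g z k" "near (sel z) z k" "z \<in> carrier G"
      using near[OF gh] near(1)[OF h'(1,2)] h'(3)[symmetric] unfolding z_def[symmetric] by simp_all
    have "dst (sel z) g \<le> k + \<kappa>"
      using near_dist[OF nz(2,1) _ _ _ nz(3)] h' cA gh by simp
    moreover have "z \<in> Z" unfolding Z_def z_def using gh by blast
    ultimately show ?thesis unfolding enc_def using f gh cA h'
      by (simp add: z_def[symmetric] word_dist_def)
  qed
  have img: "enc ` (A \<times> B) \<subseteq> F \<times> ?Bl \<times> Z"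
  proof (rule image_subsetI)
    fix x assume "x \<in> A \<times> B"
    then obtain g h where "x = (g, h)" "g \<in> A" "h \<in> B" by blast
    then show "enc x \<in> F \<times> ?Bl \<times> Z" using encF by blast
  qed
  have "inj_on enc (A \<times> B)"
  proof (rule inj_onI, clarify)
    fix g h g' h' assume gh: "g \<in> A" "h \<in> B" "g' \<in> A" "h' \<in> B" and eq: "enc (g, h) = enc (g', h')"
    then have e: "f g h = f g' h'" "pr (g, h) = pr (g', h')" 
      "inv (sel (pr (g, h))) \<otimes> g = inv (sel (pr (g, h))) \<otimes> g'" by (auto simp: enc_def)
    have s: "sel (pr (g, h)) \<in> carrier G" using sel[OF gh(1,2) refl] cA by blast
    have g: "g = g'" using e(3) s cA gh by simp
    have c: "g' \<otimes> f g' h' \<in> carrier G" "h \<in> carrier G" "h' \<in> carrier G" using f[of g' h'] gh F B cA by blast+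
    then have "h = h'" using e(1,2) unfolding g pr_def by simp
    then show "g = g' \<and> h = h'" using g by simp
  qed
  then have "card (A \<times> B) \<le> card (F \<times> ?Bl \<times> Z)"
    by (rule card_inj_on_le[OF _ img]) (use F A B finite_ball in \<open>simp add: Z_def\<close>)
  then have "card A * card B \<le> card F * card ?Bl * card Z" 
    by (simp add: card_cartesian_product)
  moreover have "\<forall>z\<in>Z. \<exists>g\<in>A. \<exists>h\<in>B. \<exists>f\<in>F. z = g \<otimes> f \<otimes> h \<and> len g + len f + len h \<le> len z + k"
  proof
    fix z assume "z \<in> Z"
    then obtain g h where "g \<in> A" "h \<in> B" "z = g \<otimes> f g h \<otimes> h" unfolding Z_def pr_def by auto
    then show "\<exists>g\<in>A. \<exists>h\<in>B. \<exists>f\<in>F. z = g \<otimes> f \<otimes> h \<and> len g + len f + len h \<le> len z + k"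
      using f[of g h] by blast
  qed
  moreover have "finite Z" using A B unfolding Z_def by simp
  ultimately show ?thesis by (intro exI[of _ Z] conjI)
qed

end

text \<open>Fekete's argument from both sides: \<open>a (n * m)\<close> is at most
  \<open>a m ^ n\<close> and at least \<open>(a n / K) ^ m\<close>. So every
  \<open>root n (a n / K)\<close> lies below every \<open>root m (a m)\<close>, and \<open>l\<close>
  is a number in between, the infimum of the latter.\<close>

lemma quasi_multiplicative_growth:
  fixes a :: "nat \<Rightarrow> real"
  assumes ge: "\<And>n. 1 \<le> a n" and sub: "\<And>n m. a (n + m) \<le> a n * a m"
    and sup: "\<And>n m. a n * a m \<le> K * a (n + m)"
  shows "\<exists>l>0. \<forall>n. l ^ n \<le> a n \<and> a n \<le> K * l ^ n"
proof -
  have a0: "0 < a n" for n using ge[of n] by linarith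
  have K1: "1 \<le> K" using sup[of 0 0] ge[of 0] a0[of 0] by (simp add: mult_le_cancel_right)
  then have K0: "0 < K" by linarith
  have up: "a (n * m) \<le> a m ^ n" if "0 < n" for n m
    using that
  proof (induction n rule: nat_induct_non_zero)
    case (Suc n)
    have "a (Suc n * m) \<le> a m * a (n * m)" using sub[of m "n * m"] by simp
    also have "\<dots> \<le> a m * a m ^ n" using Suc a0[of m] by (intro mult_left_mono) auto
    finally show ?case by simp
  qed simp
  have low: "a n ^ m \<le> K ^ m * a (m * n)" if "0 < m" for n m
    using that
  proof (induction m rule: nat_induct_non_zero)
    case 1
    then show ?case using K1 a0[of n] by (simp add: mult_le_cancel_right1)
  next
    case (Suc m)
    have "a n ^ Suc m \<le> a n * (K ^ m * a (m * n))" using Suc a0[of n] by (simp add: mult_left_mono)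
    also have "\<dots> = K ^ m * (a n * a (m * n))" by simp
    also have "\<dots> \<le> K ^ m * (K * a (n + m * n))" using sup K0 by (intro mult_left_mono) auto
    finally show ?case by (simp add: mult_ac)
  qed
  have cross: "root n (a n / K) \<le> root m (a m)" if "0 < n" "0 < m" for n m
  proof (rule power_le_imp_le_base[of _ "n * m - 1"])
    have nm: "Suc (n * m - 1) = n * m" using that by simp
    have "root n (a n / K) ^ (n * m) = (a n / K) ^ m"
      using that a0[of n] K0 by (simp add: power_mult)
    also have "\<dots> \<le> a (m * n)"
      using low[of m n] that K0 by (simp add: power_divide divide_simps mult.commute)
    also have "\<dots> \<le> a m ^ n" using up[of n m] that by (simp add: mult.commute)
    also have "\<dots> = root m (a m) ^ (n * m)"
      using that a0[of m] by (subst mult.commute) (simp add: power_mult)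
    finally show "root n (a n / K) ^ Suc (n * m - 1) \<le> root m (a m) ^ Suc (n * m - 1)" unfolding nm .
    show "0 \<le> root m (a m)" using a0[of m] by (simp add: real_root_ge_zero)
  qed
  define l where "l = Inf ((\<lambda>m. root m (a m)) ` {0<..})"
  have lb: "root n (a n / K) \<le> l" if "0 < n" for n
    unfolding l_def by (rule cINF_greatest) (use cross[OF that] in auto)
  have "bdd_below ((\<lambda>m. root m (a m)) ` {0<..})"
    by (rule bdd_belowI2[of _ "root 1 (a 1 / K)"]) (use cross[of 1] in simp)
  then have ub: "l \<le> root n (a n)" if "0 < n" for n
    unfolding l_def by (rule cINF_lower) (use that in auto)
  have "0 < a 1 / K" using a0[of 1] K0 by simp
  then have l0: "0 < l" using lb[of 1] by simp
  show ?thesis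
  proof (intro exI[of _ l] conjI allI)
    show "0 < l" by fact
    fix n
    show "l ^ n \<le> a n"
    proof (cases "n = 0")
      case False
      then have "l ^ n \<le> root n (a n) ^ n" using ub[of n] l0 by (intro power_mono) auto
      then show ?thesis using False a0[of n] by simp
    qed (use ge in simp)
    show "a n \<le> K * l ^ n"
    proof (cases "n = 0")
      case True
      then show ?thesis using sup[of 0 0] a0[of 0] by simp
    next
      case False
      then have "root n (a n / K) ^ n \<le> l ^ n" using lb[of n] a0[of n] K0 
        by (intro power_mono) (auto simp: real_root_ge_zero)
      then show ?thesis using False a0[of n] K0 by (simp add: divide_simps mult.commute)
    qed
  qed
qed

section \<open>Sphere sizes are multiplicative up to constants\<close>

context marked_group
begin

lemma prefix_in_sphere:
  assumes "g \<in> carrier G" "n \<le> len g"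
  shows "\<exists>x\<in>word_sphere G S n. \<exists>y\<in>word_sphere G S (len g - n). g = x \<otimes> y"
proof -
  obtain w where w: "w \<in> lists S" "ev w = g" "length w = len g" using word_exists assms by blast
  have l: "take n w \<in> lists S" "drop n w \<in> lists S" using w(1) by (auto dest: in_set_takeD in_set_dropD)
  have "length (take n w) = len (ev (take n w))"
    using geodesic_factor[of "[]" "take n w" "drop n w"] w by simp
  moreover have "length (drop n w) = len (ev (drop n w))"
    using geodesic_factor[of "take n w" "drop n w" "[]"] w by simp
  ultimately have "ev (take n w) \<in> word_sphere G S n" "ev (drop n w) \<in> word_sphere G S (len g - n)"
    unfolding word_sphere_def using w(3) assms(2) ev_closed[OF l(1)] ev_closed[OF l(2)] by simp_all
  moreover have "g = ev (take n w) \<otimes> ev (drop n w)"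
    using ev_append[OF l] w(2) by simp
  ultimately show ?thesis by blast
qed

lemma card_sphere_add: "card (word_sphere G S (n + m)) \<le> card (word_sphere G S n) * card (word_sphere G S m)"
proof -
  have "word_sphere G S (n + m) \<subseteq> (\<lambda>(x, y). x \<otimes> y) ` (word_sphere G S n \<times> word_sphere G S m)"
  proof
    fix g assume "g \<in> word_sphere G S (n + m)"
    then have "g \<in> carrier G" "n \<le> len g" "len g - n = m" by (auto simp: word_sphere_def)
    then show "g \<in> (\<lambda>(x, y). x \<otimes> y) ` (word_sphere G S n \<times> word_sphere G S m)"
      using prefix_in_sphere by force
  qed
  then have "card (word_sphere G S (n + m)) \<le> card (word_sphere G S n \<times> word_sphere G S m)"
    using finite_sphere by (intro surj_card_le) auto
  then show ?thesis by (simp add: card_cartesian_product)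
qed

lemma card_ball: "card {g \<in> carrier G. len g \<le> n} = (\<Sum>i\<le>n. card (word_sphere G S i))"
proof -
  have "{g \<in> carrier G. len g \<le> n} = (\<Union>i\<le>n. word_sphere G S i)" by (auto simp: word_sphere_def)
  also have "card \<dots> = (\<Sum>i\<le>n. card (word_sphere G S i))"
    using finite_sphere by (intro card_UN_disjoint) (auto simp: word_sphere_def)
  finally show ?thesis .
qed

end

context hyp_group
begin

lemma sphere_nonempty: "word_sphere G S n \<noteq> {}"
proof
  assume empty: "word_sphere G S n = {}"
  then have "len g \<le> n" if "g \<in> carrier G" for g
    using prefix_in_sphere[OF that, of n] by force
  then have "{g \<in> carrier G. len g \<le> R} \<subseteq> {g \<in> carrier G. len g \<le> n}" for R by auto
  then have le: "card {g \<in> carrier G. len g \<le> R} \<le> card {g \<in> carrier G. len g \<le> n}" for R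
    using finite_ball by (intro card_mono) auto
  obtain R where "card {g \<in> carrier G. len g \<le> n} * (2 * R + 1) < card {g \<in> carrier G. len g \<le> R}"
    using superlinear by blast
  then show False using le[of R] by (simp add: algebra_simps)
qed

lemma sphere_card_ge_1: "1 \<le> card (word_sphere G S n)"
  using sphere_nonempty finite_sphere by (simp add: Suc_le_eq card_gt_0_iff)

text \<open>By \<open>extension\<close> any two elements can be joined by a connector of length at
  most \<open>R\<close> with bounded cancellation, and \<open>product_bound\<close> controls how
  often a product is repeated. The products fall into the \<open>R + k + 1\<close> spheres from
  radius \<open>n + m - k\<close> on, whose sizes are compared with the smallest one by
  submultiplicativity.\<close>

lemma card_sphere_supmult:
  "\<exists>K. \<forall>n m. card (word_sphere G S n) * card (word_sphere G S m) \<le> K * card (word_sphere G S (n + m))"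
proof -
  let ?a = "\<lambda>n. card (word_sphere G S n)" and ?B = "\<lambda>n. {g \<in> carrier G. len g \<le> n}"
  obtain R c where Rc: "\<And>g g'. g \<in> carrier G \<Longrightarrow> g' \<in> carrier G \<Longrightarrow>
     \<exists>e\<in>carrier G. len e \<le> R \<and> len g + len g' \<le> len (g \<otimes> e \<otimes> g') + c"
    using extension by blast
  define k where "k = c + R"
  define C where "C = card (?B R) * card (?B (k + \<kappa>)) * (\<Sum>i\<le>R + k. ?a i)"
  have main: "?a n * ?a m \<le> C * ?a (n + m - k)" if nm: "k \<le> n + m" for n m
  proof -
    have ex: "\<exists>f\<in>?B R. len g + len f + len h \<le> len (g \<otimes> f \<otimes> h) + k"
      if "g \<in> word_sphere G S n" "h \<in> word_sphere G S m" for g h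
      using Rc[of g h] that unfolding word_sphere_def k_def by force
    have "\<exists>Z. finite Z \<and> ?a n * ?a m \<le> card (?B R) * card (?B (k + \<kappa>)) * card Z \<and>
      (\<forall>z\<in>Z. \<exists>g\<in>word_sphere G S n. \<exists>h\<in>word_sphere G S m. \<exists>f\<in>?B R.
         z = g \<otimes> f \<otimes> h \<and> len g + len f + len h \<le> len z + k)"
      by (rule product_bound[OF finite_ball _ finite_sphere subset_refl finite_sphere _ ex])
        (auto simp: word_sphere_def)
    then obtain Z where Z: "finite Z" "?a n * ?a m \<le> card (?B R) * card (?B (k + \<kappa>)) * card Z"
      "\<And>z. z \<in> Z \<Longrightarrow> \<exists>g\<in>word_sphere G S n. \<exists>h\<in>word_sphere G S m. \<exists>f\<in>?B R. z = g \<otimes> f \<otimes> h \<and> len g + len f + len h \<le> len z + k"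
      by blast
    have "Z \<subseteq> (\<Union>i\<le>R + k. word_sphere G S (n + m - k + i))"
    proof
      fix z assume "z \<in> Z"
      then obtain g h f where *: "g \<in> carrier G" "len g = n" "h \<in> carrier G" "len h = m" "f \<in> carrier G" "len f \<le> R"
        "z = g \<otimes> f \<otimes> h" "len g + len f + len h \<le> len z + k" 
        using Z(3)[of z] by (auto simp: word_sphere_def)
      have "len (g \<otimes> f \<otimes> h) \<le> len (g \<otimes> f) + len h" "len (g \<otimes> f) \<le> len g + len f" using len_mult * by auto
      then have "len z \<le> n + R + m" "n + m \<le> len z + k" using * by auto
      then have "len z = n + m - k + (len z + k - (n + m))" "len z + k - (n + m) \<le> R + k" using nm by auto
      moreover have "z \<in> carrier G" using * by simp
      ultimately show "z \<in> (\<Union>i\<le>R + k. word_sphere G S (n + m - k + i))"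
        unfolding word_sphere_def by blast
    qed
    then have "card Z \<le> card (\<Union>i\<le>R + k. word_sphere G S (n + m - k + i))"
      using finite_sphere by (intro card_mono) auto
    also have "\<dots> \<le> (\<Sum>i\<le>R + k. ?a (n + m - k + i))" by (rule card_UN_le) simp
    also have "\<dots> \<le> (\<Sum>i\<le>R + k. ?a (n + m - k) * ?a i)" by (intro sum_mono card_sphere_add)
    finally have "card Z \<le> (\<Sum>i\<le>R + k. ?a i) * ?a (n + m - k)"
      by (simp add: sum_distrib_left sum_distrib_right mult.commute)
    then have "card (?B R) * card (?B (k + \<kappa>)) * card Z \<le> C * ?a (n + m - k)"
      unfolding C_def by (simp add: mult.assoc)
    then show ?thesis using Z(2) by linarith
  qed
  \<comment> \<open>Undoes the loss of \<open>k\<close> in the radius: the sphere of radius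
    \<open>2 * k\<close> is a nonempty auxiliary factor, and
    \<open>2 * k + m - k = m + k\<close>.\<close>
  have mono: "?a m \<le> C * ?a (m + k)" for m
  proof -
    have "?a m \<le> ?a (2 * k) * ?a m" using sphere_card_ge_1[of "2 * k"] by simp
    also have "\<dots> \<le> C * ?a (m + k)" using main[of "2 * k" m] by (simp add: add.commute)
    finally show ?thesis .
  qed
  have "?a n * ?a m \<le> (C * C) * ?a (n + m)" for n m
  proof -
    have "?a n * ?a m \<le> ?a n * (C * ?a (m + k))" using mono by (rule mult_left_mono) simp
    also have "\<dots> = C * (?a n * ?a (m + k))" by simp
    also have "\<dots> \<le> C * (C * ?a (n + m))" using main[of n "m + k"] by (intro mult_left_mono) auto
    finally show ?thesis by simp
  qed
  then show ?thesis by blast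
qed

text \<open>The base exceeds 1 because bounded spheres would make the balls grow linearly. The lower
  constant 1 comes from submultiplicativity; it later makes \<open>rho\<close> at least 1 at the
  initial vertex.\<close>

lemma pure_exponential_growth:
  "\<exists>l K. 1 < l \<and> 1 \<le> K \<and> (\<forall>n. l ^ n \<le> real (card (word_sphere G S n)) \<and> real (card (word_sphere G S n)) \<le> K * l ^ n)"
proof -
  let ?a = "\<lambda>n. real (card (word_sphere G S n))"
  obtain K where K: "\<And>n m. card (word_sphere G S n) * card (word_sphere G S m) \<le> K * card (word_sphere G S (n + m))"
    using card_sphere_supmult by blast
  have "1 \<le> ?a n" for n
    using sphere_card_ge_1[of n] by simp
  moreover have "?a (n + m) \<le> ?a n * ?a m" for n m
    unfolding of_nat_mult[symmetric] of_nat_le_iff by (rule card_sphere_add)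
  moreover have "?a n * ?a m \<le> real K * ?a (n + m)" for n m
    unfolding of_nat_mult[symmetric] of_nat_le_iff by (rule K)
  ultimately have "\<exists>l>0. \<forall>n. l ^ n \<le> ?a n \<and> ?a n \<le> real K * l ^ n"
    by (rule quasi_multiplicative_growth)
  then obtain l where "0 < l" and "\<forall>n. l ^ n \<le> ?a n \<and> ?a n \<le> real K * l ^ n"
    by (elim exE conjE)
  then have l: "0 < l" "l ^ n \<le> ?a n" "?a n \<le> real K * l ^ n" for n
    by simp_all
  have "1 \<le> K" using l(3)[of 0] sphere_card_ge_1[of 0] by simp
  moreover have "1 < l"
  proof (rule ccontr)
    assume "\<not> 1 < l"
    then have "l ^ n \<le> 1" for n using l(1) by (simp add: power_le_one)
    then have "?a n \<le> K" for n using l(3)[of n] by (smt (verit) mult_left_le of_nat_0_le_iff)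
    then have "card (word_sphere G S n) \<le> K" for n by simp
    then have "card {g \<in> carrier G. len g \<le> R} \<le> K * (2 * R + 1)" for R
      unfolding card_ball using sum_bounded_above[of "{..R}" "\<lambda>i. card (word_sphere G S i)" K] 
      by (simp add: algebra_simps)
    then show False using superlinear[of K] not_le by blast
  qed
  ultimately show ?thesis using l by (intro exI[of _ l] exI[of _ "real K"]) auto
qed

end

lemma (in marked_group) card_ball_bound:
  assumes l: "1 < (l::real)" and up: "\<And>n. real (card (word_sphere G S n)) \<le> K * l ^ n"
  shows "real (card {g \<in> carrier G. len g \<le> n}) \<le> K * l / (l - 1) * l ^ n"
proof -
  have "0 \<le> K" using up[of 0] by (simp add: order_trans[OF of_nat_0_le_iff])
  have "real (card {g \<in> carrier G. len g \<le> n}) \<le> (\<Sum>i\<le>n. K * l ^ i)"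
    unfolding card_ball of_nat_sum by (intro sum_mono up)
  also have "\<dots> = K * ((l ^ Suc n - 1) / (l - 1))"
    using l by (simp add: sum_distrib_left[symmetric] geometric_sum lessThan_Suc_atMost[symmetric] del: power_Suc sum.lessThan_Suc)
  also have "\<dots> \<le> K * (l ^ Suc n / (l - 1))"
    using l \<open>0 \<le> K\<close> by (intro mult_left_mono divide_right_mono) auto
  finally show ?thesis by (simp add: mult_ac)
qed

section \<open>Growth tightness: languages of full growth are dense\<close>

context hyp_group
begin

text \<open>The points \<open>x1\<close>, \<open>x2\<close> and \<open>ev w\<close> are all almost
  on geodesics to \<open>z\<close>, so \<open>x1\<close> and \<open>x2\<close> are close to the
  prefixes of \<open>w\<close> of the same lengths, and the letters between these prefixes spell the
  way from \<open>x1\<close> to \<open>x2\<close>. One \<kappa> is spent on passing from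
  \<open>z\<close> to \<open>ev w\<close>, the other on comparing points of equal length.\<close>

lemma chain_through_two_points:
  assumes w: "w \<in> lists S" "length w = len (ev w)" and z: "z \<in> carrier G" and wz: "near (ev w) z A"
    and x: "x1 \<in> carrier G" "x2 \<in> carrier G" "near x1 z A" "near x2 z A"
    and le: "len x1 \<le> len x2" "len x2 \<le> length w"
  shows "\<exists>u v v' a b. w = u @ v @ v' \<and> a \<in> carrier G \<and> b \<in> carrier G \<and> len a \<le> A + 2 * \<kappa> \<and> len b \<le> A + 2 * \<kappa> \<and>
     inv x1 \<otimes> x2 = a \<otimes> ev v \<otimes> b"
proof -
  have wc: "ev w \<in> carrier G" using w by simp
  define y1 where "y1 = ev (take (len x1) w)"
  define y2 where "y2 = ev (take (len x2) w)"
  define v where "v = drop (len x1) (take (len x2) w)"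
  have y: "y1 \<in> carrier G" "y2 \<in> carrier G" unfolding y1_def y2_def using w(1) by (auto dest: in_set_takeD)
  have n: "near x1 (ev w) (A + \<kappa>)" "near x2 (ev w) (A + \<kappa>)"
    using near_trans[OF x(3) wz _ x(1) wc z] near_trans[OF x(4) wz _ x(2) wc z] w le by auto
  have d: "dst x1 y1 \<le> A + 2 * \<kappa>" "dst x2 y2 \<le> A + 2 * \<kappa>"
    using near_prefix[OF n(1) x(1) w refl] near_prefix[OF n(2) x(2) w refl] le unfolding y1_def y2_def by auto
  have sp: "take (len x2) w = take (len x1) w @ v"
    unfolding v_def using le by (metis append_take_drop_id min.absorb1 take_take)
  have lw: "take (len x1) w \<in> lists S" "v \<in> lists S"
    using w(1) unfolding v_def by (auto dest: in_set_takeD in_set_dropD)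
  then have yv: "y2 = y1 \<otimes> ev v" "ev v \<in> carrier G" unfolding y1_def y2_def sp by (simp_all add: ev_append)
  have "inv x1 \<otimes> x2 = (inv x1 \<otimes> y1) \<otimes> ev v \<otimes> (inv y2 \<otimes> x2)"
  proof -
    have "y2 \<otimes> (inv y2 \<otimes> x2) = x2" using y x by (simp add: m_assoc[symmetric])
    then have "y1 \<otimes> (ev v \<otimes> (inv y2 \<otimes> x2)) = x2" using y x yv by (metis inv_closed m_assoc m_closed)
    then show ?thesis using x y yv by (simp add: m_assoc)
  qed
  moreover have "len (inv x1 \<otimes> y1) \<le> A + 2 * \<kappa>" "len (inv y2 \<otimes> x2) \<le> A + 2 * \<kappa>"
    using d dst_sym[of x2 y2] x y by (simp_all add: word_dist_def)
  moreover have "w = take (len x1) w @ v @ drop (len x2) w"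
    using sp by (metis append.assoc append_take_drop_id)
  ultimately show ?thesis using x y by (metis inv_closed m_closed)
qed

text \<open>
  A growth-tightness argument: if \<open>h\<close> were not close to any word of \<open>W\<close>, the products \<open>y \<otimes> e1 \<otimes> h \<otimes> e2 \<otimes> y'\<close>
  with \<open>y\<close>, \<open>y'\<close> evaluated from \<open>W\<close> and \<open>len y + len y' = n\<close> would be pairwise distinct for different
  positions of \<open>h\<close>, so there would be on the order of \<open>n * l ^ n\<close> of them.
\<close>

lemma dense_language:
  fixes l K c :: real
  assumes l: "1 < l" and up: "\<And>n. real (card (word_sphere G S n)) \<le> K * l ^ n"
    and W: "W \<subseteq> lists S" "\<And>u v w. u @ v @ w \<in> W \<Longrightarrow> v \<in> W" "\<And>w. w \<in> W \<Longrightarrow> length w = len (ev w)"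
    and c: "0 < c" "\<And>n. c * l ^ n \<le> real (card (ev ` {w \<in> W. length w = n}))"
  shows "\<exists>\<Delta>. \<forall>h\<in>carrier G. \<exists>a\<in>carrier G. \<exists>b\<in>carrier G. \<exists>w\<in>W. len a \<le> \<Delta> \<and> len b \<le> \<Delta> \<and> h = a \<otimes> ev w \<otimes> b"
proof -
  obtain R d where Rd: "\<And>g g'. g \<in> carrier G \<Longrightarrow> g' \<in> carrier G \<Longrightarrow>
     \<exists>e\<in>carrier G. len e \<le> R \<and> len g + len g' \<le> len (g \<otimes> e \<otimes> g') + d"
    using extension by blast
  \<comment> \<open>Two insertions lose \<open>d\<close> each, and the connectors on both sides of
    \<open>h\<close> have length at most \<open>R\<close> each. In \<open>A\<close>, another
    \<open>2 * R\<close> accounts for passing from the middle factor to \<open>h\<close> alone, and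
    \<open>2 * R\<close> for the connectors in the distances from an end of \<open>h\<close> to the
    identity and to \<open>z\<close>.\<close>
  define k where "k = 2 * d + 2 * R"
  define A where "A = k + 4 * R"
  define \<Delta> where "\<Delta> = A + 2 * \<kappa>"
  define Y where "Y n = ev ` {w \<in> W. length w = n}" for n
  have "Y n \<subseteq> word_sphere G S n" for n
    unfolding Y_def word_sphere_def using W(1,3) by auto
  then have Y: "y \<in> carrier G" "len y = n" if "y \<in> Y n" for y n
    using that by (auto simp: word_sphere_def)
  have finY: "finite (Y n)" for n
    using \<open>Y n \<subseteq> word_sphere G S n\<close> finite_sphere finite_subset by blast
  have "c \<le> real (card (Y 0))" using c(2)[of 0] unfolding Y_def[symmetric] by simp
  then have "Y 0 \<noteq> {}" using c(1) by auto
  then have Nil: "[] \<in> W" unfolding Y_def by auto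
  show ?thesis
  proof (intro exI[of _ \<Delta>] ballI, rule ccontr)
    fix h assume h: "h \<in> carrier G"
    assume neg: "\<not> (\<exists>a\<in>carrier G. \<exists>b\<in>carrier G. \<exists>w\<in>W. len a \<le> \<Delta> \<and> len b \<le> \<Delta> \<and> h = a \<otimes> ev w \<otimes> b)"
    have hlong: "\<Delta> < len h"
    proof (rule ccontr)
      assume "\<not> \<Delta> < len h"
      then have "\<exists>a\<in>carrier G. \<exists>b\<in>carrier G. \<exists>w\<in>W. len a \<le> \<Delta> \<and> len b \<le> \<Delta> \<and> h = a \<otimes> ev w \<otimes> b"
        using h Nil by (intro bexI[of _ h] bexI[of _ \<one>] bexI[of _ "[]"]) auto
      then show False using neg by blast
    qed
    let ?B = "\<lambda>n. {g \<in> carrier G. len g \<le> n}"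
    define F where "F = (\<lambda>(e1, e2). e1 \<otimes> h \<otimes> e2) ` (?B R \<times> ?B R)"
    have F: "finite F" "F \<subseteq> carrier G" unfolding F_def using finite_ball h by auto
    have ex: "\<exists>f\<in>F. len g + len f + len g' \<le> len (g \<otimes> f \<otimes> g') + k" 
      if g: "g \<in> carrier G" "g' \<in> carrier G" for g g'
    proof -
      obtain e1 where e1: "e1 \<in> carrier G" "len e1 \<le> R" "len g + len h \<le> len (g \<otimes> e1 \<otimes> h) + d"
        using Rd[OF g(1) h] by blast
      obtain e2 where e2: "e2 \<in> carrier G" "len e2 \<le> R" 
        "len (g \<otimes> e1 \<otimes> h) + len g' \<le> len (g \<otimes> e1 \<otimes> h \<otimes> e2 \<otimes> g') + d"
        using Rd[of "g \<otimes> e1 \<otimes> h" g'] g h e1 by auto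
      have "len (e1 \<otimes> h \<otimes> e2) \<le> len (e1 \<otimes> h) + len e2" "len (e1 \<otimes> h) \<le> len e1 + len h" 
        by (simp_all only: len_mult m_closed inv_closed e1(1) e2(1) h)
      moreover have "g \<otimes> e1 \<otimes> h \<otimes> e2 \<otimes> g' = g \<otimes> (e1 \<otimes> h \<otimes> e2) \<otimes> g'" using g h e1 e2 by (simp add: m_assoc)
      moreover have "e1 \<otimes> h \<otimes> e2 \<in> F" unfolding F_def using e1 e2 by (intro image_eqI[of _ _ "(e1, e2)"]) auto
      ultimately show ?thesis using e1 e2 unfolding k_def by (intro bexI[of _ "e1 \<otimes> h \<otimes> e2"]) auto
    qed
    define CF where "CF = card F * card (?B (k + \<kappa>))"
    define good where "good p q Z \<longleftrightarrow> finite Z \<and> card (Y p) * card (Y q) \<le> CF * card Z \<and>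
       (\<forall>z\<in>Z. \<exists>g\<in>Y p. \<exists>h\<in>Y q. \<exists>f\<in>F. z = g \<otimes> f \<otimes> h \<and> len g + len f + len h \<le> len z + k)" for p q Z
    have "\<exists>Z. good p q Z" for p q
      unfolding CF_def good_def
    proof (rule product_bound[OF F finY \<open>Y p \<subseteq> word_sphere G S p\<close> finY])
      show "Y q \<subseteq> carrier G" using Y by blast
    qed (use ex Y(1) in blast)
    then obtain Z where "\<And>p q. good p q (Z p q)"
      by metis
    then have Z: "finite (Z p q)" "card (Y p) * card (Y q) \<le> CF * card (Z p q)"
       "z \<in> Z p q \<Longrightarrow> \<exists>g\<in>Y p. \<exists>h\<in>Y q. \<exists>f\<in>F. z = g \<otimes> f \<otimes> h \<and> len g + len f + len h \<le> len z + k" for p q z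
      unfolding good_def by blast+
    have Zd: "\<exists>y e1 e2 y'. y \<in> Y p \<and> y' \<in> Y q \<and> e1 \<in> carrier G \<and> e2 \<in> carrier G \<and> len e1 \<le> R \<and> len e2 \<le> R \<and>
        z = y \<otimes> (e1 \<otimes> h \<otimes> e2) \<otimes> y' \<and> p + len (e1 \<otimes> h \<otimes> e2) + q \<le> len z + k" if z: "z \<in> Z p q" for z p q
    proof -
      obtain y y' f where *: "y \<in> Y p" "y' \<in> Y q" "f \<in> F" "z = y \<otimes> f \<otimes> y'" "len y + len f + len y' \<le> len z + k"
        using Z(3)[OF z] by blast
      then obtain e1 e2 where "e1 \<in> ?B R" "e2 \<in> ?B R" "f = e1 \<otimes> h \<otimes> e2" unfolding F_def by auto
      then show ?thesis using * Y by (intro exI[of _ y] exI[of _ e1] exI[of _ e2] exI[of _ y']) auto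
    qed
    have flen: "len h \<le> len (e1 \<otimes> h \<otimes> e2) + 2 * R" "len (e1 \<otimes> h \<otimes> e2) \<le> len h + 2 * R"
      if e: "e1 \<in> carrier G" "e2 \<in> carrier G" "len e1 \<le> R" "len e2 \<le> R" for e1 e2
    proof -
      have "h = inv e1 \<otimes> (e1 \<otimes> h \<otimes> e2) \<otimes> inv e2" using e h by (simp add: m_assoc inv_solve_left)
      moreover have "len (inv e1 \<otimes> (e1 \<otimes> h \<otimes> e2) \<otimes> inv e2) \<le> len (inv e1 \<otimes> (e1 \<otimes> h \<otimes> e2)) + len (inv e2)"
        "len (inv e1 \<otimes> (e1 \<otimes> h \<otimes> e2)) \<le> len (inv e1) + len (e1 \<otimes> h \<otimes> e2)"
        by (simp_all only: len_mult m_closed inv_closed e(1,2) h)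
      ultimately show "len h \<le> len (e1 \<otimes> h \<otimes> e2) + 2 * R" using e by simp
      have "len (e1 \<otimes> h \<otimes> e2) \<le> len (e1 \<otimes> h) + len e2" "len (e1 \<otimes> h) \<le> len e1 + len h"
        by (simp_all only: len_mult m_closed inv_closed e(1,2) h)
      then show "len (e1 \<otimes> h \<otimes> e2) \<le> len h + 2 * R" using e by linarith
    qed
    have Zsub: "Z p q \<subseteq> ?B (p + q + (len h + 2 * R))" for p q
    proof
      fix z assume "z \<in> Z p q"
      then obtain y e1 e2 y' where *: "y \<in> Y p" "y' \<in> Y q" "e1 \<in> carrier G" "e2 \<in> carrier G" "len e1 \<le> R" "len e2 \<le> R"
        "z = y \<otimes> (e1 \<otimes> h \<otimes> e2) \<otimes> y'" using Zd by blast
      have yc: "y \<in> carrier G" "y' \<in> carrier G" "len y = p" "len y' = q" using Y * by auto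
      have "len z \<le> len (y \<otimes> (e1 \<otimes> h \<otimes> e2)) + len y'" "len (y \<otimes> (e1 \<otimes> h \<otimes> e2)) \<le> len y + len (e1 \<otimes> h \<otimes> e2)"
        unfolding *(7) by (simp_all only: len_mult m_closed inv_closed yc(1,2) *(3,4) h)
      then have "len z \<le> p + q + (len h + 2 * R)" using flen(2)[OF *(3-6)] yc by linarith
      then show "z \<in> ?B (p + q + (len h + 2 * R))" using * yc h by auto
    qed
    define R0 where "R0 = R + len h"
    \<comment> \<open>When the positions are \<open>R0\<close> apart, the copy of \<open>h\<close>
      placed after length \<open>p\<close> ends before length \<open>p'\<close>. If \<open>z\<close>
      had both decompositions, this copy would run along the word of \<open>W\<close> that spells
      the left factor of the second one, and a subword of it would approximate
      \<open>h\<close>.\<close>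
    have disj: "Z p q \<inter> Z p' q' = {}" if pp: "p + R0 \<le> p'" for p q p' q'
    proof (rule ccontr)
      assume "Z p q \<inter> Z p' q' \<noteq> {}"
      then obtain z where z: "z \<in> Z p q" "z \<in> Z p' q'" by blast
      obtain y e1 e2 y' where *: "y \<in> Y p" "y' \<in> Y q" "e1 \<in> carrier G" "e2 \<in> carrier G" "len e1 \<le> R" "len e2 \<le> R"
        "z = y \<otimes> (e1 \<otimes> h \<otimes> e2) \<otimes> y'" "p + len (e1 \<otimes> h \<otimes> e2) + q \<le> len z + k" using Zd[OF z(1)] by blast
      obtain x f1 f2 x' where **: "x \<in> Y p'" "x' \<in> Y q'" "f1 \<in> carrier G" "f2 \<in> carrier G" "len f1 \<le> R" "len f2 \<le> R"
        "z = x \<otimes> (f1 \<otimes> h \<otimes> f2) \<otimes> x'" "p' + len (f1 \<otimes> h \<otimes> f2) + q' \<le> len z + k" using Zd[OF z(2)] by blast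
      obtain w where w: "w \<in> W" "length w = p'" "x = ev w" using **(1) unfolding Y_def by blast
      have yc: "y \<in> carrier G" "y' \<in> carrier G" "len y = p" "len y' = q" using Y * by auto
      have xc: "x \<in> carrier G" "x' \<in> carrier G" "len x = p'" "len x' = q'" using Y ** by auto
      have zc: "z \<in> carrier G" using *(7) *(3,4) yc h by simp
      have wz: "near x z A"
      proof -
        have "dst x z = len ((f1 \<otimes> h \<otimes> f2) \<otimes> x')" unfolding **(7) using xc ** h by (simp add: m_assoc)
        also have "\<dots> \<le> len (f1 \<otimes> h \<otimes> f2) + len x'" by (simp_all only: len_mult m_closed inv_closed xc(1,2) **(3,4) h)
        finally show ?thesis unfolding near_def A_def using ** xc by linarith
      qed
      define x1 where "x1 = y \<otimes> e1"
      define x2 where "x2 = x1 \<otimes> h"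
      have "x1 \<in> carrier G" unfolding x1_def using yc * by simp
      then have x12: "x1 \<in> carrier G" "x2 \<in> carrier G" "inv x1 \<otimes> x2 = h"
        unfolding x2_def using h by (simp_all add: m_assoc[symmetric])
      have hz: "p + len h + q \<le> len z + k + 2 * R" using flen(1)[OF *(3-6)] *(8) by linarith
      have d1: "dst x1 z \<le> len h + R + q"
      proof -
        have "z = x1 \<otimes> (h \<otimes> e2 \<otimes> y')" unfolding *(7) x1_def using yc * h by (simp add: m_assoc)
        then have "dst x1 z = len (h \<otimes> e2 \<otimes> y')" using x12 yc * h by simp
        moreover have "len (h \<otimes> e2 \<otimes> y') \<le> len (h \<otimes> e2) + len y'" "len (h \<otimes> e2) \<le> len h + len e2" by (simp_all only: len_mult m_closed inv_closed yc(1,2) *(3,4) h)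
        ultimately show ?thesis using yc * by linarith
      qed
      have d2: "dst x2 z \<le> R + q"
      proof -
        have "z = x2 \<otimes> (e2 \<otimes> y')" unfolding *(7) x2_def x1_def using yc * h by (simp add: m_assoc)
        then have "dst x2 z = len (e2 \<otimes> y')" using x12 yc * h by simp
        moreover have "len (e2 \<otimes> y') \<le> len e2 + len y'" by (simp_all only: len_mult m_closed inv_closed yc(1,2) *(3,4) h)
        ultimately show ?thesis using yc * by linarith
      qed
      have l1: "len x1 \<le> p + R" unfolding x1_def using len_mult[of y e1] yc * by simp
      have l2: "len x2 \<le> p + R + len h" unfolding x2_def x1_def using len_mult[of "y \<otimes> e1" h] len_mult[of y e1] yc * h by simp
      have nr: "near x1 z A" "near x2 z A" unfolding near_def A_def using d1 d2 l1 l2 hz by linarith+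
      have "len z \<le> len x2 + dst x2 z" using dst_triangle[of \<one> x2 z] zc x12 by simp
      then have "len x1 \<le> len x2" using d2 hz l1 hlong unfolding \<Delta>_def A_def by linarith
      moreover have "len x2 \<le> length w" using l2 pp w unfolding R0_def by simp
      moreover have "w \<in> lists S" "length w = len (ev w)" using w W by blast+
      ultimately have "\<exists>u v v' a b. w = u @ v @ v' \<and> a \<in> carrier G \<and> b \<in> carrier G \<and>
        len a \<le> \<Delta> \<and> len b \<le> \<Delta> \<and> inv x1 \<otimes> x2 = a \<otimes> ev v \<otimes> b"
        unfolding \<Delta>_def
        using chain_through_two_points[OF _ _ zc _ x12(1,2) nr] wz unfolding w(3) by simp
      then obtain u v v' a b where uv: "w = u @ v @ v'" "a \<in> carrier G" "b \<in> carrier G" 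
         "len a \<le> \<Delta>" "len b \<le> \<Delta>" "h = a \<otimes> ev v \<otimes> b"
        unfolding x12(3) by blast
      moreover have "v \<in> W" using W(2) w(1) uv(1) by blast
      ultimately show False using neg by blast
    qed
    have R0: "0 < R0" unfolding R0_def using hlong by simp
    have bound: "real J * c\<^sup>2 \<le> CF * (K * l / (l - 1) * l ^ (len h + 2 * R))" for J
    proof -
      \<comment> \<open>This length offers \<open>J\<close> positions at mutual distance at least
        \<open>R0\<close>. Their families are disjoint, each has at least on the order of
        \<open>l ^ N\<close> elements, and all lie in a ball with on the order of
        \<open>l ^ N\<close> elements; so \<open>J\<close> is bounded.\<close>
      define N where "N = J * R0"
      let ?Z = "\<lambda>j. Z (j * R0) (N - j * R0)"
      have N: "j * R0 + (N - j * R0) = N" if "j < J" for j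
        using that unfolding N_def by simp
      have each: "c\<^sup>2 * l ^ N \<le> CF * card (?Z j)" if j: "j < J" for j
      proof -
        have "c\<^sup>2 * l ^ N = (c * l ^ (j * R0)) * (c * l ^ (N - j * R0))"
          by (subst N[OF j, symmetric]) (simp add: power_add power2_eq_square mult_ac)
        also have "\<dots> \<le> real (card (Y (j * R0))) * real (card (Y (N - j * R0)))"
          unfolding Y_def using c l by (intro mult_mono c(2)) auto
        also have "\<dots> \<le> CF * card (?Z j)" using Z(2)[of "j * R0" "N - j * R0"] by (metis of_nat_le_iff of_nat_mult)
        finally show ?thesis .
      qed
      have dj: "?Z i \<inter> ?Z j = {}" if "i < j" for i j
      proof (rule disj)
        have "Suc i * R0 \<le> j * R0" using that by (intro mult_right_mono) auto
        then show "i * R0 + R0 \<le> j * R0" by simp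
      qed
      have "?Z j \<subseteq> ?B (N + (len h + 2 * R))" if "j < J" for j
        using Zsub[of "j * R0" "N - j * R0"] unfolding N[OF that] .
      then have "(\<Union>j<J. ?Z j) \<subseteq> ?B (N + (len h + 2 * R))" by (intro UN_least) simp
      then have "card (\<Union>j<J. ?Z j) \<le> card (?B (N + (len h + 2 * R)))" by (rule card_mono[OF finite_ball])
      moreover have "card (\<Union>j<J. ?Z j) = (\<Sum>j<J. card (?Z j))"
      proof (rule card_UN_disjoint)
        show "\<forall>i\<in>{..<J}. \<forall>j\<in>{..<J}. i \<noteq> j \<longrightarrow> ?Z i \<inter> ?Z j = {}"
          using dj by (metis Int_commute linorder_neqE_nat)
      qed (use Z(1) in auto)
      ultimately have "(\<Sum>j<J. card (?Z j)) \<le> card (?B (N + (len h + 2 * R)))"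
        by linarith
      from of_nat_mono[OF this] have "(\<Sum>j<J. real (card (?Z j))) \<le> real (card (?B (N + (len h + 2 * R))))"
        unfolding of_nat_sum .
      also have "\<dots> \<le> K * l / (l - 1) * l ^ (N + (len h + 2 * R))"
        by (rule card_ball_bound[OF l up])
      finally have sumle: "(\<Sum>j<J. real (card (?Z j))) \<le> K * l / (l - 1) * l ^ (N + (len h + 2 * R))" .
      have "real J * (c\<^sup>2 * l ^ N) = (\<Sum>j<J. c\<^sup>2 * l ^ N)" by simp
      also have "\<dots> \<le> (\<Sum>j<J. CF * real (card (?Z j)))" using each by (intro sum_mono) auto
      also have "\<dots> = CF * (\<Sum>j<J. real (card (?Z j)))" by (simp add: sum_distrib_left)
      also have "\<dots> \<le> CF * (K * l / (l - 1) * l ^ (N + (len h + 2 * R)))" using sumle by (rule mult_left_mono) simp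
      finally have "(real J * c\<^sup>2) * l ^ N \<le> (CF * (K * l / (l - 1) * l ^ (len h + 2 * R))) * l ^ N"
        by (simp add: power_add mult_ac)
      then show ?thesis by (rule mult_right_le_imp_le) (use l in simp)
    qed
    obtain J where "CF * (K * l / (l - 1) * l ^ (len h + 2 * R)) / c\<^sup>2 < real J" by (rule exE[OF reals_Archimedean2])
    then have "CF * (K * l / (l - 1) * l ^ (len h + 2 * R)) < real J * c\<^sup>2" using c(1) by (simp only: pos_divide_less_eq zero_less_power)
    then show False using bound[of J] by linarith
  qed
qed

end

section \<open>Automata and non-elementary groups\<close>

text \<open>A partial automaton is encoded as a total transition function together with the letters
  admissible at each state, so that a run is a fold.\<close>

locale automaton =
  fixes out :: "'q \<Rightarrow> 'a set" and tr :: "'q \<Rightarrow> 'a \<Rightarrow> 'q"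
begin

fun acc :: "'q \<Rightarrow> 'a list \<Rightarrow> bool" where
  "acc v [] \<longleftrightarrow> True"
| "acc v (s # w) \<longleftrightarrow> s \<in> out v \<and> acc (tr v s) w"

abbreviation run :: "'q \<Rightarrow> 'a list \<Rightarrow> 'q" where
  "run \<equiv> foldl tr"

text \<open>The starting state is not counted, which makes the sums additive under concatenation;
  the contribution of the initial vertex has to be added separately.\<close>

fun wsum :: "('q \<Rightarrow> 'r::comm_monoid_add) \<Rightarrow> 'q \<Rightarrow> 'a list \<Rightarrow> 'r" where
  "wsum f v [] = 0"
| "wsum f v (s # w) = f (tr v s) + wsum f (tr v s) w"

lemma acc_append [simp]: "acc v (u @ w) \<longleftrightarrow> acc v u \<and> acc (run v u) w"
  by (induction u arbitrary: v) auto

lemma wsum_append: "wsum f v (u @ w) = wsum f v u + wsum f (run v u) w"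
  by (induction u arbitrary: v) (auto simp: add.assoc)

lemma acc_nth: "acc v w \<longleftrightarrow> (\<forall>i<length w. w ! i \<in> out (run v (take i w)))"
  by (induction w arbitrary: v) (auto simp: less_Suc_eq_0_disj)

lemma wsum_nth: "wsum f v w = (\<Sum>i<length w. f (run v (take (Suc i) w)))"
  by (induction w arbitrary: v) (simp_all add: sum.lessThan_Suc_shift del: sum.lessThan_Suc)

lemma run_closed:
  assumes "\<And>v s. v \<in> V \<Longrightarrow> s \<in> out v \<Longrightarrow> tr v s \<in> V" "v \<in> V" "acc v w"
  shows "run v w \<in> V"
  using assms(2,3) by (induction w arbitrary: v) (auto intro: assms(1))

lemma acc_pump:
  assumes "acc v y" "run v y = v"
  shows "acc v (concat (replicate k y))" "run v (concat (replicate k y)) = v"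
  using assms by (induction k) auto

lemma pumping:
  assumes fin: "finite V" and cl: "\<And>v s. v \<in> V \<Longrightarrow> s \<in> out v \<Longrightarrow> tr v s \<in> V"
    and v: "v \<in> V" "acc v w" "card V \<le> length w"
  shows "\<exists>x y. y \<noteq> [] \<and> (\<forall>k. acc v (x @ concat (replicate k y)))"
proof -
  have pre: "acc v (take i w)" for i
    by (metis acc_append append_take_drop_id v(2))
  have "(\<lambda>i. run v (take i w)) ` {..length w} \<subseteq> V"
    using run_closed[OF cl v(1) pre] by auto
  from card_mono[OF fin this] have "card ((\<lambda>i. run v (take i w)) ` {..length w}) < card {..length w}"
    using v(3) by simp
  then have "\<not> inj_on (\<lambda>i. run v (take i w)) {..length w}"
    by (rule pigeonhole)
  then obtain i' j' where "i' \<le> length w" "j' \<le> length w" "i' \<noteq> j'" "run v (take i' w) = run v (take j' w)"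
    unfolding inj_on_def by auto
  then obtain i j where ij: "i < j" "j \<le> length w" "run v (take i w) = run v (take j w)"
    by (metis linorder_neqE_nat)
  define x where "x = take i w"
  define y where "y = drop i (take j w)"
  have xy: "take j w = x @ y" unfolding x_def y_def using ij
    by (metis append_take_drop_id less_imp_le_nat min.absorb1 take_take)
  have "y \<noteq> []" unfolding y_def using ij by simp
  moreover have "acc v x" "acc (run v x) y" using pre[of j] unfolding xy by auto
  moreover have "run (run v x) y = run v x" using ij(3) unfolding xy by (simp add: x_def)
  ultimately show ?thesis using acc_pump[of "run v x" y] by auto
qed

end

definition digraph_out :: "'a labeled_digraph \<Rightarrow> nat \<Rightarrow> 'a set" where
  "digraph_out \<Gamma> v = {s. \<exists>u. (v, s, u) \<in> edges \<Gamma>}"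

definition digraph_step :: "'a labeled_digraph \<Rightarrow> nat \<Rightarrow> 'a \<Rightarrow> nat" where
  "digraph_step \<Gamma> v s = (THE u. (v, s, u) \<in> edges \<Gamma>)"

lemma parameterizes_automaton:
  assumes "parameterizes S \<Gamma> L"
  shows "\<And>v s. v \<in> vertices \<Gamma> \<Longrightarrow> s \<in> digraph_out \<Gamma> v \<Longrightarrow> digraph_step \<Gamma> v s \<in> vertices \<Gamma> \<and> s \<in> S"
    and "finite (vertices \<Gamma>)" "initial \<Gamma> \<in> vertices \<Gamma>"
    and "L = {w. automaton.acc (digraph_out \<Gamma>) (digraph_step \<Gamma>) (initial \<Gamma>) w}"
    and "\<And>w. automaton.acc (digraph_out \<Gamma>) (digraph_step \<Gamma>) (initial \<Gamma>) w \<Longrightarrow> 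
            reads \<Gamma> w (map (\<lambda>i. foldl (digraph_step \<Gamma>) (initial \<Gamma>) (take i w)) [0..<Suc (length w)])"
proof -
  interpret automaton "digraph_out \<Gamma>" "digraph_step \<Gamma>" .
  have fin: "finite_labeled_digraph S \<Gamma>" and L: "L = {w. \<exists>\<gamma>. reads \<Gamma> w \<gamma>}"
    using assms(1) by (auto simp: parameterizes_def)
  have edge: "(v, s, u) \<in> edges \<Gamma> \<longleftrightarrow> s \<in> digraph_out \<Gamma> v \<and> u = digraph_step \<Gamma> v s" for v s u
  proof
    assume "(v, s, u) \<in> edges \<Gamma>"
    then show "s \<in> digraph_out \<Gamma> v \<and> u = digraph_step \<Gamma> v s"
      using fin unfolding digraph_out_def digraph_step_def finite_labeled_digraph_def by (metis (mono_tags, lifting) mem_Collect_eq the_equality)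
  next
    assume *: "s \<in> digraph_out \<Gamma> v \<and> u = digraph_step \<Gamma> v s"
    then obtain u' where "(v, s, u') \<in> edges \<Gamma>" unfolding digraph_out_def by blast
    moreover from this have "u' = digraph_step \<Gamma> v s"
      using fin unfolding digraph_step_def finite_labeled_digraph_def by (metis (mono_tags, lifting) the_equality)
    ultimately show "(v, s, u) \<in> edges \<Gamma>" using * by simp
  qed
  show "finite (vertices \<Gamma>)" "initial \<Gamma> \<in> vertices \<Gamma>"
    using fin by (auto simp: finite_labeled_digraph_def)
  show "digraph_step \<Gamma> v s \<in> vertices \<Gamma> \<and> s \<in> S" if "v \<in> vertices \<Gamma>" "s \<in> digraph_out \<Gamma> v" for v s
    using edge[of v s "digraph_step \<Gamma> v s"] that fin unfolding finite_labeled_digraph_def by blast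
  show reads: "reads \<Gamma> w (map (\<lambda>i. run (initial \<Gamma>) (take i w)) [0..<Suc (length w)])"
    if w: "acc (initial \<Gamma>) w" for w
    unfolding reads_def
  proof (intro conjI allI impI)
    fix i assume i: "i < length w"
    show "(map (\<lambda>i. run (initial \<Gamma>) (take i w)) [0..<Suc (length w)] ! i, w ! i,
           map (\<lambda>i. run (initial \<Gamma>) (take i w)) [0..<Suc (length w)] ! Suc i) \<in> edges \<Gamma>"
      using i w unfolding edge acc_nth by (simp del: upt_Suc add: take_Suc_conv_app_nth)
  qed (simp_all del: upt_Suc)
  have "acc (initial \<Gamma>) w" if r: "reads \<Gamma> w \<gamma>" for w \<gamma>
  proof -
    have "i \<le> length w \<Longrightarrow> run (initial \<Gamma>) (take i w) = \<gamma> ! i" for i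
    proof (induction i)
      case 0
      then show ?case using r by (simp add: reads_def)
    next
      case (Suc i)
      then have "(\<gamma> ! i, w ! i, \<gamma> ! Suc i) \<in> edges \<Gamma>" using r by (simp add: reads_def)
      then show ?case using Suc edge by (simp add: take_Suc_conv_app_nth)
    qed
    then show ?thesis using r unfolding acc_nth reads_def by (simp add: edge)
  qed
  then show "L = {w. acc (initial \<Gamma>) w}" using L reads by blast
qed

section \<open>Groups with a combing and linear growth are elementary\<close>

context marked_group
begin

lemma concat_replicate_lists: "y \<in> lists S \<Longrightarrow> concat (replicate k y) \<in> lists S"
  by (induction k) auto

lemma ev_concat_replicate: "y \<in> lists S \<Longrightarrow> ev (concat (replicate k y)) = ev y [^] k"
proof (induction k)
  case (Suc k)
  have "concat (replicate k y) \<in> lists S" using concat_replicate_lists Suc.prems .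
  then show ?case using Suc nat_pow_Suc2[of "ev y" k] by (simp add: ev_append)
qed simp

text \<open>An infinite regular language can be pumped, and evaluation is injective on the combing.
  So the words \<open>x\<close> followed by powers of \<open>y\<close> represent different elements,
  and the powers of \<open>ev y\<close> are distinct.\<close>

lemma infinite_combing_imp_infinite_order:
  assumes "combing G S L" "infinite (carrier G)"
  shows "\<exists>t\<in>carrier G. inj (\<lambda>k::nat. t [^] k)"
proof -
  obtain \<Gamma> where "parameterizes S \<Gamma> L" using assms(1) unfolding combing_def regular_language_def by blast
  note pa = parameterizes_automaton[OF this]
  interpret automaton "digraph_out \<Gamma>" "digraph_step \<Gamma>" .
  have LS: "L \<subseteq> lists S" and bij: "bij_betw ev L (carrier G)" using assms(1) by (auto simp: combing_def)
  have "infinite L" using bij assms(2) bij_betw_finite by blast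
  have "\<exists>w\<in>L. card (vertices \<Gamma>) \<le> length w"
  proof (rule ccontr)
    assume "\<not> ?thesis"
    then have "L \<subseteq> {w. set w \<subseteq> S \<and> length w \<le> card (vertices \<Gamma>)}" using LS by force
    then show False using \<open>infinite L\<close> finite_lists_length_le[OF fin_S] finite_subset by blast
  qed
  then obtain w where "w \<in> L" "card (vertices \<Gamma>) \<le> length w" by blast
  then obtain x y where xy: "y \<noteq> []" "\<And>k. x @ concat (replicate k y) \<in> L"
    using pumping[OF pa(2) conjunct1[OF pa(1)] pa(3), of w] unfolding pa(4) by auto
  have xS: "x \<in> lists S" "y \<in> lists S"
    using xy(2)[of 1] LS by auto
  have "inj (\<lambda>k::nat. ev y [^] k)"
  proof (rule injI)
    fix k m :: nat assume "ev y [^] k = ev y [^] m"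
    then have "ev (x @ concat (replicate k y)) = ev (x @ concat (replicate m y))"
      using ev_append[OF xS(1) concat_replicate_lists[OF xS(2)]] ev_concat_replicate[OF xS(2)] by simp
    then have "x @ concat (replicate k y) = x @ concat (replicate m y)"
      by (rule inj_onD[OF bij_betw_imp_inj_on[OF bij] _ xy(2) xy(2)])
    then have "length (concat (replicate k y)) = length (concat (replicate m y))" by simp
    then show "k = m" using xy(1) by (simp add: length_concat sum_list_replicate)
  qed
  then show ?thesis using xS by blast
qed

text \<open>If a ball of radius \<open>n + 1\<close> met no new coset compared with radius
  \<open>n\<close>, multiplication by generators would never lead to a new one. With infinitely many
  cosets the number met therefore grows by at least one with each radius.\<close>

lemma infinite_index_cosets:
  assumes H: "subgroup H G" and inf: "infinite (rcosets H)"
  shows "Suc n \<le> card ((\<lambda>g. H #> g) ` {g \<in> carrier G. len g \<le> n})"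
proof -
  let ?Q = "\<lambda>n. (\<lambda>g. H #> g) ` {g \<in> carrier G. len g \<le> n}"
  have finQ: "finite (?Q n)" for n using finite_ball by blast
  have Hc: "H \<subseteq> carrier G" using H subgroup.subset by blast
  have step: "?Q (Suc n) \<noteq> ?Q n" for n
  proof
    assume eq: "?Q (Suc n) = ?Q n"
    have evQ: "H #> ev w \<in> ?Q n" if "w \<in> lists S" for w
      using that
    proof (induction w rule: rev_induct)
      case Nil
      then show ?case by (intro image_eqI[of _ _ \<one>]) auto
    next
      case (snoc s w)
      then have s: "s \<in> S" "w \<in> lists S" by auto
      then have sc: "s \<in> carrier G" "len s \<le> 1" using S_carrier len_le[of "[s]"] by auto
      obtain g where g: "g \<in> carrier G" "len g \<le> n" "H #> ev w = H #> g" using snoc s by auto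
      have "ev (w @ [s]) = ev w \<otimes> s" using s sc ev_append[of w "[s]"] by simp
      then have "H #> ev (w @ [s]) = H #> (g \<otimes> s)"
        using coset_mult_assoc[OF Hc g(1) sc(1)] coset_mult_assoc[OF Hc ev_closed[OF s(2)] sc(1)] g(3) by simp
      moreover have "len (g \<otimes> s) \<le> Suc n" using len_mult[OF g(1) sc(1)] g sc by simp
      ultimately have "H #> ev (w @ [s]) \<in> ?Q (Suc n)" using g sc by auto
      then show ?case using eq by simp
    qed
    have "rcosets H \<subseteq> ?Q n"
    proof
      fix c assume "c \<in> rcosets H"
      then obtain g where g: "g \<in> carrier G" "c = H #> g" unfolding RCOSETS_def by blast
      then obtain w where "w \<in> lists S" "ev w = g" using word_exists by blast
      then show "c \<in> ?Q n" using evQ[of w] g by simp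
    qed
    then show False using inf finQ[of n] by (metis finite_subset)
  qed
  show ?thesis
  proof (induction n)
    case 0
    have "\<one> \<in> {g \<in> carrier G. len g \<le> 0}" by simp
    then have "?Q 0 \<noteq> {}" by blast
    then have "0 < card (?Q 0)" using finQ[of 0] by (subst card_gt_0_iff) blast
    then show ?case by (rule Suc_leI)
  next
    case (Suc n)
    have "?Q n \<subseteq> ?Q (Suc n)" by (rule image_mono) auto
    from psubsetI[OF this not_sym[OF step]] have "?Q n \<subset> ?Q (Suc n)" .
    then have "card (?Q n) < card (?Q (Suc n))" by (rule psubset_card_mono[OF finQ])
    then show ?case using Suc by linarith
  qed
qed

lemma len_pow: "t \<in> carrier G \<Longrightarrow> len (t [^] (k::nat)) \<le> k * len t"
proof (induction k)
  case (Suc k)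
  then show ?case using len_mult[of "t [^] k" t] by (simp add: nat_pow_closed)
qed simp

text \<open>Take the cyclic subgroup of an element \<open>t\<close> of infinite order. If its index
  were infinite, the products of the powers \<open>t [^] i\<close> for \<open>i \<le> n\<close> with
  representatives of \<open>n + 1\<close> cosets met by the ball of radius \<open>n\<close> would
  give quadratic growth. A finite group has the trivial subgroup as a cyclic subgroup of finite
  index.\<close>

lemma linear_growth_imp_elementary:
  assumes L: "combing G S L" and lin: "\<And>R. card {g \<in> carrier G. len g \<le> R} \<le> K * (2 * R + 1)"
  shows "elementary G"
proof (cases "finite (carrier G)")
  case True
  then have "finite (rcosets (generate G {\<one>}))" unfolding RCOSETS_def by simp
  then show ?thesis unfolding elementary_def by blast
next
  case False
  then obtain t where t: "t \<in> carrier G" "inj (\<lambda>k::nat. t [^] k)"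
    using infinite_combing_imp_infinite_order L by blast
  define H where "H = generate G {t}"
  have H: "subgroup H G" unfolding H_def using t by (intro generate_is_subgroup) auto
  have tH: "t [^] (k::nat) \<in> H" for k
  proof (induction k)
    case (Suc k)
    then show ?case using subgroup.m_closed[OF H] generate.incl[of t "{t}" G] unfolding H_def by simp
  qed (use subgroup.one_closed[OF H] in simp)
  have "finite (rcosets H)"
  proof (rule ccontr)
    assume inf: "infinite (rcosets H)"
    let ?B = "\<lambda>n. {g \<in> carrier G. len g \<le> n}"
    have "Suc n * Suc n \<le> card (?B (n * (len t + 1)))" for n
    proof -
      let ?Q = "(\<lambda>g. H #> g) ` ?B n"
      define rep where "rep c = (SOME g. g \<in> ?B n \<and> H #> g = c)" for c
      have rep: "rep c \<in> carrier G" "len (rep c) \<le> n" "H #> rep c = c" if "c \<in> ?Q" for c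
      proof -
        have "\<exists>g. g \<in> ?B n \<and> H #> g = c" using that by auto
        from someI_ex[OF this] show "rep c \<in> carrier G" "len (rep c) \<le> n" "H #> rep c = c" unfolding rep_def by auto
      qed
      have "inj_on (\<lambda>(i, c). t [^] (i::nat) \<otimes> rep c) ({..n} \<times> ?Q)"
      proof (rule inj_onI, clarify)
        fix i j :: nat and x y assume xy: "x \<in> carrier G" "len x \<le> n" "y \<in> carrier G" "len y \<le> n"
          and eq: "t [^] i \<otimes> rep (H #> x) = t [^] j \<otimes> rep (H #> y)"
        have q: "H #> x \<in> ?Q" "H #> y \<in> ?Q" using xy by auto
        have coset: "H #> (t [^] k \<otimes> g) = H #> g" if "g \<in> carrier G" for k :: nat and g
          using tH[of k] that t H
          by (metis coset_join2 coset_mult_assoc nat_pow_closed subgroup.subset)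
        have "H #> x = H #> y" using arg_cong[OF eq, of "\<lambda>g. H #> g"] coset rep[OF q(1)] rep[OF q(2)] by simp
        then have "t [^] i = t [^] j" using eq t rep[OF q(1)] by simp
        then have "i = j" using t(2) by (simp add: inj_def)
        then show "i = j \<and> H #> x = H #> y" using \<open>H #> x = H #> y\<close> by simp
      qed
      moreover have "(\<lambda>(i, c). t [^] (i::nat) \<otimes> rep c) ` ({..n} \<times> ?Q) \<subseteq> ?B (n * (len t + 1))"
      proof (rule image_subsetI)
        fix ic assume "ic \<in> {..n} \<times> ?Q"
        then obtain i x where i: "i \<in> {..n}" and x: "x \<in> carrier G" "len x \<le> n" and ic: "ic = (i, H #> x)" by auto
        then have q: "H #> x \<in> ?Q" by auto
        have "len (t [^] i \<otimes> rep (H #> x)) \<le> len (t [^] i) + len (rep (H #> x))"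
          using len_mult t rep[OF q] by simp
        also have "\<dots> \<le> n * len t + n" using rep[OF q] len_pow[OF t(1), of i] i 
          by (intro add_mono) (auto intro: order_trans)
        finally show "(\<lambda>(i, c). t [^] i \<otimes> rep c) ic \<in> ?B (n * (len t + 1))"
          using t rep[OF q] unfolding ic by (simp add: algebra_simps)
      qed
      ultimately have "card ({..n} \<times> ?Q) \<le> card (?B (n * (len t + 1)))"
        by (intro card_inj_on_le[OF _ _ finite_ball])
      moreover have "Suc n * Suc n \<le> card ({..n} \<times> ?Q)"
        using mult_le_mono2[OF infinite_index_cosets[OF H inf, of n], of "Suc n"]
        by (simp only: card_cartesian_product card_atMost)
      ultimately show ?thesis by linarith
    qed
    note quad = this
    \<comment> \<open>Chosen so that the linear bound at radius \<open>m * (len t + 1)\<close> is at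
      most \<open>m * Suc m\<close>, just below the quadratic lower bound.\<close>
    define m where "m = K * (2 * (len t + 1) + 1)"
    have "Suc m * Suc m \<le> K * (2 * (m * (len t + 1)) + 1)"
      using quad[of m] lin[of "m * (len t + 1)"] by linarith
    also have "\<dots> \<le> K * ((2 * (len t + 1) + 1) * Suc m)"
      by (intro mult_left_mono) (auto simp: algebra_simps)
    also have "\<dots> = m * Suc m" unfolding m_def by (simp only: mult.assoc)
    finally show False by simp
  qed
  then show ?thesis unfolding elementary_def H_def using t by blast
qed

lemma nonelementary_hyp_group:
  assumes "word_hyperbolic G" "\<not> elementary G" "combing G S L"
  shows "\<exists>\<kappa>. hyp_group G S \<kappa>"
proof -
  obtain \<kappa> where "cay.four_point \<kappa>" using word_hyperbolic_four_point assms(1) by blast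
  moreover have "\<exists>R. K * (2 * R + 1) < card {g \<in> carrier G. len g \<le> R}" for K
    using linear_growth_imp_elementary[OF assms(3), of K] assms(2) not_le by blast
  ultimately have "hyp_group G S \<kappa>" by unfold_locales
  then show ?thesis by blast
qed

end

section \<open>Finite Markov chains\<close>

lemma finite_convergent_subsequence:
  fixes x :: "nat \<Rightarrow> 'q \<Rightarrow> real"
  assumes "finite V" "\<And>n v. v \<in> V \<Longrightarrow> x n v \<in> {0..K}"
  shows "\<exists>r \<rho>. strict_mono (r :: nat \<Rightarrow> nat) \<and> (\<forall>v\<in>V. (\<lambda>n. x (r n) v) \<longlonglongrightarrow> \<rho> v)"
  using assms
proof (induction V rule: finite_induct)
  case empty
  then show ?case by (intro exI[of _ id]) (auto simp: strict_mono_def)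
next
  case (insert u V)
  have "\<exists>r \<rho>. strict_mono (r :: nat \<Rightarrow> nat) \<and> (\<forall>v\<in>V. (\<lambda>n. x (r n) v) \<longlonglongrightarrow> \<rho> v)"
    by (rule insert.IH) (use insert.prems in auto)
  then obtain r \<rho> where r: "strict_mono (r :: nat \<Rightarrow> nat)" "\<forall>v\<in>V. (\<lambda>n. x (r n) v) \<longlonglongrightarrow> \<rho> v"
    by blast
  have "seq_compact {0..K}" by (rule compact_imp_seq_compact) simp
  moreover have "\<forall>n. x (r n) u \<in> {0..K}" using insert.prems by blast
  ultimately obtain l s where s: "strict_mono (s :: nat \<Rightarrow> nat)" "((\<lambda>n. x (r n) u) \<circ> s) \<longlonglongrightarrow> l"
    by (rule seq_compactE)
  have "(\<lambda>n. x (r (s n)) v) \<longlonglongrightarrow> \<rho> v" if "v \<in> V" for v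
    using LIMSEQ_subseq_LIMSEQ[OF bspec[OF r(2) that] s(1)] by (simp add: o_def)
  moreover have "strict_mono (r \<circ> s)" using r(1) s(1) by (rule strict_mono_o)
  ultimately show ?case using s(2) insert.hyps
    by (intro exI[of _ "r \<circ> s"] exI[of _ "\<rho>(u := l)"]) (auto simp: o_def)
qed

text \<open>
  Since the matrix is nonnegative, boundedness of the orbit of the constant function \<open>1\<close> makes the matrix power bounded
  in the sup norm; so the limit of a subsequence of the averages is already the limit of all of them.
\<close>

lemma cesaro_nonneg_iteration:
  fixes b :: "nat \<Rightarrow> 'q \<Rightarrow> real" and A :: "'q \<Rightarrow> 'q \<Rightarrow> real"
  assumes fin: "finite V" and A: "\<And>v u. 0 \<le> A v u"
    and b0: "\<And>v. v \<in> V \<Longrightarrow> b 0 v = 1"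
    and bS: "\<And>k v. v \<in> V \<Longrightarrow> b (Suc k) v = (\<Sum>u\<in>V. A v u * b k u)"
    and bK: "\<And>k v. v \<in> V \<Longrightarrow> b k v \<le> K"
  shows "\<exists>\<rho>. \<forall>v\<in>V. (\<lambda>m. (\<Sum>k<m. b k v) / real m) \<longlonglongrightarrow> \<rho> v \<and> (\<Sum>u\<in>V. A v u * \<rho> u) = \<rho> v"
proof (cases "V = {}")
  case False
  then have K1: "1 \<le> K" using b0 bK by (metis ex_in_conv)
  define avg where "avg m v = (\<Sum>k<m. b k v) / real m" for m v
  define sh where "sh j n v = (\<Sum>k<n. b (j + k) v) / real n" for j n v
  have bpos: "0 \<le> b k v" if "v \<in> V" for k v
    using that by (induction k arbitrary: v) (auto simp: b0 bS A intro!: sum_nonneg mult_nonneg_nonneg)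
  have sum_le: "0 \<le> (\<Sum>k\<in>I. b (f k) v)" "(\<Sum>k\<in>I. b (f k) v) \<le> card I * K" if "v \<in> V" for I :: "nat set" and f :: "nat \<Rightarrow> nat" and v
    using bpos bK that by (auto intro!: sum_nonneg sum_bounded_above)
  have "avg m v \<in> {0..K}" if "v \<in> V" for m v
    using sum_le[OF that, where I="{..<m}" and f="\<lambda>k. k"] K1 unfolding avg_def by (auto simp: divide_simps mult.commute)
  then obtain r \<rho> where r: "strict_mono (r :: nat \<Rightarrow> nat)" "\<And>v. v \<in> V \<Longrightarrow> (\<lambda>n. avg (r n) v) \<longlonglongrightarrow> \<rho> v"
    using finite_convergent_subsequence[OF fin, of avg K] by blast
  \<comment> \<open>So \<open>sh j n\<close> is the \<open>j\<close>-th power of the matrix applied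
    to the average \<open>avg n\<close>.\<close>
  have shS: "sh (Suc j) n v = (\<Sum>u\<in>V. A v u * sh j n u)" if "v \<in> V" for j n v
    unfolding sh_def add_Suc using that
    by (simp add: bS sum_divide_distrib sum_distrib_left) (rule sum.swap)
  have close: "\<bar>(\<Sum>k<n. b k v) - (\<Sum>k<n. b (j + k) v)\<bar> \<le> j * K" if v: "v \<in> V" for n j v
  proof -
    have "(\<Sum>k<n + j. b k v) = (\<Sum>k<n. b k v) + (\<Sum>k<j. b (n + k) v)" 
      by (induction j) auto
    moreover have "(\<Sum>k<j + n. b k v) = (\<Sum>k<j. b k v) + (\<Sum>k<n. b (j + k) v)" 
      by (induction n) auto
    moreover have "j + n = n + j" by simp
    moreover have "0 \<le> (\<Sum>k<j. b k v)" "(\<Sum>k<j. b k v) \<le> j * K" "0 \<le> (\<Sum>k<j. b (n + k) v)" "(\<Sum>k<j. b (n + k) v) \<le> j * K"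
      using sum_le[OF v, where I="{..<j}" and f="\<lambda>k. k"] sum_le[OF v, where I="{..<j}" and f="\<lambda>k. n + k"] by auto
    ultimately show ?thesis by (smt (verit))
  qed
  have avgsh: "avg n v = sh 0 n v" for n v unfolding avg_def sh_def by simp
  have fixed: "(\<Sum>u\<in>V. A v u * \<rho> u) = \<rho> v" if v: "v \<in> V" for v
  proof -
    have "(\<lambda>n. \<Sum>u\<in>V. A v u * avg (r n) u) \<longlonglongrightarrow> (\<Sum>u\<in>V. A v u * \<rho> u)"
      using r(2) by (intro tendsto_intros) auto
    moreover have "(\<lambda>n. (\<Sum>u\<in>V. A v u * avg (r n) u)) \<longlonglongrightarrow> \<rho> v"
    proof (rule Lim_transform[OF r(2)[OF v]])
      have *: "norm (avg (r n) v - (\<Sum>u\<in>V. A v u * avg (r n) u)) \<le> K / real n" if "0 < n" for n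
      proof -
        have n: "n \<le> r n" using r(1) by (rule seq_suble)
        have "avg (r n) v - (\<Sum>u\<in>V. A v u * avg (r n) u) = ((\<Sum>k<r n. b k v) - (\<Sum>k<r n. b (1 + k) v)) / r n"
          unfolding avgsh using shS[OF v, of 0 "r n"] by (simp add: sh_def diff_divide_distrib)
        then have "norm (avg (r n) v - (\<Sum>u\<in>V. A v u * avg (r n) u)) \<le> K / real (r n)"
          using close[OF v, of "r n" 1] by (simp add: divide_right_mono)
        also have "\<dots> \<le> K / real n" using n that K1 by (intro divide_left_mono) auto
        finally show ?thesis .
      qed
      show "(\<lambda>n. (\<Sum>u\<in>V. A v u * avg (r n) u) - avg (r n) v) \<longlonglongrightarrow> 0"
      proof (rule Lim_null_comparison[OF _ lim_const_over_n[of K]])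
        show "\<forall>\<^sub>F n in sequentially. norm ((\<Sum>u\<in>V. A v u * avg (r n) u) - avg (r n) v) \<le> K / real n"
          using * unfolding norm_minus_commute[of "avg _ v"] by (intro eventually_sequentiallyI[of 1]) simp
      qed
    qed
    ultimately show ?thesis using LIMSEQ_unique by blast
  qed
  have contract: "\<bar>sh j n v - \<rho> v\<bar> \<le> \<epsilon> * b j v" 
    if \<epsilon>: "\<And>u. u \<in> V \<Longrightarrow> \<bar>avg n u - \<rho> u\<bar> \<le> \<epsilon>" and v: "v \<in> V" for \<epsilon> j n v
    using v
  proof (induction j arbitrary: v)
    case 0
    then show ?case using \<epsilon> b0 by (simp add: avgsh)
  next
    case (Suc j)
    have "sh (Suc j) n v - \<rho> v = (\<Sum>u\<in>V. A v u * (sh j n u - \<rho> u))"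
      using shS[OF Suc.prems, of j n] fixed[OF Suc.prems] by (simp add: sum_subtractf right_diff_distrib)
    also have "\<bar>\<dots>\<bar> \<le> (\<Sum>u\<in>V. A v u * (\<epsilon> * b j u))"
      using Suc.IH A by (intro order_trans[OF sum_abs] sum_mono) (auto simp: abs_mult intro!: mult_left_mono)
    also have "\<dots> = \<epsilon> * b (Suc j) v" using Suc.prems by (simp add: bS sum_distrib_left mult_ac)
    finally show ?case .
  qed
  have "(\<lambda>m. avg m v) \<longlonglongrightarrow> \<rho> v" if v: "v \<in> V" for v
  proof (rule LIMSEQ_I)
    fix \<eta> :: real assume "0 < \<eta>"
    define \<epsilon> where "\<epsilon> = \<eta> / (2 * K)"
    have \<epsilon>: "0 < \<epsilon>" "\<epsilon> * K = \<eta> / 2" unfolding \<epsilon>_def using \<open>0 < \<eta>\<close> K1 by auto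
    have "\<forall>u\<in>V. \<forall>\<^sub>F i in sequentially. dist (avg (r i) u) (\<rho> u) < \<epsilon>"
      using tendstoD[OF r(2) \<epsilon>(1)] by blast
    from eventually_ball_finite[OF fin this]
    obtain i0 where i0: "\<forall>i\<ge>i0. \<forall>u\<in>V. dist (avg (r i) u) (\<rho> u) < \<epsilon>"
      unfolding eventually_sequentially by blast
    \<comment> \<open>The successor only ensures that \<open>n\<close> is positive.\<close>
    define n where "n = r (Suc i0)"
    have n: "\<bar>avg n u - \<rho> u\<bar> \<le> \<epsilon>" if "u \<in> V" for u
      using bspec[OF spec[OF i0, THEN mp, of "Suc i0"] that] unfolding n_def by (simp add: dist_real_def)
    have "0 < n" using seq_suble[OF r(1), of "Suc i0"] unfolding n_def by simp
    obtain m0 where m0: "2 * (n * K) / \<eta> < real m0" using reals_Archimedean2 by blast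
    show "\<exists>m0. \<forall>m\<ge>m0. norm (avg m v - \<rho> v) < \<eta>"
    proof (intro exI allI impI)
      fix m assume m: "Suc m0 \<le> m"
      then have m0': "0 < real m" by simp
      have "2 * (n * K) / \<eta> < real m" using m m0 by linarith
      then have nm: "n * K / real m < \<eta> / 2" using \<open>0 < \<eta>\<close> m0' by (simp add: field_simps)
      \<comment> \<open>A double average. Over the shifts \<open>j < m\<close> it stays near
        \<open>\<rho> v\<close> by \<open>contract\<close>; after exchanging the sums it differs
        from \<open>avg m v\<close> by boundary terms of order \<open>n / m\<close> only.\<close>
      define D where "D = (\<Sum>j<m. sh j n v) / real m"
      have "\<bar>D - \<rho> v\<bar> \<le> \<eta> / 2"
      proof -
        have "D - \<rho> v = (\<Sum>j<m. sh j n v - \<rho> v) / real m"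
          unfolding D_def sum_subtractf using m0' by (simp add: field_simps)
        also have "\<bar>\<dots>\<bar> \<le> (\<Sum>j<m. \<eta> / 2) / real m"
          unfolding abs_divide
        proof (intro divide_mono order_trans[OF sum_abs] sum_mono)
          fix j
          have "\<bar>sh j n v - \<rho> v\<bar> \<le> \<epsilon> * b j v" using contract[OF n v] .
          also have "\<dots> \<le> \<epsilon> * K" using bK[OF v] \<epsilon> by (intro mult_left_mono) auto
          finally show "\<bar>sh j n v - \<rho> v\<bar> \<le> \<eta> / 2" using \<epsilon> by simp
        qed (use m0' in \<open>auto intro: sum_nonneg\<close>)
        finally show ?thesis using m0' by simp
      qed
      moreover have "\<bar>avg m v - D\<bar> \<le> n * K / real m"
      proof -
        have "D = (\<Sum>k<n. \<Sum>j<m. b (k + j) v) / real n / real m"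
          unfolding D_def sh_def sum_divide_distrib[symmetric] by (subst sum.swap) (simp add: add.commute)
        moreover have "(\<Sum>k<n. \<Sum>j<m. b j v) = real n * (\<Sum>j<m. b j v)" by simp
        then have "avg m v = (\<Sum>k<n. \<Sum>j<m. b j v) / real n / real m"
          unfolding avg_def using \<open>0 < n\<close> by (simp del: sum_constant)
        ultimately have "avg m v - D = (\<Sum>k<n. (\<Sum>j<m. b j v) - (\<Sum>j<m. b (k + j) v)) / real n / real m"
          by (simp only: sum_subtractf diff_divide_distrib)
        moreover have "\<bar>\<Sum>k<n. (\<Sum>j<m. b j v) - (\<Sum>j<m. b (k + j) v)\<bar> \<le> (\<Sum>k<n. n * K)"
        proof (intro order_trans[OF sum_abs] sum_mono)
          fix k assume "k \<in> {..<n}"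
          then have "real k * K \<le> real n * K" using K1 by (intro mult_right_mono) auto
          then show "\<bar>(\<Sum>j<m. b j v) - (\<Sum>j<m. b (k + j) v)\<bar> \<le> real n * K" using close[OF v, of m k] by linarith
        qed
        then have "\<bar>\<Sum>k<n. (\<Sum>j<m. b j v) - (\<Sum>j<m. b (k + j) v)\<bar> / real n / real m \<le> (\<Sum>k<n. n * K) / real n / real m"
          by (intro divide_right_mono) auto
        ultimately show ?thesis using \<open>0 < n\<close> m0' by simp
      qed
      ultimately show "norm (avg m v - \<rho> v) < \<eta>" using nm unfolding real_norm_def by linarith
    qed
  qed
  then show ?thesis using fixed unfolding avg_def by blast
qed simp

locale finite_automaton = automaton out tr for out :: "'q \<Rightarrow> 'a set" and tr +
  fixes V :: "'q set"
  assumes finite_V: "finite V"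
    and finite_out: "v \<in> V \<Longrightarrow> finite (out v)"
    and tr_closed: "v \<in> V \<Longrightarrow> s \<in> out v \<Longrightarrow> tr v s \<in> V"
begin

definition words :: "'q \<Rightarrow> nat \<Rightarrow> 'a list set" where
  "words v n = {w. length w = n \<and> acc v w}"

lemma words_0 [simp]: "words v 0 = {[]}"
  by (auto simp: words_def)

lemma words_Suc: "words v (Suc n) = (\<Union>s\<in>out v. (#) s ` words (tr v s) n)"
  by (auto simp: words_def length_Suc_conv image_iff)

lemma finite_words [simp, intro]: "v \<in> V \<Longrightarrow> finite (words v n)"
  by (induction n arbitrary: v) (auto simp: words_Suc finite_out tr_closed)

lemma sum_words_Suc:
  assumes "v \<in> V"
  shows "(\<Sum>w\<in>words v (Suc n). F w) = (\<Sum>s\<in>out v. \<Sum>w\<in>words (tr v s) n. F (s # w))"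
proof -
  have "(\<Sum>w\<in>words v (Suc n). F w) = (\<Sum>s\<in>out v. \<Sum>w\<in>(#) s ` words (tr v s) n. F w)"
    unfolding words_Suc using assms by (intro sum.UNION_disjoint) (auto simp: finite_out tr_closed)
  then show ?thesis by (simp add: sum.reindex inj_on_def)
qed

lemma run_in: "v \<in> V \<Longrightarrow> acc v w \<Longrightarrow> run v w \<in> V"
  using run_closed[of V] tr_closed by blast

lemma card_words_Suc: "v \<in> V \<Longrightarrow> card (words v (Suc n)) = (\<Sum>s\<in>out v. card (words (tr v s) n))"
  using sum_words_Suc[of v "\<lambda>_. 1 :: nat" n] by simp

end

section \<open>Markov chains on automata and their twisted transition operators\<close>

locale chain = finite_automaton out tr V for out :: "'q \<Rightarrow> 'a set" and tr V +
  fixes p :: "'q \<Rightarrow> 'a \<Rightarrow> real"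
  assumes p_pos: "v \<in> V \<Longrightarrow> s \<in> out v \<Longrightarrow> 0 < p v s"
    and p_sum: "v \<in> V \<Longrightarrow> (\<Sum>s\<in>out v. p v s) = 1"
begin

fun pr :: "'q \<Rightarrow> 'a list \<Rightarrow> real" where
  "pr v [] = 1"
| "pr v (s # w) = p v s * pr (tr v s) w"

lemma pr_pos: "v \<in> V \<Longrightarrow> acc v w \<Longrightarrow> 0 < pr v w"
  by (induction w arbitrary: v) (auto simp: p_pos tr_closed)

lemma sum_pr: "v \<in> V \<Longrightarrow> (\<Sum>w\<in>words v n. pr v w) = 1"
proof (induction n arbitrary: v)
  case (Suc n)
  then show ?case by (simp add: sum_words_Suc sum_distrib_left[symmetric] tr_closed p_sum)
qed simp

lemma norm_average:
  assumes "v \<in> V" "\<And>s. s \<in> out v \<Longrightarrow> norm (z s) \<le> B"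
  shows "norm (\<Sum>s\<in>out v. of_real (p v s) * z s :: complex) \<le> B"
proof -
  have "norm (\<Sum>s\<in>out v. of_real (p v s) * z s) \<le> (\<Sum>s\<in>out v. p v s * B)"
  proof (rule sum_norm_le)
    fix s assume "s \<in> out v"
    then show "norm (of_real (p v s) * z s) \<le> p v s * B"
      using assms(2)[of s] p_pos[OF assms(1), of s] by (simp add: norm_mult)
  qed
  then show ?thesis using p_sum[OF assms(1)] by (simp add: sum_distrib_right[symmetric])
qed

text \<open>This is the \<open>n\<close>-th power of the transition operator twisted by
  \<open>iexp (\<theta> * g)\<close>, applied to \<open>h\<close>. For constant \<open>h = 1\<close>
  it is the characteristic function at \<theta> of the sum of \<open>g\<close> along
  \<open>n\<close> random steps from \<open>v\<close>.\<close>

definition charf :: "('q \<Rightarrow> real) \<Rightarrow> real \<Rightarrow> ('q \<Rightarrow> complex) \<Rightarrow> nat \<Rightarrow> 'q \<Rightarrow> complex" where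
  "charf g \<theta> h n v = (\<Sum>w\<in>words v n. of_real (pr v w) * iexp (\<theta> * wsum g v w) * h (run v w))"

lemma charf_0 [simp]: "charf g \<theta> h 0 v = h v"
  by (simp add: charf_def)

lemma charf_Suc:
  assumes "v \<in> V"
  shows "charf g \<theta> h (Suc n) v = (\<Sum>s\<in>out v. of_real (p v s) * (iexp (\<theta> * g (tr v s)) * charf g \<theta> h n (tr v s)))"
  unfolding charf_def sum_words_Suc[OF assms]
  by (simp add: sum_distrib_left ring_distribs exp_add mult_ac)

lemma charf_diff: "charf g \<theta> (\<lambda>u. h u - k u) n v = charf g \<theta> h n v - charf g \<theta> k n v"
  unfolding charf_def by (simp add: right_diff_distrib sum_subtractf)

lemma norm_charf_le:
  assumes "U \<subseteq> V" "\<And>v s. v \<in> U \<Longrightarrow> s \<in> out v \<Longrightarrow> tr v s \<in> U" "\<And>v. v \<in> U \<Longrightarrow> norm (h v) \<le> B" "v \<in> U"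
  shows "norm (charf g \<theta> h n v) \<le> B"
  using assms(4)
proof (induction n arbitrary: v)
  case 0
  then show ?case using assms(3) by simp
next
  case (Suc n)
  then have "v \<in> V" using assms(1) by blast
  show ?case unfolding charf_Suc[OF \<open>v \<in> V\<close>]
    by (rule norm_average[OF \<open>v \<in> V\<close>]) (simp add: norm_mult Suc assms(2))
qed

text \<open>The twisted operator does not increase the sup norm on the invariant set
  \<open>U\<close>, so every further application contributes the one-step error at most once more,
  times a power of \<mu>. Hence the error is linear in \<open>n\<close>, up to the factor
  \<open>m ^ n\<close>.\<close>

lemma charf_eigen:
  assumes U: "U \<subseteq> V" "\<And>v s. v \<in> U \<Longrightarrow> s \<in> out v \<Longrightarrow> tr v s \<in> U"
    and eig: "\<And>v. v \<in> U \<Longrightarrow> norm (charf g \<theta> h 1 v - \<mu> * h v) \<le> B"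
    and \<mu>: "norm \<mu> \<le> m" "1 \<le> m" and v: "v \<in> U"
  shows "norm (charf g \<theta> h n v - \<mu> ^ n * h v) \<le> n * m ^ n * B"
  using v
proof (induction n arbitrary: v)
  case (Suc n)
  have vV: "v \<in> V" using Suc.prems U by blast
  have B0: "0 \<le> B" using eig[OF Suc.prems] norm_ge_zero order_trans by blast
  have m0: "0 \<le> m ^ n" using \<mu> by simp
  have one: "charf g \<theta> h 1 v = (\<Sum>s\<in>out v. of_real (p v s) * (iexp (\<theta> * g (tr v s)) * h (tr v s)))"
    using charf_Suc[OF vV, of g \<theta> h 0] by simp
  have "charf g \<theta> h (Suc n) v - \<mu> ^ n * charf g \<theta> h 1 v =
     (\<Sum>s\<in>out v. of_real (p v s) * (iexp (\<theta> * g (tr v s)) * (charf g \<theta> h n (tr v s) - \<mu> ^ n * h (tr v s))))"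
    unfolding one charf_Suc[OF vV] sum_distrib_left sum_subtractf[symmetric] 
    by (intro sum.cong) (auto simp: algebra_simps)
  also have "norm \<dots> \<le> n * m ^ n * B"
    by (rule norm_average[OF vV]) (simp add: norm_mult Suc.IH U(2) Suc.prems)
  finally have 1: "norm (charf g \<theta> h (Suc n) v - \<mu> ^ n * charf g \<theta> h 1 v) \<le> n * m ^ n * B" .
  have "norm (\<mu> ^ n * (charf g \<theta> h 1 v - \<mu> * h v)) \<le> m ^ n * B"
    unfolding norm_mult norm_power using eig[OF Suc.prems] \<mu> B0
    by (intro mult_mono power_mono) auto
  then have 2: "norm (\<mu> ^ n * charf g \<theta> h 1 v - \<mu> ^ Suc n * h v) \<le> m ^ n * B"
    by (simp add: algebra_simps)
  have "norm (charf g \<theta> h (Suc n) v - \<mu> ^ Suc n * h v) \<le> n * m ^ n * B + m ^ n * B"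
    using 1 2 norm_triangle_ineq[of "charf g \<theta> h (Suc n) v - \<mu> ^ n * charf g \<theta> h 1 v" "\<mu> ^ n * charf g \<theta> h 1 v - \<mu> ^ Suc n * h v"]
    by simp
  also have "\<dots> = (real (Suc n) * B) * m ^ n" by (simp add: algebra_simps)
  also have "\<dots> \<le> (real (Suc n) * B) * m ^ Suc n"
    using B0 \<mu>(2) m0 by (intro mult_left_mono) (auto simp: mult_le_cancel_right1)
  finally show ?case by (simp add: mult_ac)
qed simp

end

text \<open>Multiply the second order Taylor polynomial of \<open>iexp (\<theta> * g)\<close> with
  the trial function and drop all terms beyond order two; the term \<open>- g * a1\<close> is the
  product of the two linear ones. Since \<open>1 \<le> M\<close>, all leftovers are absorbed into
  \<open>M ^ 4\<close>.\<close>

lemma second_order_expansion: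
  fixes \<theta> g a1 a2 M :: real
  assumes "\<bar>\<theta>\<bar> \<le> 1" "\<bar>g\<bar> \<le> M" "\<bar>a1\<bar> \<le> M" "\<bar>a2\<bar> \<le> M" "1 \<le> M"
  shows "norm (iexp (\<theta> * g) * (1 + \<i> * \<theta> * a1 + \<theta>\<^sup>2 * a2) -
           (1 + \<i> * \<theta> * (a1 + g) + \<theta>\<^sup>2 * (a2 - g * a1 - g\<^sup>2 / 2))) \<le> 8 * M ^ 4 * \<bar>\<theta>\<bar> ^ 3"
proof -
  let ?A = "1 + \<i> * \<theta> * a1 + \<theta>\<^sup>2 * a2 :: complex"
  let ?T = "1 + \<i> * (\<theta> * g) - (\<theta> * g)\<^sup>2 / 2 :: complex"
  have t3: "\<bar>\<theta>\<bar> ^ 4 \<le> \<bar>\<theta>\<bar> ^ 3" using assms(1) by (intro power_decreasing) auto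
  have t2: "\<bar>\<theta>\<bar>\<^sup>2 \<le> 1" using assms(1) by (simp add: abs_square_le_1)
  have M0: "0 \<le> M" using assms by simp
  have "(\<Sum>k\<le>2. (\<i> * complex_of_real (\<theta> * g)) ^ k / fact k) = ?T"
    by (simp add: numeral_2_eq_2 power_mult_distrib)
  then have "norm (iexp (\<theta> * g) - ?T) \<le> \<bar>\<theta> * g\<bar> ^ 3 / 6"
    using iexp_approx1[of "\<theta> * g" 2] by (simp add: numeral_3_eq_3 fact_numeral)
  also have "\<dots> \<le> \<bar>\<theta>\<bar> ^ 3 * M ^ 3"
  proof -
    have "\<bar>\<theta> * g\<bar> ^ 3 \<le> \<bar>\<theta>\<bar> ^ 3 * M ^ 3" using assms unfolding abs_mult power_mult_distrib
      by (intro mult_left_mono power_mono) auto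
    moreover have "0 \<le> \<bar>\<theta>\<bar> ^ 3 * M ^ 3" using M0 by simp
    ultimately show ?thesis by linarith
  qed
  finally have r: "norm (iexp (\<theta> * g) - ?T) \<le> \<bar>\<theta>\<bar> ^ 3 * M ^ 3" .
  have "norm ?A \<le> norm (1 :: complex) + norm (\<i> * \<theta> * a1 :: complex) + norm (\<theta>\<^sup>2 * a2 :: complex)"
    by (rule order_trans[OF norm_triangle_ineq add_right_mono[OF norm_triangle_ineq]])
  also have "\<dots> = 1 + \<bar>\<theta>\<bar> * \<bar>a1\<bar> + \<bar>\<theta>\<bar>\<^sup>2 * \<bar>a2\<bar>" by (simp add: norm_mult norm_power)
  also have "\<dots> \<le> M + 1 * M + 1 * M" 
    using assms M0 t2 by (intro add_mono mult_mono) auto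
  finally have A: "norm ?A \<le> 3 * M" by simp
  have "norm ((iexp (\<theta> * g) - ?T) * ?A) \<le> (\<bar>\<theta>\<bar> ^ 3 * M ^ 3) * (3 * M)"
    unfolding norm_mult using r A by (intro mult_mono) (auto simp: M0)
  then have 1: "norm ((iexp (\<theta> * g) - ?T) * ?A) \<le> 3 * M ^ 4 * \<bar>\<theta>\<bar> ^ 3"
    by (simp add: power_numeral_reduce mult_ac)
  have pb: "\<bar>g * a2\<bar> \<le> M ^ 4" "\<bar>g\<^sup>2 * a1\<bar> \<le> M ^ 4" "\<bar>g\<^sup>2 * a2\<bar> \<le> M ^ 4"
  proof -
    have "\<bar>g * a2\<bar> \<le> M ^ 2" unfolding abs_mult power2_eq_square using assms by (intro mult_mono) auto
    also have "\<dots> \<le> M ^ 4" using assms by (intro power_increasing) auto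
    finally show "\<bar>g * a2\<bar> \<le> M ^ 4" .
    have "g\<^sup>2 \<le> M\<^sup>2" using power_mono[OF assms(2), of 2] by simp
    then have "\<bar>g\<^sup>2 * a1\<bar> \<le> M ^ 2 * M" "\<bar>g\<^sup>2 * a2\<bar> \<le> M ^ 2 * M" 
      unfolding abs_mult using assms(3,4) M0 by (auto intro: mult_mono)
    moreover have "M ^ 2 * M = M ^ 3" by (simp add: power_numeral_reduce)
    moreover have "M ^ 3 \<le> M ^ 4" using assms by (intro power_increasing) auto
    ultimately show "\<bar>g\<^sup>2 * a1\<bar> \<le> M ^ 4" "\<bar>g\<^sup>2 * a2\<bar> \<le> M ^ 4" by linarith+
  qed
  have "?T * ?A - (1 + \<i> * \<theta> * (a1 + g) + \<theta>\<^sup>2 * (a2 - g * a1 - g\<^sup>2 / 2)) =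
      \<i> * of_real (\<theta> ^ 3 * (g * a2)) - \<i> * of_real (\<theta> ^ 3 * (g\<^sup>2 * a1) / 2) - of_real (\<theta> ^ 4 * (g\<^sup>2 * a2) / 2)"
    by (simp add: algebra_simps power_numeral_reduce power2_eq_square)
  also have "norm \<dots> \<le> norm (\<i> * of_real (\<theta> ^ 3 * (g * a2)) :: complex) + norm (\<i> * of_real (\<theta> ^ 3 * (g\<^sup>2 * a1) / 2) :: complex) 
     + norm (of_real (\<theta> ^ 4 * (g\<^sup>2 * a2) / 2) :: complex)"
    by (rule order_trans[OF norm_triangle_ineq4 add_right_mono[OF norm_triangle_ineq4]])
  also have "\<dots> = \<bar>\<theta>\<bar> ^ 3 * \<bar>g * a2\<bar> + \<bar>\<theta>\<bar> ^ 3 * \<bar>g\<^sup>2 * a1\<bar> / 2 + \<bar>\<theta>\<bar> ^ 4 * \<bar>g\<^sup>2 * a2\<bar> / 2"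
    unfolding norm_mult norm_of_real by (simp add: abs_mult power_abs)
  also have "\<dots> \<le> \<bar>\<theta>\<bar> ^ 3 * M ^ 4 + \<bar>\<theta>\<bar> ^ 3 * M ^ 4 / 2 + \<bar>\<theta>\<bar> ^ 3 * M ^ 4 / 2"
    using pb t3 M0 by (intro add_mono divide_right_mono mult_mono) auto
  finally have 2: "norm (?T * ?A - (1 + \<i> * \<theta> * (a1 + g) + \<theta>\<^sup>2 * (a2 - g * a1 - g\<^sup>2 / 2))) \<le> 2 * M ^ 4 * \<bar>\<theta>\<bar> ^ 3"
    by (simp add: mult_ac)
  have "iexp (\<theta> * g) * ?A - (1 + \<i> * \<theta> * (a1 + g) + \<theta>\<^sup>2 * (a2 - g * a1 - g\<^sup>2 / 2)) =
      (iexp (\<theta> * g) - ?T) * ?A + (?T * ?A - (1 + \<i> * \<theta> * (a1 + g) + \<theta>\<^sup>2 * (a2 - g * a1 - g\<^sup>2 / 2)))"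
    by (simp add: algebra_simps)
  also have "norm \<dots> \<le> 3 * M ^ 4 * \<bar>\<theta>\<bar> ^ 3 + 2 * M ^ 4 * \<bar>\<theta>\<bar> ^ 3"
    using 1 2 by (rule norm_triangle_mono)
  also have "\<dots> \<le> 8 * M ^ 4 * \<bar>\<theta>\<bar> ^ 3" using M0 by (simp add: mult_right_mono)
  finally show ?thesis .
qed

context chain
begin

text \<open>
  With \<open>A = 1 + \<i> \<theta> a1 + \<theta>\<^sup>2 a2\<close>, the two equations say that \<open>A\<close> is an eigenfunction of the transition operator
  twisted by \<open>iexp (\<theta> * g)\<close>, up to an error of order \<open>\<theta>\<^sup>3\<close>.
\<close>

lemma twisted_eigenfunction:
  fixes a1 a2 g :: "'q \<Rightarrow> real"
  assumes v: "v \<in> V" and \<theta>: "\<bar>\<theta>\<bar> \<le> 1" and M: "1 \<le> M" "\<bar>s2\<bar> \<le> M" "\<bar>a1 v\<bar> \<le> M" "\<bar>a2 v\<bar> \<le> M"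
    "\<And>s. s \<in> out v \<Longrightarrow> \<bar>g (tr v s)\<bar> \<le> M \<and> \<bar>a1 (tr v s)\<bar> \<le> M \<and> \<bar>a2 (tr v s)\<bar> \<le> M"
    and eq1: "a1 v = (\<Sum>s\<in>out v. p v s * (a1 (tr v s) + g (tr v s)))"
    and eq2: "a2 v = (\<Sum>s\<in>out v. p v s * (a2 (tr v s) - g (tr v s) * a1 (tr v s) - (g (tr v s))\<^sup>2 / 2)) + s2 / 2"
  defines "A \<equiv> \<lambda>u. 1 + \<i> * \<theta> * a1 u + \<theta>\<^sup>2 * a2 u :: complex"
  shows "norm (charf g \<theta> A 1 v - of_real (1 - \<theta>\<^sup>2 * s2 / 2) * A v) \<le> 9 * M ^ 4 * \<bar>\<theta>\<bar> ^ 3"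
proof -
  define T where "T = (\<lambda>u. 1 + \<i> * \<theta> * (a1 u + g u) + \<theta>\<^sup>2 * (a2 u - g u * a1 u - (g u)\<^sup>2 / 2) :: complex)"
  have M0: "0 \<le> M" using M by simp
  have one: "charf g \<theta> A 1 v = (\<Sum>s\<in>out v. of_real (p v s) * (iexp (\<theta> * g (tr v s)) * A (tr v s)))"
    using charf_Suc[OF v, of g \<theta> A 0] by simp
  have "(\<Sum>s\<in>out v. of_real (p v s) * T (tr v s)) =
      of_real (\<Sum>s\<in>out v. p v s) + \<i> * \<theta> * of_real (\<Sum>s\<in>out v. p v s * (a1 (tr v s) + g (tr v s))) +
      \<theta>\<^sup>2 * of_real (\<Sum>s\<in>out v. p v s * (a2 (tr v s) - g (tr v s) * a1 (tr v s) - (g (tr v s))\<^sup>2 / 2))"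
    unfolding T_def of_real_sum sum_distrib_left sum.distrib[symmetric]
    by (intro sum.cong refl) (simp add: algebra_simps)
  also have "\<dots> = 1 + \<i> * \<theta> * a1 v + \<theta>\<^sup>2 * (a2 v - s2 / 2)"
    unfolding eq1[symmetric] p_sum[OF v] using eq2 by simp
  finally have sumT: "(\<Sum>s\<in>out v. of_real (p v s) * T (tr v s)) = 1 + \<i> * \<theta> * a1 v + \<theta>\<^sup>2 * (a2 v - s2 / 2)" .
  have "charf g \<theta> A 1 v - (\<Sum>s\<in>out v. of_real (p v s) * T (tr v s)) =
     (\<Sum>s\<in>out v. of_real (p v s) * (iexp (\<theta> * g (tr v s)) * A (tr v s) - T (tr v s)))"
    unfolding one by (simp add: sum_subtractf right_diff_distrib)
  also have "norm \<dots> \<le> 8 * M ^ 4 * \<bar>\<theta>\<bar> ^ 3"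
    unfolding A_def T_def using M \<theta> by (intro norm_average[OF v] second_order_expansion) auto
  finally have 1: "norm (charf g \<theta> A 1 v - (\<Sum>s\<in>out v. of_real (p v s) * T (tr v s))) \<le> 8 * M ^ 4 * \<bar>\<theta>\<bar> ^ 3" .
  have "1 + \<i> * \<theta> * a1 v + \<theta>\<^sup>2 * (a2 v - s2 / 2) - of_real (1 - \<theta>\<^sup>2 * s2 / 2) * A v =
      \<i> * of_real (\<theta> ^ 3 * (s2 * a1 v) / 2) + of_real (\<theta> ^ 4 * (s2 * a2 v) / 2)"
    unfolding A_def by (simp add: algebra_simps power_numeral_reduce power2_eq_square)
  also have "norm \<dots> \<le> norm (\<i> * of_real (\<theta> ^ 3 * (s2 * a1 v) / 2) :: complex) + norm (of_real (\<theta> ^ 4 * (s2 * a2 v) / 2) :: complex)"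
    by (rule norm_triangle_ineq)
  also have "\<dots> = \<bar>\<theta>\<bar> ^ 3 * \<bar>s2 * a1 v\<bar> / 2 + \<bar>\<theta>\<bar> ^ 4 * \<bar>s2 * a2 v\<bar> / 2"
    unfolding norm_mult norm_of_real by (simp add: abs_mult power_abs)
  also have "\<dots> \<le> \<bar>\<theta>\<bar> ^ 3 * M ^ 4 / 2 + \<bar>\<theta>\<bar> ^ 3 * M ^ 4 / 2"
  proof -
    have "\<bar>s2 * a1 v\<bar> \<le> M\<^sup>2" "\<bar>s2 * a2 v\<bar> \<le> M\<^sup>2"
      unfolding abs_mult power2_eq_square using M M0 by (auto intro: mult_mono)
    moreover have "M\<^sup>2 \<le> M ^ 4" using M by (intro power_increasing) auto
    ultimately have "\<bar>s2 * a1 v\<bar> \<le> M ^ 4" "\<bar>s2 * a2 v\<bar> \<le> M ^ 4" by linarith+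
    moreover have "\<bar>\<theta>\<bar> ^ 4 \<le> \<bar>\<theta>\<bar> ^ 3" using \<theta> by (intro power_decreasing) auto
    ultimately show ?thesis by (intro add_mono divide_right_mono mult_mono) auto
  qed
  finally have 2: "norm (1 + \<i> * \<theta> * a1 v + \<theta>\<^sup>2 * (a2 v - s2 / 2) - of_real (1 - \<theta>\<^sup>2 * s2 / 2) * A v) \<le> M ^ 4 * \<bar>\<theta>\<bar> ^ 3"
    by (simp add: mult_ac)
  show ?thesis
    using norm_triangle_mono[OF 1 2] unfolding sumT by (simp add: algebra_simps)
qed

text \<open>At the scale \<open>t / sqrt n\<close>, the \<open>n\<close> one-step errors of third
  order add up to order \<open>1 / sqrt n\<close>, replacing the constant 1 by the approximate
  eigenfunction costs the same order, and the \<open>n\<close>-th power of the eigenvalue tends to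
  the exponential.\<close>

lemma charf_tendsto:
  fixes a1 a2 g :: "'q \<Rightarrow> real"
  assumes U: "U \<subseteq> V" "\<And>v s. v \<in> U \<Longrightarrow> s \<in> out v \<Longrightarrow> tr v s \<in> U"
    and eq1: "\<And>v. v \<in> U \<Longrightarrow> a1 v = (\<Sum>s\<in>out v. p v s * (a1 (tr v s) + g (tr v s)))"
    and eq2: "\<And>v. v \<in> U \<Longrightarrow> a2 v = (\<Sum>s\<in>out v. p v s * (a2 (tr v s) - g (tr v s) * a1 (tr v s) - (g (tr v s))\<^sup>2 / 2)) + s2 / 2"
    and v: "v \<in> U"
  shows "(\<lambda>n. charf g (t / sqrt n) (\<lambda>_. 1) n v) \<longlonglongrightarrow> of_real (exp (- s2 * t\<^sup>2 / 2))"
proof -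
  define M where "M = 1 + \<bar>s2\<bar> + (\<Sum>u\<in>U. \<bar>g u\<bar> + \<bar>a1 u\<bar> + \<bar>a2 u\<bar>)"
  have finU: "finite U" using U finite_V finite_subset by blast
  have bd: "\<bar>g u\<bar> \<le> M \<and> \<bar>a1 u\<bar> \<le> M \<and> \<bar>a2 u\<bar> \<le> M" if "u \<in> U" for u
  proof -
    have "\<bar>g u\<bar> + \<bar>a1 u\<bar> + \<bar>a2 u\<bar> \<le> (\<Sum>u\<in>U. \<bar>g u\<bar> + \<bar>a1 u\<bar> + \<bar>a2 u\<bar>)"
      by (rule member_le_sum[OF that]) (auto simp: finU)
    then show ?thesis unfolding M_def by linarith
  qed
  have "0 \<le> (\<Sum>u\<in>U. \<bar>g u\<bar> + \<bar>a1 u\<bar> + \<bar>a2 u\<bar>)" by (intro sum_nonneg) auto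
  then have M: "1 \<le> M" "\<bar>s2\<bar> \<le> M" unfolding M_def by linarith+
  define A where "A \<theta> u = 1 + \<i> * \<theta> * a1 u + \<theta>\<^sup>2 * a2 u" for \<theta> :: real and u
  define \<mu> where "\<mu> \<theta> = complex_of_real (1 - \<theta>\<^sup>2 * s2 / 2)" for \<theta>
  \<comment> \<open>The first summand is the accumulated eigenvalue error, with the exponential
    bounding the power of \<mu>; the second is the cost of replacing 1 by
    \<open>A \<theta>\<close>.\<close>
  define C where "C = exp (t\<^sup>2 * M / 2) * (9 * M ^ 4) * \<bar>t\<bar> ^ 3 + 2 * M * \<bar>t\<bar>"
  have main: "norm (charf g \<theta> (\<lambda>_. 1) n v - \<mu> \<theta> ^ n * A \<theta> v) \<le> C / sqrt n"
    if n: "0 < n" and \<theta>: "\<theta> = t / sqrt n" "\<bar>\<theta>\<bar> \<le> 1" for n \<theta>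
  proof -
    let ?m = "exp (\<theta>\<^sup>2 * M / 2)"
    have step: "norm (charf g \<theta> (A \<theta>) 1 u - \<mu> \<theta> * A \<theta> u) \<le> 9 * M ^ 4 * \<bar>\<theta>\<bar> ^ 3" if u: "u \<in> U" for u
      unfolding \<mu>_def A_def
      by (rule twisted_eigenfunction[OF _ \<theta>(2) M _ _ _ eq1[OF u] eq2[OF u]]) (use bd u U in auto)
    have "norm (\<mu> \<theta>) = \<bar>1 - \<theta>\<^sup>2 * s2 / 2\<bar>" unfolding \<mu>_def by (rule norm_of_real)
    also have "\<dots> \<le> 1 + \<theta>\<^sup>2 * M / 2"
    proof -
      have "\<bar>\<theta>\<^sup>2 * s2 / 2\<bar> \<le> \<theta>\<^sup>2 * M / 2" using mult_left_mono[OF M(2), of "\<theta>\<^sup>2"] by (simp add: abs_mult)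
      then show ?thesis by linarith
    qed
    also have "\<dots> \<le> ?m" by (rule exp_ge_add_one_self)
    finally have m: "norm (\<mu> \<theta>) \<le> ?m" .
    have n\<theta>: "n * \<theta>\<^sup>2 = t\<^sup>2" "n * \<bar>\<theta>\<bar> ^ 3 = \<bar>t\<bar> ^ 3 / sqrt n"
    proof -
      show *: "n * \<theta>\<^sup>2 = t\<^sup>2" unfolding \<theta> using n by (simp add: power_divide)
      have "n * \<bar>\<theta>\<bar> ^ 3 = (n * \<theta>\<^sup>2) * \<bar>\<theta>\<bar>" by (simp add: power_numeral_reduce power2_eq_square abs_mult_self_eq)
      also have "\<dots> = \<bar>t\<bar> ^ 3 / sqrt n" unfolding * \<theta> by (simp add: power_numeral_reduce power2_eq_square abs_mult_self_eq)
      finally show "n * \<bar>\<theta>\<bar> ^ 3 = \<bar>t\<bar> ^ 3 / sqrt n" .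
    qed
    have "?m ^ n = exp (t\<^sup>2 * M / 2)" unfolding exp_of_nat_mult[symmetric] n\<theta>(1)[symmetric] by (simp add: mult_ac)
    moreover have "norm (charf g \<theta> (A \<theta>) n v - \<mu> \<theta> ^ n * A \<theta> v) \<le> n * ?m ^ n * (9 * M ^ 4 * \<bar>\<theta>\<bar> ^ 3)"
      using M by (intro charf_eigen[OF U step m _ v]) auto
    ultimately have 1: "norm (charf g \<theta> (A \<theta>) n v - \<mu> \<theta> ^ n * A \<theta> v) \<le> exp (t\<^sup>2 * M / 2) * (9 * M ^ 4) * (\<bar>t\<bar> ^ 3 / sqrt n)"
      unfolding n\<theta>(2)[symmetric] by (simp add: mult_ac)
    have A1: "norm (1 - A \<theta> u) \<le> 2 * M * \<bar>\<theta>\<bar>" if u: "u \<in> U" for u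
    proof -
      have "norm (1 - A \<theta> u) = norm (\<i> * \<theta> * a1 u + \<theta>\<^sup>2 * a2 u :: complex)" 
        unfolding A_def by (subst norm_minus_commute) simp
      also have "\<dots> \<le> norm (\<i> * \<theta> * a1 u :: complex) + norm (\<theta>\<^sup>2 * a2 u :: complex)" by (rule norm_triangle_ineq)
      also have "\<dots> = \<bar>\<theta>\<bar> * \<bar>a1 u\<bar> + \<bar>\<theta>\<bar> * (\<bar>\<theta>\<bar> * \<bar>a2 u\<bar>)" by (simp add: norm_mult norm_power power2_eq_square)
      also have "\<dots> \<le> \<bar>\<theta>\<bar> * M + \<bar>\<theta>\<bar> * (1 * M)" using bd[OF u] \<theta>(2) by (intro add_mono mult_mono) auto
      finally show ?thesis by simp
    qed
    have "norm (charf g \<theta> (\<lambda>u. 1 - A \<theta> u) n v) \<le> 2 * M * \<bar>\<theta>\<bar>"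
      by (rule norm_charf_le[where U = U]) (simp_all add: U v A1)
    then have 2: "norm (charf g \<theta> (\<lambda>_. 1) n v - charf g \<theta> (A \<theta>) n v) \<le> 2 * M * (\<bar>t\<bar> / sqrt n)"
      unfolding charf_diff \<theta> by simp
    show ?thesis using norm_triangle_mono[OF 2 1] unfolding C_def by (simp add: add_divide_distrib algebra_simps)
  qed
  have "(\<lambda>n. \<mu> (t / sqrt n) ^ n * A (t / sqrt n) v) \<longlonglongrightarrow> of_real (exp (- s2 * t\<^sup>2 / 2)) * (1 + \<i> * of_real 0 * of_real (a1 v) + of_real (0\<^sup>2 * a2 v))"
  proof (rule tendsto_mult)
    have "(\<lambda>n. (1 + (- s2 * t\<^sup>2 / 2) / real n) ^ n) \<longlonglongrightarrow> exp (- s2 * t\<^sup>2 / 2)" by (rule tendsto_exp_limit_sequentially)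
    then have "(\<lambda>n. of_real ((1 + (- s2 * t\<^sup>2 / 2) / real n) ^ n) :: complex) \<longlonglongrightarrow> of_real (exp (- s2 * t\<^sup>2 / 2))"
      by (rule tendsto_of_real)
    moreover have "\<mu> (t / sqrt n) ^ n = of_real ((1 + (- s2 * t\<^sup>2 / 2) / real n) ^ n)" for n
      unfolding \<mu>_def by (simp add: power_divide mult_ac)
    ultimately show "(\<lambda>n. \<mu> (t / sqrt n) ^ n) \<longlonglongrightarrow> of_real (exp (- s2 * t\<^sup>2 / 2))" by simp
    have "(\<lambda>n. t / sqrt (real n)) \<longlonglongrightarrow> 0" by real_asymp
    then show "(\<lambda>n. A (t / sqrt n) v) \<longlonglongrightarrow> 1 + \<i> * of_real 0 * of_real (a1 v) + of_real (0\<^sup>2 * a2 v)"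
      unfolding A_def by (intro tendsto_intros)
  qed
  then have lim: "(\<lambda>n. \<mu> (t / sqrt n) ^ n * A (t / sqrt n) v) \<longlonglongrightarrow> of_real (exp (- s2 * t\<^sup>2 / 2))" by simp
  show ?thesis
  proof (rule Lim_transform[OF lim], rule Lim_null_comparison)
    have "(\<lambda>n. t / sqrt (real n)) \<longlonglongrightarrow> 0" by real_asymp
    then have "\<forall>\<^sub>F n in sequentially. dist (t / sqrt (real n)) 0 < 1" by (rule tendstoD) simp
    then show "\<forall>\<^sub>F n in sequentially. norm (charf g (t / sqrt n) (\<lambda>_. 1) n v - \<mu> (t / sqrt n) ^ n * A (t / sqrt n) v) \<le> C / sqrt (real n)"
      using eventually_gt_at_top[of 0]
    proof eventually_elim
      case (elim n)
      show ?case by (rule main[OF elim(2) refl]) (use elim(1) in simp)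
    qed
    show "(\<lambda>n. C / sqrt (real n)) \<longlonglongrightarrow> 0" by real_asymp
  qed
qed

text \<open>The number \<open>s2\<close> arises as the constant in a Poisson equation and not as the
  mean of a square; its sign is read off from the limit at \<open>t = 1\<close>, which has modulus
  at most 1.\<close>

lemma charf_limit_variance_nonneg:
  assumes "v \<in> V" and lim: "\<And>t. (\<lambda>n. charf g (t / sqrt n) (\<lambda>_. 1) n v) \<longlonglongrightarrow> of_real (exp (- s2 * t\<^sup>2 / 2))"
  shows "0 \<le> s2"
proof -
  have "norm (of_real (exp (- s2 * 1\<^sup>2 / 2)) :: complex) \<le> 1"
  proof (rule LIMSEQ_le_const2[OF tendsto_norm[OF lim[of 1]]], intro exI allI impI)
    fix n show "norm (charf g (1 / sqrt n) (\<lambda>_. 1) n v) \<le> 1"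
      by (rule norm_charf_le[OF subset_refl tr_closed _ assms(1)]) simp_all
  qed
  then show ?thesis by simp
qed

end

section \<open>Recurrent classes, Dirichlet problems and the Poisson equation\<close>

context chain
begin

lemma p_nonneg: "v \<in> V \<Longrightarrow> s \<in> out v \<Longrightarrow> 0 \<le> p v s"
  using p_pos less_imp_le by blast

definition reach :: "'q \<Rightarrow> 'q set" where
  "reach v = {u. \<exists>w. acc v w \<and> run v w = u}"

definition recurrent :: "'q set" where
  "recurrent = {v \<in> V. \<forall>u\<in>reach v. v \<in> reach u}"

lemma reach_self [simp, intro]: "v \<in> reach v"
  unfolding reach_def by (auto intro: exI[of _ "[]"])

lemma reach_trans: "u \<in> reach v \<Longrightarrow> x \<in> reach u \<Longrightarrow> x \<in> reach v"
  unfolding reach_def by clarsimp (metis acc_append foldl_append)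

lemma reach_step: "s \<in> out v \<Longrightarrow> tr v s \<in> reach v"
  unfolding reach_def by (auto intro!: exI[of _ "[s]"])

lemma reach_closed: "u \<in> reach v \<Longrightarrow> s \<in> out u \<Longrightarrow> tr u s \<in> reach v"
  using reach_step reach_trans by blast

lemma reach_V: "v \<in> V \<Longrightarrow> reach v \<subseteq> V"
  unfolding reach_def using run_in by auto

lemma reach_recurrent:
  assumes "v \<in> recurrent" "u \<in> reach v"
  shows "u \<in> recurrent" "reach u = reach v"
proof -
  have v: "v \<in> V" "v \<in> reach u" using assms unfolding recurrent_def by auto
  show "reach u = reach v" using reach_trans v(2) assms(2) by blast
  then show "u \<in> recurrent" using assms reach_V[OF v(1)] reach_trans unfolding recurrent_def by blast
qed

text \<open>A state whose reachable set has minimal size among those reachable from \<open>v\<close>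
  is recurrent: whatever it leads to has the same reachable set.\<close>

lemma reaches_recurrent:
  assumes "v \<in> V" shows "\<exists>u\<in>recurrent. u \<in> reach v"
proof -
  have fin: "finite (reach u)" if "u \<in> V" for u using reach_V[OF that] finite_V finite_subset by blast
  obtain u where u: "u \<in> reach v" "\<And>x. x \<in> reach v \<Longrightarrow> card (reach u) \<le> card (reach x)"
    using arg_min_nat_lemma[of "\<lambda>u. u \<in> reach v" v "\<lambda>u. card (reach u)"] reach_self by blast
  have uV: "u \<in> V" using u reach_V assms by blast
  have "u \<in> reach x" if "x \<in> reach u" for x
  proof -
    have "reach x \<subseteq> reach u" using reach_trans that by blast
    moreover have "card (reach u) \<le> card (reach x)" using u reach_trans that by blast
    ultimately have "reach x = reach u" using fin[OF uV] card_seteq by blast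
    then show ?thesis by auto
  qed
  then show ?thesis using u uV unfolding recurrent_def by blast
qed

text \<open>The transition operator of the chain killed on \<open>B\<close>. Its iterates on the
  indicator of the complement of \<open>B\<close> are the probabilities of having avoided
  \<open>B\<close> up to time \<open>k\<close>.\<close>

definition killed :: "'q set \<Rightarrow> ('q \<Rightarrow> real) \<Rightarrow> 'q \<Rightarrow> real" where
  "killed B f v = (if v \<in> B then 0 else \<Sum>s\<in>out v. p v s * f (tr v s))"

lemma killed_mono:
  assumes U: "U \<subseteq> V" "\<And>v s. v \<in> U \<Longrightarrow> s \<in> out v \<Longrightarrow> tr v s \<in> U"
    and le: "\<And>v. v \<in> U \<Longrightarrow> f v \<le> h v" and v: "v \<in> U"
  shows "(killed B ^^ k) f v \<le> (killed B ^^ k) h v"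
  using v
proof (induction k arbitrary: v)
  case (Suc k)
  then have "v \<in> V" using U by blast
  show ?case using Suc U(2) p_nonneg[OF \<open>v \<in> V\<close>]
    by (auto simp: killed_def[of B "(killed B ^^ k) _"] intro!: sum_mono mult_left_mono)
qed (use le in simp)

lemma killed_scale: "(killed B ^^ k) (\<lambda>v. a * f v) v = a * (killed B ^^ k) f v"
  by (induction k arbitrary: v) (auto simp: killed_def sum_distrib_left mult_ac)

text \<open>From each of the finitely many states \<open>B\<close> is hit with positive probability.
  So there are a common time \<open>N\<close> and \<open>q < 1\<close> such that every further
  \<open>N\<close> steps reduce the probability of avoiding \<open>B\<close> by the factor
  \<open>q\<close>.\<close>

lemma dirichlet_summable:
  assumes U: "U \<subseteq> V" "\<And>v s. v \<in> U \<Longrightarrow> s \<in> out v \<Longrightarrow> tr v s \<in> U"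
    and B: "\<And>v. v \<in> U \<Longrightarrow> \<exists>b\<in>B. b \<in> reach v" and v: "v \<in> U"
  shows "summable (\<lambda>k. (killed B ^^ k) (\<lambda>v. if v \<in> B then 0 else 1) v)"
proof -
  let ?T = "killed B"
  let ?r0 = "\<lambda>v. if v \<in> B then 0 else 1 :: real"
  define r where "r k = (?T ^^ k) ?r0" for k
  have r_Suc: "r (Suc k) v = (if v \<in> B then 0 else \<Sum>s\<in>out v. p v s * r k (tr v s))" for k v
    unfolding r_def by (simp add: killed_def)
  have r_0: "r 0 v = ?r0 v" for v unfolding r_def by simp
  have finU: "finite U" using U finite_V finite_subset by blast
  have pp: "v \<in> U \<Longrightarrow> s \<in> out v \<Longrightarrow> 0 < p v s" for v s using U p_pos by blast
  have pn: "v \<in> U \<Longrightarrow> s \<in> out v \<Longrightarrow> 0 \<le> p v s" for v s using U p_nonneg by blast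
  have ps: "v \<in> U \<Longrightarrow> (\<Sum>s\<in>out v. p v s) = 1" for v using U p_sum by blast
  have rb: "0 \<le> r k v \<and> r k v \<le> 1" if "v \<in> U" for k v
    using that
  proof (induction k arbitrary: v)
    case (Suc k)
    have "0 \<le> (\<Sum>s\<in>out v. p v s * r k (tr v s))"
      using Suc U(2) pn by (intro sum_nonneg mult_nonneg_nonneg) auto
    moreover have "(\<Sum>s\<in>out v. p v s * r k (tr v s)) \<le> (\<Sum>s\<in>out v. p v s * 1)"
      using Suc U(2) pn by (intro sum_mono mult_left_mono) auto
    ultimately show ?case using ps[OF Suc.prems] unfolding r_Suc by simp
  qed (simp add: r_0)
  have dec: "r (Suc k) v \<le> r k v" if "v \<in> U" for k v
  proof -
    have "r 1 u \<le> r 0 u" if "u \<in> U" for u using rb[OF that, of 1] by (auto simp: r_0 r_Suc)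
    then have "(?T ^^ k) (r 1) v \<le> (?T ^^ k) (r 0) v" by (intro killed_mono[where U = U]) (simp_all add: U that)
    then show ?thesis unfolding r_def by (simp add: funpow_swap1)
  qed
  have decr: "r (k + j) v \<le> r k v" if "v \<in> U" for k j v
    by (induction j) (use dec[OF that] in \<open>auto intro: order_trans\<close>)
  have hit: "r (length w) v < 1" if "v \<in> U" "acc v w" "run v w \<in> B" for v w
    using that
  proof (induction w arbitrary: v)
    case Nil
    then show ?case by (simp add: r_0)
  next
    case (Cons s w)
    then have s: "s \<in> out v" "tr v s \<in> U" "r (length w) (tr v s) < 1" using U(2) by auto
    have "finite (out v)" using finite_out Cons.prems U by blast
    then have "(\<Sum>s\<in>out v. p v s * r (length w) (tr v s)) < (\<Sum>s\<in>out v. p v s * 1)"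
    proof (rule sum_strict_mono_ex1)
      show "\<forall>s\<in>out v. p v s * r (length w) (tr v s) \<le> p v s * 1"
        using pn[OF Cons.prems(1)] rb U(2)[OF Cons.prems(1)] by (intro ballI mult_left_mono) auto
      show "\<exists>s\<in>out v. p v s * r (length w) (tr v s) < p v s * 1"
        using s pp[OF Cons.prems(1) s(1)] by (intro bexI[of _ s] mult_strict_left_mono)
    qed
    then show ?case using ps[OF Cons.prems(1)] by (simp add: r_Suc)
  qed
  have "\<forall>v\<in>U. \<exists>l. r l v < 1"
    using hit B unfolding reach_def by blast
  then obtain l where l: "\<And>v. v \<in> U \<Longrightarrow> r (l v) v < 1" by metis
  define N where "N = (\<Sum>v\<in>U. l v)"
  have "r N v < 1" if "v \<in> U" for v
  proof -
    have "l v \<le> N" unfolding N_def using that finU by (simp add: member_le_sum)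
    then show ?thesis using decr[OF that, of "l v" "N - l v"] l[OF that] by simp
  qed
  \<comment> \<open>Inserting 0 keeps the maximum meaningful for empty \<open>U\<close> and makes
    \<open>q\<close> nonnegative.\<close>
  moreover define q where "q = Max (insert 0 (r N ` U))"
  ultimately have q: "q < 1" "0 \<le> q" "\<And>v. v \<in> U \<Longrightarrow> r N v \<le> q"
    using finU by (auto simp: Max_ge)
  have "r (k + N) v \<le> q * r k v" if v: "v \<in> U" for k v
  proof -
    have "r N u \<le> q * ?r0 u" if "u \<in> U" for u using q(3)[OF that] rb[OF that, of N] decr[OF that, of 0 N] by (auto simp: r_0)
    then have "(?T ^^ k) (r N) v \<le> (?T ^^ k) (\<lambda>u. q * ?r0 u) v" by (intro killed_mono[where U = U]) (simp_all add: U v)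
    then show ?thesis unfolding killed_scale r_def by (simp add: funpow_add)
  qed
  note geo = this
  have "(\<Sum>k<n. r k v) \<le> N / (1 - q)" for n
  proof -
    have "(\<Sum>k<n. r k v) \<le> (\<Sum>k<N + n. r k v)" using rb[OF v] by (intro sum_mono2) auto
    moreover have "(\<Sum>k<N + n. r k v) = (\<Sum>k<N. r k v) + (\<Sum>k<n. r (k + N) v)"
      by (induction n) (auto simp: add.commute)
    moreover have "(\<Sum>k<N. r k v) \<le> N" using sum_bounded_above[of "{..<N}" "\<lambda>k. r k v" 1] rb[OF v] by simp
    moreover have "(\<Sum>k<n. r (k + N) v) \<le> q * (\<Sum>k<n. r k v)"
      unfolding sum_distrib_left using geo[OF v] by (intro sum_mono)
    ultimately have "(1 - q) * (\<Sum>k<n. r k v) \<le> N" by (simp add: algebra_simps)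
    then show ?thesis using q(1) by (simp add: field_simps)
  qed
  then show ?thesis using rb[OF v] unfolding r_def by (intro summableI_nonneg_bounded) auto
qed

text \<open>The solution is the Neumann series of the killed operator. Its initial term
  \<open>h0\<close> combines the source \<open>g\<close> with the boundary values met after a single
  step, and the values on \<open>B\<close> are added as \<open>b0\<close>.\<close>

lemma dirichlet:
  fixes g b :: "'q \<Rightarrow> real"
  assumes U: "U \<subseteq> V" "\<And>v s. v \<in> U \<Longrightarrow> s \<in> out v \<Longrightarrow> tr v s \<in> U"
    and B: "\<And>v. v \<in> U \<Longrightarrow> \<exists>b\<in>B. b \<in> reach v"
  shows "\<exists>u. (\<forall>v\<in>B. u v = b v) \<and> (\<forall>v\<in>U - B. u v = g v + (\<Sum>s\<in>out v. p v s * u (tr v s)))"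
proof -
  let ?T = "killed B"
  define b0 where "b0 v = (if v \<in> B then b v else 0)" for v
  define h0 where "h0 v = (if v \<in> B then 0 else g v + (\<Sum>s\<in>out v. p v s * b0 (tr v s)))" for v
  define h where "h k = (?T ^^ k) h0" for k
  have h_Suc: "h (Suc k) = ?T (h k)" for k unfolding h_def by simp
  have finU: "finite U" using U finite_V finite_subset by blast
  define M where "M = (\<Sum>v\<in>U. \<bar>h0 v\<bar>)"
  let ?r0 = "\<lambda>v. if v \<in> B then 0 else 1 :: real"
  have M: "\<bar>h0 v\<bar> \<le> M * ?r0 v" if "v \<in> U" for v
  proof (cases "v \<in> B")
    case True then show ?thesis by (simp add: h0_def)
  next
    case False
    have "\<bar>h0 v\<bar> \<le> M" unfolding M_def by (rule member_le_sum[OF that]) (auto simp: finU)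
    then show ?thesis using False by simp
  qed
  have summ: "summable (\<lambda>k. h k v)" if v: "v \<in> U" for v
  proof (rule summable_comparison_test)
    show "\<exists>N. \<forall>k\<ge>N. norm (h k v) \<le> M * (?T ^^ k) ?r0 v"
    proof (intro exI allI impI)
      fix k
      have "h k v \<le> (?T ^^ k) (\<lambda>v. M * ?r0 v) v"
        unfolding h_def using M by (intro killed_mono[OF U _ v]) (auto simp: abs_le_iff)
      moreover have "(?T ^^ k) (\<lambda>v. (-1) * h0 v) v \<le> (?T ^^ k) (\<lambda>v. M * ?r0 v) v"
        using M by (intro killed_mono[OF U _ v]) (auto simp: abs_le_iff)
      ultimately show "norm (h k v) \<le> M * (?T ^^ k) ?r0 v"
        unfolding killed_scale h_def by (simp add: abs_le_iff)
    qed
    show "summable (\<lambda>k. M * (?T ^^ k) ?r0 v)"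
      by (intro summable_mult dirichlet_summable[OF U B v])
  qed
  define u where "u v = suminf (\<lambda>k. h k v) + b0 v" for v
  have hB: "h k v = 0" if "v \<in> B" for k v
    using that unfolding h_def by (cases k) (auto simp: h0_def killed_def)
  have "u v = b v" if "v \<in> B" for v
    unfolding u_def b0_def using that hB[OF that] by simp
  moreover have "u v = g v + (\<Sum>s\<in>out v. p v s * u (tr v s))" if v: "v \<in> U - B" for v
  proof -
    have vU: "v \<in> U" "v \<notin> B" using v by auto
    have "suminf (\<lambda>k. h k v) = h 0 v + suminf (\<lambda>k. h (Suc k) v)"
      using suminf_split_head[OF summ[OF vU(1)]] by simp
    also have "suminf (\<lambda>k. h (Suc k) v) = suminf (\<lambda>k. \<Sum>s\<in>out v. p v s * h k (tr v s))"
      unfolding h_Suc killed_def using vU by simp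
    also have "\<dots> = (\<Sum>s\<in>out v. suminf (\<lambda>k. p v s * h k (tr v s)))"
      using summ U(2)[OF vU(1)] by (intro suminf_sum summable_mult) auto
    also have "\<dots> = (\<Sum>s\<in>out v. p v s * suminf (\<lambda>k. h k (tr v s)))"
      using summ U(2)[OF vU(1)] by (intro sum.cong refl suminf_mult) auto
    finally show ?thesis unfolding u_def using vU
      by (simp add: h_def h0_def b0_def ring_distribs sum.distrib)
  qed
  ultimately show ?thesis by blast
qed

text \<open>Prescribing the value 0 at \<open>c\<close> solves the equation everywhere except at
  \<open>c\<close>, where a defect remains. The source \<open>g\<close> leaves the defect
  \<open>m\<close>, the constant source 1 leaves \<kappa>, the mean return time to \<open>c\<close>.
  Subtracting \<open>m / \<kappa>\<close> times the second solution cancels the defects, so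
  \<open>E = m / \<kappa>\<close> is the mean of \<open>g\<close>.\<close>

lemma poisson_recurrent_class:
  fixes g :: "'q \<Rightarrow> real"
  assumes c: "c \<in> recurrent"
  shows "\<exists>E u. \<forall>v\<in>reach c. u v = g v - E + (\<Sum>s\<in>out v. p v s * u (tr v s))"
proof -
  let ?C = "reach c"
  have cV: "c \<in> V" using c by (simp add: recurrent_def)
  have C: "?C \<subseteq> V" "\<And>v s. v \<in> ?C \<Longrightarrow> s \<in> out v \<Longrightarrow> tr v s \<in> ?C" using reach_V[OF cV] reach_closed by auto
  have B: "\<exists>b\<in>{c}. b \<in> reach v" if "v \<in> ?C" for v using c that by (auto simp: recurrent_def)
  have "\<exists>u m. \<forall>v\<in>?C. u v = g v - (if v = c then m else 0) + (\<Sum>s\<in>out v. p v s * u (tr v s))" for g :: "'q \<Rightarrow> real"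
  proof -
    obtain u where u: "u c = 0" "\<And>v. v \<in> ?C - {c} \<Longrightarrow> u v = g v + (\<Sum>s\<in>out v. p v s * u (tr v s))"
      using dirichlet[OF C B, of "\<lambda>_. 0" g] by auto
    show ?thesis using u
      by (intro exI[of _ u] exI[of _ "g c + (\<Sum>s\<in>out c. p c s * u (tr c s))"]) auto
  qed
  note base = this
  obtain u m where u: "\<And>v. v \<in> ?C \<Longrightarrow> u v = g v - (if v = c then m else 0) + (\<Sum>s\<in>out v. p v s * u (tr v s))"
    using base[of g] by blast
  obtain u1 \<kappa> where u1: "\<And>v. v \<in> ?C \<Longrightarrow> u1 v = 1 - (if v = c then \<kappa> else 0) + (\<Sum>s\<in>out v. p v s * u1 (tr v s))"
    using base[of "\<lambda>_. 1"] by blast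
  \<comment> \<open>Minimum principle: with \<kappa> zero, the minimal value of \<open>u1\<close>
    would exceed an average of values of \<open>u1\<close> by 1.\<close>
  have "\<kappa> \<noteq> 0"
  proof
    assume "\<kappa> = 0"
    have fin: "finite ?C" using C finite_V finite_subset by blast
    obtain v where v: "v \<in> ?C" "\<And>x. x \<in> ?C \<Longrightarrow> u1 v \<le> u1 x"
      using fin reach_self by (metis arg_min_if_finite(1) arg_min_least empty_iff)
    have vV: "v \<in> V" using v C by blast
    have "(\<Sum>s\<in>out v. p v s * u1 v) \<le> (\<Sum>s\<in>out v. p v s * u1 (tr v s))"
      using v C(2)[OF v(1)] p_nonneg[OF vV] by (intro sum_mono mult_left_mono) auto
    then have "u1 v \<le> (\<Sum>s\<in>out v. p v s * u1 (tr v s))" using p_sum[OF vV] by (simp add: sum_distrib_right[symmetric])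
    moreover have "u1 v = 1 + (\<Sum>s\<in>out v. p v s * u1 (tr v s))" using u1[OF v(1)] unfolding \<open>\<kappa> = 0\<close> if_cancel diff_zero .
    ultimately show False by linarith
  qed
  show ?thesis
  proof (intro exI ballI)
    fix v assume v: "v \<in> ?C"
    have "(\<Sum>s\<in>out v. p v s * (u (tr v s) - m / \<kappa> * u1 (tr v s))) =
       (\<Sum>s\<in>out v. p v s * u (tr v s)) - m / \<kappa> * (\<Sum>s\<in>out v. p v s * u1 (tr v s))"
      by (simp add: right_diff_distrib sum_subtractf sum_distrib_left mult_ac)
    moreover have "m / \<kappa> * u1 v = m / \<kappa> - (if v = c then m else 0) + m / \<kappa> * (\<Sum>s\<in>out v. p v s * u1 (tr v s))"
      using arg_cong[OF u1[OF v], of "\<lambda>z. m / \<kappa> * z"] \<open>\<kappa> \<noteq> 0\<close> by (simp add: ring_distribs)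
    ultimately show "u v - m / \<kappa> * u1 v = g v - m / \<kappa> + (\<Sum>s\<in>out v. p v s * (u (tr v s) - m / \<kappa> * u1 (tr v s)))"
      using u[OF v] by linarith
  qed
qed

text \<open>The Poisson equations at orders one and two in \<theta> of the eigenvalue equation for
  the twisted operator, with eigenvalue \<open>1 - \<theta>\<^sup>2 * s2 / 2\<close>. Solvability of
  the first means that \<open>g\<close> has mean 0 on each recurrent class in \<open>U\<close>;
  \<open>s2\<close> is the asymptotic variance.\<close>

definition clt_data :: "('q \<Rightarrow> real) \<Rightarrow> real \<Rightarrow> 'q set \<Rightarrow> ('q \<Rightarrow> real) \<Rightarrow> ('q \<Rightarrow> real) \<Rightarrow> bool" where
  "clt_data g s2 U a1 a2 \<longleftrightarrow>
     (\<forall>v\<in>U. a1 v = (\<Sum>s\<in>out v. p v s * (a1 (tr v s) + g (tr v s))) \<and>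
            a2 v = (\<Sum>s\<in>out v. p v s * (a2 (tr v s) - g (tr v s) * a1 (tr v s) - (g (tr v s))\<^sup>2 / 2)) + s2 / 2)"

text \<open>Each order is a Poisson equation whose source is known from the order before. The
  constant of the first is the mean \<open>E\<close>, that of the second is minus half of the
  variance.\<close>

lemma clt_data_recurrent_class:
  fixes f :: "'q \<Rightarrow> real"
  assumes c: "c \<in> recurrent"
  shows "\<exists>E s2 a1 a2. clt_data (\<lambda>v. f v - E) s2 (reach c) a1 a2"
proof -
  have ps: "(\<Sum>s\<in>out v. p v s) = 1" if "v \<in> reach c" for v
    using c that reach_V p_sum unfolding recurrent_def by blast
  obtain E a1 where a1: "\<And>v. v \<in> reach c \<Longrightarrow>
      a1 v = (\<Sum>s\<in>out v. p v s * f (tr v s)) - E + (\<Sum>s\<in>out v. p v s * a1 (tr v s))"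
    using poisson_recurrent_class[OF c, of "\<lambda>v. \<Sum>s\<in>out v. p v s * f (tr v s)"] by blast
  define g where "g = (\<lambda>v. f v - E)"
  obtain E2 a2 where a2: "\<And>v. v \<in> reach c \<Longrightarrow>
      a2 v = (\<Sum>s\<in>out v. p v s * (- g (tr v s) * a1 (tr v s) - (g (tr v s))\<^sup>2 / 2)) - E2 + (\<Sum>s\<in>out v. p v s * a2 (tr v s))"
    using poisson_recurrent_class[OF c, of "\<lambda>v. \<Sum>s\<in>out v. p v s * (- g (tr v s) * a1 (tr v s) - (g (tr v s))\<^sup>2 / 2)"] by blast
  have "clt_data g (- 2 * E2) (reach c) a1 a2"
    unfolding clt_data_def
  proof (intro ballI conjI)
    fix v assume v: "v \<in> reach c"
    have "(\<Sum>s\<in>out v. p v s * (a1 (tr v s) + g (tr v s))) = 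
        (\<Sum>s\<in>out v. p v s * f (tr v s)) - E * (\<Sum>s\<in>out v. p v s) + (\<Sum>s\<in>out v. p v s * a1 (tr v s))"
      unfolding g_def sum_distrib_left sum.distrib[symmetric] sum_subtractf[symmetric]
      by (intro sum.cong refl) (simp add: algebra_simps)
    then show "a1 v = (\<Sum>s\<in>out v. p v s * (a1 (tr v s) + g (tr v s)))" using a1[OF v] ps[OF v] by simp
    have "(\<Sum>s\<in>out v. p v s * (a2 (tr v s) - g (tr v s) * a1 (tr v s) - (g (tr v s))\<^sup>2 / 2)) =
       (\<Sum>s\<in>out v. p v s * (- g (tr v s) * a1 (tr v s) - (g (tr v s))\<^sup>2 / 2)) + (\<Sum>s\<in>out v. p v s * a2 (tr v s))"
      unfolding sum.distrib[symmetric] by (intro sum.cong refl) (simp add: algebra_simps)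
    then show "a2 v = (\<Sum>s\<in>out v. p v s * (a2 (tr v s) - g (tr v s) * a1 (tr v s) - (g (tr v s))\<^sup>2 / 2)) + (- 2 * E2) / 2"
      using a2[OF v] by simp
  qed
  then show ?thesis unfolding g_def by (intro exI)
qed

text \<open>A single \<open>s2\<close> valid on all recurrent classes leaves Dirichlet problems on
  the transient states, with the recurrent states as boundary. The problem for \<open>a2\<close>
  comes second because its source contains \<open>a1\<close>.\<close>

lemma clt_data_extend:
  assumes "\<And>c. c \<in> recurrent \<Longrightarrow> \<exists>a1 a2. clt_data g s2 (reach c) a1 a2"
  shows "\<exists>a1 a2. clt_data g s2 V a1 a2"
proof -
  \<comment> \<open>The choice depends on the class as a set and not on a state in it; the reachable
    set is constant on a recurrent class, so the chosen solutions agree along transitions.\<close>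
  define sel where "sel D = (SOME a. clt_data g s2 D (fst a) (snd a))" for D
  have sel: "clt_data g s2 (reach c) (fst (sel (reach c))) (snd (sel (reach c)))" if c: "c \<in> recurrent" for c
  proof -
    obtain a1 a2 where "clt_data g s2 (reach c) a1 a2" using assms[OF c] by blast
    then have "clt_data g s2 (reach c) (fst (a1, a2)) (snd (a1, a2))" by simp
    then show ?thesis unfolding sel_def by (rule someI)
  qed
  define b1 where "b1 v = fst (sel (reach v)) v" for v
  define b2 where "b2 v = snd (sel (reach v)) v" for v
  have nb: "tr v s \<in> recurrent \<and> b1 (tr v s) = fst (sel (reach v)) (tr v s) \<and> b2 (tr v s) = snd (sel (reach v)) (tr v s)"
    if "v \<in> recurrent" "s \<in> out v" for v s
    using reach_recurrent[OF that(1) reach_step[OF that(2)]] unfolding b1_def b2_def by simp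
  have dir: "\<exists>u. (\<forall>v\<in>recurrent. u v = b v) \<and> (\<forall>v\<in>V - recurrent. u v = k v + (\<Sum>s\<in>out v. p v s * u (tr v s)))"
    for b k :: "'q \<Rightarrow> real"
    by (rule dirichlet) (auto simp: tr_closed reaches_recurrent)
  define k where "k v = (\<Sum>s\<in>out v. p v s * g (tr v s))" for v
  obtain a1 where "\<forall>v\<in>recurrent. a1 v = b1 v"
      "\<forall>v\<in>V - recurrent. a1 v = k v + (\<Sum>s\<in>out v. p v s * a1 (tr v s))"
    using dir[of b1 k] by (elim exE conjE)
  then have a1: "v \<in> recurrent \<Longrightarrow> a1 v = b1 v"
      "v \<in> V - recurrent \<Longrightarrow> a1 v = k v + (\<Sum>s\<in>out v. p v s * a1 (tr v s))" for v
    by simp_all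
  define h where "h v = (\<Sum>s\<in>out v. p v s * (- g (tr v s) * a1 (tr v s) - (g (tr v s))\<^sup>2 / 2)) + s2 / 2" for v
  obtain a2 where "\<forall>v\<in>recurrent. a2 v = b2 v"
      "\<forall>v\<in>V - recurrent. a2 v = h v + (\<Sum>s\<in>out v. p v s * a2 (tr v s))"
    using dir[of b2 h] by (elim exE conjE)
  then have a2: "v \<in> recurrent \<Longrightarrow> a2 v = b2 v"
      "v \<in> V - recurrent \<Longrightarrow> a2 v = h v + (\<Sum>s\<in>out v. p v s * a2 (tr v s))" for v
    by simp_all
  have "clt_data g s2 V a1 a2"
    unfolding clt_data_def
  proof (intro ballI conjI)
    fix v assume v: "v \<in> V"
    show "a1 v = (\<Sum>s\<in>out v. p v s * (a1 (tr v s) + g (tr v s)))"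
    proof (cases "v \<in> recurrent")
      case True
      have "a1 v = (\<Sum>s\<in>out v. p v s * (fst (sel (reach v)) (tr v s) + g (tr v s)))"
        using sel[OF True] a1(1)[OF True] unfolding clt_data_def b1_def by auto
      also have "\<dots> = (\<Sum>s\<in>out v. p v s * (a1 (tr v s) + g (tr v s)))"
        using nb[OF True] a1(1) by (intro sum.cong) auto
      finally show ?thesis .
    next
      case False
      then show ?thesis using a1(2)[of v] v unfolding k_def by (simp add: ring_distribs sum.distrib)
    qed
    show "a2 v = (\<Sum>s\<in>out v. p v s * (a2 (tr v s) - g (tr v s) * a1 (tr v s) - (g (tr v s))\<^sup>2 / 2)) + s2 / 2"
    proof (cases "v \<in> recurrent")
      case True
      have "a2 v = (\<Sum>s\<in>out v. p v s * (snd (sel (reach v)) (tr v s) - g (tr v s) * fst (sel (reach v)) (tr v s) - (g (tr v s))\<^sup>2 / 2)) + s2 / 2"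
        using sel[OF True] a2(1)[OF True] unfolding clt_data_def b2_def by auto
      also have "\<dots> = (\<Sum>s\<in>out v. p v s * (a2 (tr v s) - g (tr v s) * a1 (tr v s) - (g (tr v s))\<^sup>2 / 2)) + s2 / 2"
        using nb[OF True] a1(1) a2(1) by (intro arg_cong2[of _ _ _ _ "(+)"] sum.cong refl) auto
      finally show ?thesis .
    next
      case False
      have "h v + (\<Sum>s\<in>out v. p v s * a2 (tr v s)) =
          (\<Sum>s\<in>out v. p v s * (a2 (tr v s) - g (tr v s) * a1 (tr v s) - (g (tr v s))\<^sup>2 / 2)) + s2 / 2"
        unfolding h_def by (simp add: algebra_simps sum.distrib[symmetric] sum_subtractf[symmetric] sum_negf[symmetric])
      then show ?thesis using a2(2)[of v] v False by simp
    qed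
  qed
  then show ?thesis by blast
qed

end

section \<open>The Markov chain of a combing\<close>

locale combed_group = hyp_group G S \<kappa> for G :: "('a, 'b) monoid_scheme" (structure) and S \<kappa> +
  fixes L :: "'a list set" and \<Gamma> :: "'a labeled_digraph"
  assumes comb: "combing G S L" and param: "parameterizes S \<Gamma> L"
begin

abbreviation tr where "tr \<equiv> digraph_step \<Gamma>"
abbreviation v0 where "v0 \<equiv> initial \<Gamma>"

text \<open>The digraph may contain vertices that are not reached from the initial one; paths from
  those are not parts of words of \<open>L\<close> and their number is not controlled by the
  spheres.\<close>

definition accessible :: "nat set" where
  "accessible = {foldl tr v0 w | w. automaton.acc (digraph_out \<Gamma>) tr v0 w}"

sublocale full: finite_automaton "digraph_out \<Gamma>" tr accessible
proof
  interpret automaton "digraph_out \<Gamma>" tr .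
  note pa = parameterizes_automaton[OF param]
  have sub: "accessible \<subseteq> vertices \<Gamma>"
    unfolding accessible_def using run_closed[OF conjunct1[OF pa(1)] pa(3)] by blast
  then show "finite accessible" using pa(2) finite_subset by blast
  show "finite (digraph_out \<Gamma> v)" if "v \<in> accessible" for v
    using pa(1) that sub fin_S by (meson finite_subset subsetD subsetI)
  show "tr v s \<in> accessible" if v: "v \<in> accessible" and s: "s \<in> digraph_out \<Gamma> v" for v s
  proof -
    obtain w where "acc v0 w" "v = run v0 w" using v unfolding accessible_def by blast
    then have "acc v0 (w @ [s])" "tr v s = run v0 (w @ [s])" using s by auto
    then show ?thesis unfolding accessible_def by blast
  qed
qed

lemma v0_accessible: "v0 \<in> accessible"
  unfolding accessible_def by (auto intro!: exI[of _ "[]"])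

lemma L_eq: "L = {w. full.acc v0 w}"
  using parameterizes_automaton(4)[OF param] .

lemma acc_L: "full.acc v0 w \<Longrightarrow> w \<in> lists S \<and> length w = len (ev w)"
proof -
  assume "full.acc v0 w"
  then have "w \<in> L" unfolding L_eq by simp
  then show ?thesis using comb unfolding combing_def by (meson subsetD)
qed

lemma ev_bij: "bij_betw ev {w. full.acc v0 w} (carrier G)"
  using comb unfolding combing_def L_eq[symmetric] by (elim conjE)

lemma ev_inj: "full.acc v0 u \<Longrightarrow> full.acc v0 w \<Longrightarrow> ev u = ev w \<Longrightarrow> u = w"
  by (rule inj_onD[OF bij_betw_imp_inj_on[OF ev_bij]]) simp_all

lemma carrier_word:
  assumes "g \<in> carrier G"
  obtains w where "full.acc v0 w" "ev w = g" "w \<in> full.words v0 (len g)"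
proof -
  have "g \<in> ev ` {w. full.acc v0 w}" using bij_betw_imp_surj_on[OF ev_bij] assms by simp
  then obtain w where w: "full.acc v0 w" "ev w = g" by blast
  moreover have "length w = len g" using acc_L[OF w(1)] w(2) by simp
  ultimately show ?thesis using that unfolding full.words_def by blast
qed

lemma sphere_words: "bij_betw ev (full.words v0 n) (word_sphere G S n)"
  unfolding bij_betw_def
proof
  show "inj_on ev (full.words v0 n)" using ev_inj unfolding full.words_def by (auto intro: inj_onI)
  show "ev ` full.words v0 n = word_sphere G S n"
  proof
    show "ev ` full.words v0 n \<subseteq> word_sphere G S n"
      using acc_L unfolding full.words_def word_sphere_def by force
    show "word_sphere G S n \<subseteq> ev ` full.words v0 n"
      unfolding word_sphere_def using carrier_word by blast
  qed
qed

lemma card_words_v0: "card (full.words v0 n) = card (word_sphere G S n)"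
  using sphere_words by (rule bij_betw_same_card)

lemma growth_base_unique:
  assumes l: "1 < l" "1 \<le> K" "\<And>n. 1 \<le> n \<Longrightarrow> inverse K * l ^ n \<le> a n" "\<And>n. 1 \<le> n \<Longrightarrow> a n \<le> K * l ^ n"
    and m: "1 < m" "1 \<le> K'" "\<And>n. 1 \<le> n \<Longrightarrow> inverse K' * m ^ n \<le> a n" "\<And>n. 1 \<le> n \<Longrightarrow> a n \<le> K' * m ^ n"
  shows "m \<le> (l :: real)"
proof (rule ccontr)
  assume "\<not> m \<le> l"
  then have q: "1 < m / l" using l(1) by simp
  obtain n where n: "K * K' < (m / l) ^ n" using real_arch_pow[OF q] by blast
  have "n \<noteq> 0"
  proof
    assume "n = 0"
    then have "K * K' < 1" using n by simp
    moreover have "1 * 1 \<le> K * K'" using l(2) m(2) by (intro mult_mono) auto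
    ultimately show False by linarith
  qed
  then have "inverse K' * m ^ n \<le> K * l ^ n" using l(4)[of n] m(3)[of n] by linarith
  then have "m ^ n \<le> K * K' * l ^ n" using m(2) by (simp add: field_simps)
  then have "(m / l) ^ n \<le> K * K'" using l(1) by (simp add: power_divide divide_le_eq)
  then show False using n by linarith
qed

definition lam :: real where "lam = growth_base G S"

lemma growth: "1 < lam" "lam ^ n \<le> real (card (word_sphere G S n))"
  "\<exists>K\<ge>1. \<forall>n. real (card (word_sphere G S n)) \<le> K * lam ^ n"
proof -
  let ?a = "\<lambda>n. real (card (word_sphere G S n))"
  let ?P = "\<lambda>l. l > 1 \<and> (\<exists>K\<ge>1. \<forall>n\<ge>1. inverse K * l ^ n \<le> ?a n \<and> ?a n \<le> K * l ^ n)"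
  obtain l K where l: "1 < l" "1 \<le> K" "\<And>n. l ^ n \<le> ?a n" "\<And>n. ?a n \<le> K * l ^ n"
    using pure_exponential_growth by blast
  have "inverse K * l ^ n \<le> ?a n" for n
  proof -
    have "inverse K * l ^ n \<le> 1 * l ^ n" using l(1,2) by (intro mult_right_mono) (auto simp: inverse_le_1_iff)
    then show ?thesis using l(3)[of n] by simp
  qed
  then have Pl: "?P l" using l by blast
  have "lam = l"
    unfolding lam_def growth_base_def
  proof (rule the_equality[of ?P, OF Pl])
    fix m assume "?P m"
    then obtain K' where K': "1 < m" "1 \<le> K'" "\<And>n. 1 \<le> n \<Longrightarrow> inverse K' * m ^ n \<le> ?a n" "\<And>n. 1 \<le> n \<Longrightarrow> ?a n \<le> K' * m ^ n"
      by blast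
    obtain K where K: "1 < l" "1 \<le> K" "\<And>n. 1 \<le> n \<Longrightarrow> inverse K * l ^ n \<le> ?a n" "\<And>n. 1 \<le> n \<Longrightarrow> ?a n \<le> K * l ^ n"
      using Pl by blast
    show "m = l"
      using growth_base_unique[OF K K'] growth_base_unique[OF K' K] by (rule antisym)
  qed
  then show "1 < lam" "lam ^ n \<le> ?a n" "\<exists>K\<ge>1. \<forall>n. ?a n \<le> K * lam ^ n" using l by auto
qed

section \<open>Path densities and the eigenvector of the adjacency matrix\<close>

definition dens :: "nat \<Rightarrow> nat \<Rightarrow> real" where
  "dens k v = card (full.words v k) / lam ^ k"

text \<open>Averages over \<open>k\<close> are taken because \<open>dens k v\<close> itself can
  oscillate when the digraph has periodic classes; they match the factor \<open>1 / m\<close> in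
  \<open>nu_hat_approx\<close>.\<close>

definition rho :: "nat \<Rightarrow> real" where
  "rho v = lim (\<lambda>m. (\<Sum>k<m. dens k v) / real m)"

lemma lam_pos: "0 < lam" using growth(1) by simp

text \<open>Prefixing a fixed word that leads to \<open>v\<close> embeds the paths of length
  \<open>k\<close> from \<open>v\<close> into a sphere whose radius is larger by a constant.\<close>

lemma dens_bounded: "\<exists>K. \<forall>v\<in>accessible. \<forall>k. dens k v \<le> K"
proof -
  obtain K where K: "1 \<le> K" "\<And>n. real (card (word_sphere G S n)) \<le> K * lam ^ n" using growth(3) by blast
  have "\<exists>C. \<forall>k. dens k v \<le> C" if v: "v \<in> accessible" for v
  proof -
    obtain u where u: "full.acc v0 u" "v = full.run v0 u" using v unfolding accessible_def by blast
    have "dens k v \<le> K * lam ^ length u" for k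
    proof -
      have "card (full.words v k) \<le> card (full.words v0 (length u + k))"
      proof (rule card_inj_on_le[of "\<lambda>w. u @ w"])
        show "(\<lambda>w. u @ w) ` full.words v k \<subseteq> full.words v0 (length u + k)"
          using u by (auto simp: full.words_def)
      qed (auto simp: inj_on_def v0_accessible)
      then have "real (card (full.words v k)) \<le> K * lam ^ (length u + k)"
        using K(2)[of "length u + k"] unfolding card_words_v0 by linarith
      then show ?thesis unfolding dens_def using lam_pos by (simp add: divide_le_eq power_add mult_ac)
    qed
    then show ?thesis by blast
  qed
  then obtain C where C: "\<And>v k. v \<in> accessible \<Longrightarrow> dens k v \<le> C v" by metis
  show ?thesis
  proof (intro exI ballI allI)
    fix v k assume v: "v \<in> accessible"
    have "dens k v \<le> \<bar>C v\<bar>" using C[OF v, of k] by linarith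
    also have "\<dots> \<le> (\<Sum>v\<in>accessible. \<bar>C v\<bar>)" using v full.finite_V by (intro member_le_sum) auto
    finally show "dens k v \<le> (\<Sum>v\<in>accessible. \<bar>C v\<bar>)" .
  qed
qed

lemma sum_out_by_target:
  fixes f :: "nat \<Rightarrow> real"
  assumes "v \<in> accessible"
  shows "(\<Sum>u\<in>accessible. real (card {s \<in> digraph_out \<Gamma> v. tr v s = u}) * f u) = (\<Sum>s\<in>digraph_out \<Gamma> v. f (tr v s))"
proof -
  have "(\<Sum>s\<in>digraph_out \<Gamma> v. f (tr v s)) = (\<Sum>u\<in>accessible. \<Sum>s\<in>{s \<in> digraph_out \<Gamma> v. tr v s = u}. f (tr v s))"
    using assms full.finite_V full.finite_out full.tr_closed by (intro sum.group[symmetric]) auto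
  also have "\<dots> = (\<Sum>u\<in>accessible. real (card {s \<in> digraph_out \<Gamma> v. tr v s = u}) * f u)"
    by (intro sum.cong) auto
  finally show ?thesis by simp
qed

lemma dens_Suc: "v \<in> accessible \<Longrightarrow> dens (Suc k) v = (\<Sum>s\<in>digraph_out \<Gamma> v. dens k (tr v s)) / lam"
  unfolding dens_def full.card_words_Suc by (simp add: sum_divide_distrib mult.commute)

lemma rho_limit:
  assumes v: "v \<in> accessible"
  shows "(\<lambda>m. (\<Sum>k<m. dens k v) / real m) \<longlonglongrightarrow> rho v"
    and "(\<Sum>s\<in>digraph_out \<Gamma> v. rho (tr v s)) = lam * rho v"
proof -
  let ?A = "\<lambda>v u. real (card {s \<in> digraph_out \<Gamma> v. tr v s = u}) / lam"
  obtain K where K: "\<And>k v. v \<in> accessible \<Longrightarrow> dens k v \<le> K" using dens_bounded by blast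
  have A: "(\<Sum>u\<in>accessible. ?A v u * f u) = (\<Sum>s\<in>digraph_out \<Gamma> v. f (tr v s)) / lam" if "v \<in> accessible" for v and f :: "nat \<Rightarrow> real"
    using sum_out_by_target[OF that, of f] by (simp add: sum_divide_distrib[symmetric])
  have "\<exists>r. \<forall>v\<in>accessible. (\<lambda>m. (\<Sum>k<m. dens k v) / real m) \<longlonglongrightarrow> r v \<and> (\<Sum>u\<in>accessible. ?A v u * r u) = r v"
    by (rule cesaro_nonneg_iteration[OF full.finite_V, where K = K])
      (use lam_pos K A dens_Suc in \<open>auto simp: dens_def[of 0]\<close>)
  then obtain r where r: "\<And>v. v \<in> accessible \<Longrightarrow> (\<lambda>m. (\<Sum>k<m. dens k v) / real m) \<longlonglongrightarrow> r v"
    "\<And>v. v \<in> accessible \<Longrightarrow> (\<Sum>u\<in>accessible. ?A v u * r u) = r v" by blast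
  have req: "rho v = r v" if "v \<in> accessible" for v
    unfolding rho_def using r(1)[OF that] by (rule limI)
  show "(\<lambda>m. (\<Sum>k<m. dens k v) / real m) \<longlonglongrightarrow> rho v" using r(1)[OF v] req[OF v] by simp
  have "(\<Sum>s\<in>digraph_out \<Gamma> v. rho (tr v s)) = (\<Sum>s\<in>digraph_out \<Gamma> v. r (tr v s))"
    using req full.tr_closed[OF v] by (intro sum.cong) auto
  also have "\<dots> = lam * rho v" using r(2)[OF v] A[OF v, of r] req[OF v] lam_pos by (simp add: field_simps)
  finally show "(\<Sum>s\<in>digraph_out \<Gamma> v. rho (tr v s)) = lam * rho v" .
qed

lemma rho_nonneg: "v \<in> accessible \<Longrightarrow> 0 \<le> rho v"
  using lam_pos by (intro LIMSEQ_le_const[OF rho_limit(1)])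
    (auto simp: dens_def intro!: exI[of _ 0] divide_nonneg_nonneg sum_nonneg)

lemma rho_v0: "1 \<le> rho v0"
proof (rule LIMSEQ_le_const[OF rho_limit(1)[OF v0_accessible]], intro exI allI impI)
  fix n :: nat assume n: "1 \<le> n"
  have "1 \<le> dens k v0" for k
    unfolding dens_def card_words_v0 using growth(2)[of k] lam_pos by simp
  then have "(\<Sum>k<n. 1) \<le> (\<Sum>k<n. dens k v0)" by (intro sum_mono)
  then show "1 \<le> (\<Sum>k<n. dens k v0) / real n" using n by (simp add: le_divide_eq)
qed

text \<open>Unique representation in \<open>L\<close> turns the cone of \<open>ev w\<close> into the
  paths that start where \<open>w\<close> ends. Sorted by their length \<open>k\<close>, each of
  them contributes the weight \<open>lam ^ (- (n + k))\<close>.\<close>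

lemma nu_hat_approx_cone:
  assumes w: "w \<in> full.words v0 n" and m: "n \<le> m"
  shows "nu_hat_approx G S m (combing_cone G L (ev w)) = (\<Sum>k\<le>m - n. dens k (full.run v0 w)) / (lam ^ n * real m)"
proof -
  let ?v = "full.run v0 w"
  have aw: "full.acc v0 w" "length w = n" using w by (auto simp: full.words_def)
  have v: "?v \<in> accessible" using aw unfolding accessible_def by blast
  let ?B = "{g \<in> carrier G. len g \<le> m}"
  let ?W = "\<Union>k\<le>m - n. full.words ?v k"
  have inj: "inj_on (\<lambda>x. ev (w @ x)) ?W"
  proof (rule inj_onI)
    fix x y assume xy: "x \<in> ?W" "y \<in> ?W" and eq: "ev (w @ x) = ev (w @ y)"
    have "full.acc v0 (w @ x)" "full.acc v0 (w @ y)" using xy aw by (auto simp: full.words_def)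
    then have "w @ x = w @ y" using ev_inj eq by blast
    then show "x = y" by simp
  qed
  have img: "combing_cone G L (ev w) \<inter> ?B = (\<lambda>x. ev (w @ x)) ` ?W"
  proof (intro equalityI subsetI)
    fix g assume g: "g \<in> combing_cone G L (ev w) \<inter> ?B"
    then obtain u u' where u: "full.acc v0 u" "full.acc v0 u'" "ev u = ev w" "ev u' = g" "prefix u u'"
      unfolding combing_cone_def L_eq by blast
    then have "u = w" using ev_inj aw by blast
    then obtain x where x: "u' = w @ x" using u(5) by (auto simp: prefix_def)
    have "length u' \<le> m" using acc_L[OF u(2)] u(4) g by simp
    then have "x \<in> full.words ?v (length x)" "length x \<le> m - n" using u(2) aw unfolding x full.words_def by auto
    then show "g \<in> (\<lambda>x. ev (w @ x)) ` ?W" using u(4) x by blast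
  next
    fix g assume "g \<in> (\<lambda>x. ev (w @ x)) ` ?W"
    then obtain x k where x: "k \<le> m - n" "x \<in> full.words ?v k" "g = ev (w @ x)" by blast
    then have ax: "full.acc v0 (w @ x)" "length (w @ x) \<le> m" using aw m by (auto simp: full.words_def)
    have "len g \<le> m" "g \<in> carrier G" using acc_L[OF ax(1)] ax(2) x(3) by auto
    moreover have "prefix w (w @ x)" by simp
    ultimately show "g \<in> combing_cone G L (ev w) \<inter> ?B"
      unfolding combing_cone_def L_eq using aw ax(1) x(3) by blast
  qed
  have "(\<Sum>g | g \<in> carrier G \<and> len g \<le> m. inverse (lam ^ len g) * indicator (combing_cone G L (ev w)) g) =
      (\<Sum>g\<in>combing_cone G L (ev w) \<inter> ?B. inverse (lam ^ len g))"
    using finite_ball by (intro sum.mono_neutral_cong_right) (auto simp: indicator_def)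
  also have "\<dots> = (\<Sum>x\<in>?W. inverse (lam ^ len (ev (w @ x))))"
    unfolding img by (simp add: sum.reindex[OF inj])
  also have "\<dots> = (\<Sum>k\<le>m - n. \<Sum>x\<in>full.words ?v k. inverse (lam ^ len (ev (w @ x))))"
  proof (rule sum.UNION_disjoint)
    show "\<forall>i\<in>{..m - n}. \<forall>j\<in>{..m - n}. i \<noteq> j \<longrightarrow> full.words ?v i \<inter> full.words ?v j = {}"
      unfolding full.words_def by blast
  qed (use v in auto)
  also have "\<dots> = (\<Sum>k\<le>m - n. dens k ?v / lam ^ n)"
  proof (intro sum.cong refl)
    fix k
    have "len (ev (w @ x)) = n + k" if "x \<in> full.words ?v k" for x
      using that acc_L[of "w @ x"] aw by (simp add: full.words_def)
    then have "(\<Sum>x\<in>full.words ?v k. inverse (lam ^ len (ev (w @ x)))) = (\<Sum>x\<in>full.words ?v k. inverse (lam ^ (n + k)))"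
      by (intro sum.cong) auto
    also have "\<dots> = dens k ?v / lam ^ n" unfolding dens_def by (simp add: power_add divide_inverse)
    finally show "(\<Sum>x\<in>full.words ?v k. inverse (lam ^ len (ev (w @ x)))) = dens k ?v / lam ^ n" .
  qed
  finally show ?thesis unfolding nu_hat_approx_def lam_def[symmetric]
    by (simp add: sum_divide_distrib[symmetric] mult.commute)
qed

lemma nu_hat_eq:
  assumes w: "w \<in> full.words v0 n"
  shows "nu_hat G S L (ev w) = rho (full.run v0 w) / lam ^ n"
  unfolding nu_hat_def
proof (rule limI, rule LIMSEQ_offset[of _ n])
  let ?v = "full.run v0 w"
  have v: "?v \<in> accessible" using w unfolding accessible_def full.words_def by blast
  have "(\<lambda>m. (\<Sum>k<Suc m. dens k ?v) / real (Suc m)) \<longlonglongrightarrow> rho ?v"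
    using rho_limit(1)[OF v] by (rule LIMSEQ_Suc)
  \<comment> \<open>The \<open>m + 1\<close> densities of lengths 0 to \<open>m\<close> are divided
    by \<open>m + n\<close> in the approximating measure; the two normalizations agree in the
    limit.\<close>
  moreover have "(\<lambda>m. real (Suc m) / real (m + n)) \<longlonglongrightarrow> 1" by real_asymp
  ultimately have "(\<lambda>m. (\<Sum>k<Suc m. dens k ?v) / real (Suc m) * (real (Suc m) / real (m + n)) / lam ^ n) \<longlonglongrightarrow> rho ?v * 1 / lam ^ n"
    by (intro tendsto_intros) (use lam_pos in auto)
  moreover have "(\<Sum>k<Suc m. dens k ?v) / real (Suc m) * (real (Suc m) / real (m + n)) / lam ^ n =
      nu_hat_approx G S (m + n) (combing_cone G L (ev w))" for m
    using nu_hat_approx_cone[OF w, of "m + n"] by (simp add: lessThan_Suc_atMost mult.commute del: sum.lessThan_Suc)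
  ultimately show "(\<lambda>m. nu_hat_approx G S (m + n) (combing_cone G L (ev w))) \<longlonglongrightarrow> rho ?v / lam ^ n" by simp
qed

section \<open>The Markov chain obtained by the Doob transform with \<open>rho\<close>\<close>

definition pos_states :: "nat set" where
  "pos_states = {v \<in> accessible. 0 < rho v}"

definition pos_out :: "nat \<Rightarrow> 'a set" where
  "pos_out v = {s \<in> digraph_out \<Gamma> v. 0 < rho (tr v s)}"

text \<open>Doob transform of edge counting by the eigenvector \<open>rho\<close>. Edges into zeros
  of \<open>rho\<close> have been removed by \<open>pos_out\<close>, so that all remaining
  probabilities are positive.\<close>

definition trans_prob :: "nat \<Rightarrow> 'a \<Rightarrow> real" where
  "trans_prob v s = rho (tr v s) / (lam * rho v)"

sublocale pos: chain pos_out tr pos_states trans_prob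
proof
  show "finite pos_states" using full.finite_V unfolding pos_states_def by simp
  show "finite (pos_out v)" if "v \<in> pos_states" for v using that full.finite_out unfolding pos_states_def pos_out_def by simp
  show "tr v s \<in> pos_states" if "v \<in> pos_states" "s \<in> pos_out v" for v s
    using that full.tr_closed unfolding pos_states_def pos_out_def by blast
  show "0 < trans_prob v s" if "v \<in> pos_states" "s \<in> pos_out v" for v s
    using that lam_pos unfolding pos_states_def pos_out_def trans_prob_def by simp
  show "(\<Sum>s\<in>pos_out v. trans_prob v s) = 1" if v: "v \<in> pos_states" for v
  proof -
    have va: "v \<in> accessible" "0 < rho v" using v by (auto simp: pos_states_def)
    have "(\<Sum>s\<in>pos_out v. rho (tr v s)) = (\<Sum>s\<in>digraph_out \<Gamma> v. rho (tr v s))"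
      using full.finite_out[OF va(1)] rho_nonneg[OF full.tr_closed[OF va(1)]]
      by (intro sum.mono_neutral_left) (auto simp: pos_out_def order.antisym not_less)
    then show ?thesis unfolding trans_prob_def
      using rho_limit(2)[OF va(1)] va(2) lam_pos by (simp add: sum_divide_distrib[symmetric])
  qed
qed

lemma v0_pos: "v0 \<in> pos_states"
  using rho_v0 v0_accessible unfolding pos_states_def by simp

lemma pos_acc_imp: "pos.acc v w \<Longrightarrow> full.acc v w"
  by (induction w arbitrary: v) (auto simp: pos_out_def)

text \<open>The factors telescope. As a consequence, words of length \<open>n\<close> from the same
  vertex are equally likely up to bounded factors, so that counting words and measuring them are
  interchangeable.\<close>

lemma pr_eq:
  assumes "v \<in> pos_states" "pos.acc v w"
  shows "pos.pr v w = rho (full.run v w) / (lam ^ length w * rho v)"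
  using assms
proof (induction w arbitrary: v)
  case Nil
  then show ?case by (simp add: pos_states_def)
next
  case (Cons s w)
  then have "tr v s \<in> pos_states" using pos.tr_closed by simp
  moreover from this have "0 < rho v" "0 < rho (tr v s)" using Cons.prems unfolding pos_states_def by auto
  moreover have "pos.pr v (s # w) = rho (tr v s) / (lam * rho v) * pos.pr (tr v s) w" by (simp add: trans_prob_def[symmetric])
  ultimately show ?case using Cons lam_pos by (simp add: field_simps)
qed

text \<open>By the eigenvector equation with nonnegative terms, a zero of \<open>rho\<close>
  propagates along all outgoing edges. A path that ends where \<open>rho\<close> is positive has
  therefore never met a zero.\<close>

lemma pos_acc_iff:
  assumes "v \<in> accessible" "full.acc v w"
  shows "pos.acc v w \<or> rho (full.run v w) = 0"
  using assms
proof (induction w arbitrary: v)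
  case (Cons s w)
  have t: "tr v s \<in> accessible" using Cons.prems full.tr_closed by simp
  have zero: "rho (full.run u x) = 0" if "u \<in> accessible" "full.acc u x" "rho u = 0" for u x
    using that
  proof (induction x arbitrary: u)
    case (Cons s x)
    have "(\<Sum>s\<in>digraph_out \<Gamma> u. rho (tr u s)) = 0" using rho_limit(2)[OF Cons.prems(1)] Cons.prems(3) by simp
    then have "rho (tr u s) = 0"
      using full.finite_out[OF Cons.prems(1)] rho_nonneg[OF full.tr_closed[OF Cons.prems(1)]] Cons.prems(2)
      by (subst (asm) sum_nonneg_eq_0_iff) auto
    then show ?case using Cons full.tr_closed by simp
  qed simp
  show ?case
  proof (cases "0 < rho (tr v s)")
    case True
    then have "s \<in> pos_out v" using Cons.prems unfolding pos_out_def by simp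
    then show ?thesis using Cons t by simp
  next
    case False
    then have "rho (tr v s) = 0" using rho_nonneg[OF t] by simp
    then show ?thesis using zero[OF t] Cons.prems by simp
  qed
qed simp

text \<open>Integration against \<open>nu_hat\<close> over a sphere is expectation along the chain,
  up to the factor \<open>rho v0\<close> for every \<open>n\<close>. With constant \<open>F\<close>
  it gives the normalization, with exponentials the characteristic function.\<close>

lemma sum_nu_hat_sphere:
  fixes F :: "'a \<Rightarrow> complex"
  shows "(\<Sum>g\<in>word_sphere G S n. of_real (nu_hat G S L g) * F g) = of_real (rho v0) * (\<Sum>w\<in>pos.words v0 n. of_real (pos.pr v0 w) * F (ev w))"
proof -
  have "(\<Sum>g\<in>word_sphere G S n. of_real (nu_hat G S L g) * F g) = (\<Sum>w\<in>full.words v0 n. of_real (nu_hat G S L (ev w)) * F (ev w))"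
    by (rule sum.reindex_bij_betw[OF sphere_words, symmetric])
  also have "\<dots> = (\<Sum>w\<in>full.words v0 n. of_real (rho (full.run v0 w) / lam ^ n) * F (ev w))"
    using nu_hat_eq by (intro sum.cong) auto
  also have "\<dots> = (\<Sum>w\<in>pos.words v0 n. of_real (rho (full.run v0 w) / lam ^ n) * F (ev w))"
    using pos_acc_iff[OF v0_accessible] pos_acc_imp full.finite_words[OF v0_accessible, of n]
    by (intro sum.mono_neutral_right) (auto simp: full.words_def pos.words_def)
  also have "\<dots> = (\<Sum>w\<in>pos.words v0 n. of_real (rho v0 * pos.pr v0 w) * F (ev w))"
    using pr_eq[OF v0_pos] rho_v0 by (intro sum.cong) (auto simp: pos.words_def)
  also have "\<dots> = of_real (rho v0) * (\<Sum>w\<in>pos.words v0 n. of_real (pos.pr v0 w) * F (ev w))"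
    by (simp add: sum_distrib_left mult.assoc)
  finally show ?thesis .
qed

end

section \<open>Distributions\<close>

lemma finite_distribution:
  fixes p X' :: "'b \<Rightarrow> real"
  assumes A: "finite A" "\<And>w. w \<in> A \<Longrightarrow> 0 \<le> p w" "(\<Sum>w\<in>A. p w) = 1"
  defines "M \<equiv> distr (point_measure A (\<lambda>w. ennreal (p w))) borel X'"
  shows "real_distribution M"
    and "char M t = (\<Sum>w\<in>A. of_real (p w) * iexp (t * X' w))"
    and "cdf M x = (\<Sum>w | w \<in> A \<and> X' w \<le> x. p w)"
proof -
  let ?P = "point_measure A (\<lambda>w. ennreal (p w))"
  interpret prob_space ?P
    using A by (intro prob_space_point_measure) (auto simp: sum_ennreal)
  have meas: "X' \<in> borel_measurable ?P" by simp
  show "real_distribution M" unfolding M_def using meas by (rule real_distribution_distr)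
  have "char M t = (CLINT x|?P. iexp (t * X' x))"
    unfolding M_def char_def by (subst integral_distr) simp_all
  also have "\<dots> = (\<Sum>w\<in>A. of_real (p w) * iexp (t * X' w))"
    using A by (subst lebesgue_integral_point_measure_finite) (auto simp: scaleR_conv_of_real)
  finally show "char M t = (\<Sum>w\<in>A. of_real (p w) * iexp (t * X' w))" .
  have "emeasure M {..x} = emeasure ?P {w \<in> A. X' w \<le> x}"
    unfolding M_def by (subst emeasure_distr) (auto simp: space_point_measure intro!: arg_cong[of _ _ "emeasure _"])
  also have "\<dots> = ennreal (\<Sum>w | w \<in> A \<and> X' w \<le> x. p w)"
    using A by (subst emeasure_point_measure_finite) (auto intro!: sum_ennreal)
  finally show "cdf M x = (\<Sum>w | w \<in> A \<and> X' w \<le> x. p w)"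
    unfolding cdf_def measure_def using A(2) by (simp, intro enn2real_ennreal sum_nonneg) auto
qed

lemma real_distribution_normal: "0 \<le> \<sigma> \<Longrightarrow> real_distribution (normal_distribution 0 \<sigma>)"
proof (cases "\<sigma> = 0")
  case True
  interpret prob_space "return borel (0 :: real)" by (rule prob_space_return) simp
  show ?thesis unfolding normal_distribution_def using True by (simp add: real_distribution_def real_distribution_axioms_def prob_space_axioms)
next
  case False
  assume "0 \<le> \<sigma>"
  then interpret prob_space "density lborel (\<lambda>x. ennreal (normal_density 0 \<sigma> x))"
    using False by (intro prob_space_normal_density) simp
  show ?thesis unfolding normal_distribution_def using False by (simp add: real_distribution_def real_distribution_axioms_def prob_space_axioms)
qed

lemma char_normal_distribution:
  assumes "0 \<le> \<sigma>"
  shows "char (normal_distribution 0 \<sigma>) t = of_real (exp (- \<sigma>\<^sup>2 * t\<^sup>2 / 2))"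
proof (cases "\<sigma> = 0")
  case True
  have "char (return borel 0) t = 1" unfolding char_def by (subst integral_return) simp_all
  then show ?thesis using True by (simp add: normal_distribution_def)
next
  case False
  then have \<sigma>: "0 < \<sigma>" using assms by simp
  let ?N = "density lborel (\<lambda>x. ennreal (normal_density 0 \<sigma> x))"
  interpret prob_space ?N using \<sigma> by (rule prob_space_normal_density)
  have "distributed ?N lborel (\<lambda>x. x) (\<lambda>x. ennreal (normal_density 0 \<sigma> x))"
    unfolding distributed_def by (auto intro!: distr_id2)
  then have "distributed ?N lborel (\<lambda>x. (x - 0) / \<sigma>) std_normal_density"
    using normal_standard_normal_convert[OF \<sigma>, of "\<lambda>x. x" 0] by simp
  then have d: "distr ?N lborel (\<lambda>x. x / \<sigma>) = density lborel std_normal_density"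
    using distributed_distr_eq_density by fastforce
  have "char ?N t = (CLINT x|?N. iexp ((\<sigma> * t) * (x / \<sigma>)))"
    unfolding char_def using \<sigma> by simp
  also have "\<dots> = (CLINT x|distr ?N lborel (\<lambda>x. x / \<sigma>). iexp ((\<sigma> * t) * x))"
    by (subst integral_distr) simp_all
  also have "\<dots> = char std_normal_distribution (\<sigma> * t)"
    unfolding d char_def ..
  also have "\<dots> = of_real (exp (- \<sigma>\<^sup>2 * t\<^sup>2 / 2))"
    unfolding char_std_normal_distribution by (simp add: power_mult_distrib)
  finally show ?thesis using False by (simp add: normal_distribution_def)
qed

lemma isCont_cdf_normal:
  assumes "0 \<le> \<sigma>" "\<sigma> \<noteq> 0 \<or> x \<noteq> 0"
  shows "isCont (cdf (normal_distribution 0 \<sigma>)) x"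
proof -
  interpret real_distribution "normal_distribution 0 \<sigma>" using assms(1) by (rule real_distribution_normal)
  have "measure (normal_distribution 0 \<sigma>) {x} = 0"
  proof (cases "\<sigma> = 0")
    case True
    then show ?thesis using assms(2) by (simp add: normal_distribution_def measure_return)
  next
    case False
    have "emeasure (density lborel (\<lambda>x. ennreal (normal_density 0 \<sigma> x))) {x} = 0"
    proof (subst emeasure_density)
      have "AE y in lborel. ennreal (normal_density 0 \<sigma> y) * indicator {x} y = 0"
        using AE_lborel_singleton[of x] by eventually_elim simp
      then show "(\<integral>\<^sup>+y. ennreal (normal_density 0 \<sigma> y) * indicator {x} y \<partial>lborel) = 0"
        by (subst nn_integral_0_iff_AE) auto
    qed auto
    then show ?thesis using False by (simp add: normal_distribution_def measure_def)
  qed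
  then show ?thesis by (simp add: isCont_cdf)
qed

lemma normal_interval_bounds:
  assumes \<sigma>: "0 < \<sigma>" and ab: "a \<le> b" and m: "\<And>x. x \<in> {a<..b} \<Longrightarrow> l \<le> normal_density 0 \<sigma> x \<and> normal_density 0 \<sigma> x \<le> u"
    and "0 \<le> l"
  shows "l * (b - a) \<le> measure (normal_distribution 0 \<sigma>) {a<..b}" "measure (normal_distribution 0 \<sigma>) {a<..b} \<le> u * (b - a)"
proof -
  let ?N = "density lborel (\<lambda>x. ennreal (normal_density 0 \<sigma> x))"
  have N: "normal_distribution 0 \<sigma> = ?N" using \<sigma> by (simp add: normal_distribution_def)
  interpret prob_space ?N using \<sigma> by (rule prob_space_normal_density)
  have e: "ennreal (measure ?N {a<..b}) = (\<integral>\<^sup>+x. ennreal (normal_density 0 \<sigma> x) * indicator {a<..b} x \<partial>lborel)"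
    unfolding emeasure_eq_measure[symmetric] by (subst emeasure_density) auto
  have c: "(\<integral>\<^sup>+x. ennreal z * indicator {a<..b} x \<partial>lborel) = ennreal (z * (b - a))" if "0 \<le> z" for z
    using that ab by (subst nn_integral_cmult_indicator) (auto simp: ennreal_mult)
  have "ennreal (l * (b - a)) \<le> ennreal (measure ?N {a<..b})"
    unfolding e c[OF \<open>0 \<le> l\<close>, symmetric]
    by (intro nn_integral_mono) (use m in \<open>auto simp: indicator_def intro: ennreal_leI\<close>)
  then show "l * (b - a) \<le> measure (normal_distribution 0 \<sigma>) {a<..b}"
    unfolding N by (simp add: ennreal_le_iff)
  show "measure (normal_distribution 0 \<sigma>) {a<..b} \<le> u * (b - a)"
  proof (cases "a = b")
    case False
    then have "b \<in> {a<..b}" using ab by simp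
    then have "0 \<le> u" using m[of b] normal_density_nonneg[of 0 \<sigma> b] by linarith
    have "ennreal (measure ?N {a<..b}) \<le> ennreal (u * (b - a))"
      unfolding e c[OF \<open>0 \<le> u\<close>, symmetric]
      by (intro nn_integral_mono) (use m in \<open>auto simp: indicator_def intro: ennreal_leI\<close>)
    then show ?thesis unfolding N using \<open>0 \<le> u\<close> ab by (simp add: ennreal_le_iff)
  qed simp
qed

lemma normal_density_antimono:
  assumes "0 < \<sigma>" "\<bar>x\<bar> \<le> \<bar>y\<bar>"
  shows "normal_density 0 \<sigma> y \<le> normal_density 0 \<sigma> x"
proof -
  have "x\<^sup>2 \<le> y\<^sup>2" using assms(2) by (simp add: abs_le_square_iff)
  then have "exp (- y\<^sup>2 / (2 * \<sigma>\<^sup>2)) \<le> exp (- x\<^sup>2 / (2 * \<sigma>\<^sup>2))" using assms(1) by (simp add: divide_right_mono)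
  then show ?thesis unfolding normal_density_def by (simp add: divide_right_mono)
qed

text \<open>The second interval is the reflection of the first, enlarged by 1 on both sides. If
  \<sigma> were larger, the ratio of the density of \<sigma> at \<open>T + 1\<close> to that of
  \<tau> at \<open>T - 1\<close> would be unbounded. For \<open>3 \<le> T\<close> the intervals
  avoid 0, so a point mass at 0 is covered as well.\<close>

lemma normal_tails_comparison:
  assumes \<sigma>: "0 \<le> \<sigma>" "0 \<le> \<tau>" and \<kappa>: "0 \<le> \<kappa>"
    and le: "\<And>T. 3 \<le> T \<Longrightarrow> measure (normal_distribution 0 \<sigma>) {T<..T + 1} \<le> \<kappa> * measure (normal_distribution 0 \<tau>) {- T - 2<..- T + 1}"
  shows "\<sigma> \<le> \<tau>"
proof (rule ccontr)
  assume "\<not> \<sigma> \<le> \<tau>"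
  then have lt: "\<tau> < \<sigma>" "0 < \<sigma>" using \<sigma> by auto
  have lower: "normal_density 0 \<sigma> (T + 1) \<le> measure (normal_distribution 0 \<sigma>) {T<..T + 1}" if "3 \<le> T" for T
    using that normal_interval_bounds(1)[OF lt(2), of T "T + 1" "normal_density 0 \<sigma> (T + 1)" "normal_density 0 \<sigma> T"]
      normal_density_antimono[OF lt(2)] by simp
  show False
  proof (cases "\<tau> = 0")
    case True
    have "measure (normal_distribution 0 \<tau>) {- 3 - 2<..- 3 + 1} = 0"
      using True by (simp add: normal_distribution_def measure_return)
    then have "normal_density 0 \<sigma> (3 + 1) \<le> 0" using le[of 3] lower[of 3] by simp
    moreover have "0 < normal_density 0 \<sigma> (3 + 1)" using lt(2) by (rule normal_density_pos)
    ultimately show False by linarith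
  next
    case False
    then have \<tau>: "0 < \<tau>" using \<sigma> by simp
    have upper: "measure (normal_distribution 0 \<tau>) {- T - 2<..- T + 1} \<le> 3 * normal_density 0 \<tau> (T - 1)" if "3 \<le> T" for T
      using that normal_interval_bounds(2)[OF \<tau>, of "- T - 2" "- T + 1" 0 "normal_density 0 \<tau> (T - 1)"]
        normal_density_antimono[OF \<tau>, of "T - 1"] normal_density_nonneg[of 0 \<tau>] by (simp add: abs_if)
    define a where "a = 1 / (2 * \<tau>\<^sup>2)"
    define b where "b = 1 / (2 * \<sigma>\<^sup>2)"
    have "\<tau>\<^sup>2 < \<sigma>\<^sup>2" using lt(1) \<tau> by (intro power_strict_mono) auto
    then have ab: "b < a" "0 < b" unfolding a_def b_def using \<tau> lt by (auto intro!: divide_strict_left_mono)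
    define z where "z = 1 / sqrt (2 * pi * \<sigma>\<^sup>2)"
    define y where "y = 1 / sqrt (2 * pi * \<tau>\<^sup>2)"
    have zy: "0 < z" "0 < y" unfolding z_def y_def using \<tau> lt by auto
    \<comment> \<open>\<open>M\<close> exceeds the largest ratio of exponentials compatible with the
      assumption, and \<open>T\<close> is taken so large that the exponent in question is at least
      \<open>M\<close>.\<close>
    define M where "M = 1 + \<bar>3 * \<kappa> * y / z\<bar>"
    define T where "T = 3 + (2 * (a + b) + M) / (a - b)"
    have "0 \<le> (2 * (a + b) + M) / (a - b)" using ab unfolding M_def by (intro divide_nonneg_nonneg) auto
    then have T: "3 \<le> T" unfolding T_def by simp
    have "T * (a - b) - 2 * (a + b) = 3 * (a - b) + M" unfolding T_def using ab by (simp add: field_simps)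
    then have "M \<le> T * (a - b) - 2 * (a + b)" using ab by simp
    then have "1 * M \<le> T * (T * (a - b) - 2 * (a + b))" using T ab unfolding M_def by (intro mult_mono) auto
    then have "M \<le> (T - 1)\<^sup>2 * a - (T + 1)\<^sup>2 * b" using ab by (simp add: power2_eq_square algebra_simps)
    then have "M \<le> exp ((T - 1)\<^sup>2 * a - (T + 1)\<^sup>2 * b)" by (meson exp_ge_add_one_self order_trans le_add_same_cancel2 zero_le_one add_increasing)
    moreover have "z * exp (- ((T + 1)\<^sup>2 * b)) \<le> \<kappa> * (3 * (y * exp (- ((T - 1)\<^sup>2 * a))))"
    proof -
      have "normal_density 0 \<sigma> (T + 1) \<le> \<kappa> * (3 * normal_density 0 \<tau> (T - 1))"
        using lower[OF T] le[OF T] mult_left_mono[OF upper[OF T] \<kappa>] by linarith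
      then show ?thesis unfolding normal_density_def z_def y_def a_def b_def by simp
    qed
    then have "exp ((T - 1)\<^sup>2 * a - (T + 1)\<^sup>2 * b) \<le> 3 * \<kappa> * y / z"
      using zy by (simp add: exp_diff exp_minus field_simps)
    ultimately show False unfolding M_def by linarith
  qed
qed

section \<open>Convergence of the probabilities of windows\<close>

context chain
begin

lemma wsum_shift: "wsum (\<lambda>u. f u - E) v w = wsum f v w - real (length w) * E" for f :: "'q \<Rightarrow> real"
  by (induction w arbitrary: v) (auto simp: algebra_simps)

lemma wsum_bound:
  fixes f :: "'q \<Rightarrow> real"
  assumes "\<And>u. u \<in> V \<Longrightarrow> \<bar>f u\<bar> \<le> B" "v \<in> V" "acc v w"
  shows "\<bar>wsum f v w\<bar> \<le> B * length w"
  using assms(2,3)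
proof (induction w arbitrary: v)
  case (Cons s w)
  then have "tr v s \<in> V" using tr_closed by simp
  then have "\<bar>f (tr v s)\<bar> \<le> B" "\<bar>wsum f (tr v s) w\<bar> \<le> B * length w" using assms(1) Cons by auto
  then show ?case by (simp add: algebra_simps)
qed simp

lemma words_nonempty: "v \<in> V \<Longrightarrow> words v n \<noteq> {}"
  using sum_pr[of v n] by auto

lemma clt_data_charf:
  assumes U: "U \<subseteq> V" "\<And>v s. v \<in> U \<Longrightarrow> s \<in> out v \<Longrightarrow> tr v s \<in> U" and clt: "clt_data g s2 U a1 a2" and v: "v \<in> U"
  shows "(\<lambda>n. charf g (t / sqrt n) (\<lambda>_. 1) n v) \<longlonglongrightarrow> of_real (exp (- s2 * t\<^sup>2 / 2))" and "0 \<le> s2"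
proof -
  show lim: "(\<lambda>n. charf g (t / sqrt n) (\<lambda>_. 1) n v) \<longlonglongrightarrow> of_real (exp (- s2 * t\<^sup>2 / 2))" for t
    by (rule charf_tendsto[OF U _ _ v]) (use clt in \<open>auto simp: clt_data_def\<close>)
  show "0 \<le> s2" by (rule charf_limit_variance_nonneg[OF _ lim]) (use U v in auto)
qed

lemma window_limit:
  assumes U: "U \<subseteq> V" "\<And>v s. v \<in> U \<Longrightarrow> s \<in> out v \<Longrightarrow> tr v s \<in> U" and clt: "clt_data g s2 U a1 a2" and v: "v \<in> U"
    and ab: "a \<le> b" "s2 \<noteq> 0 \<or> a \<noteq> 0 \<and> b \<noteq> 0"
  shows "(\<lambda>n. \<Sum>w | w \<in> words v n \<and> wsum g v w / sqrt n \<in> {a<..b}. pr v w) \<longlonglongrightarrow>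
           measure (normal_distribution 0 (sqrt s2)) {a<..b}"
proof -
  have vV: "v \<in> V" using U v by blast
  have s2: "0 \<le> s2" using clt_data_charf(2)[OF U clt v] .
  let ?X = "\<lambda>n w. wsum g v w / sqrt (real n)"
  define M where "M n = distr (point_measure (words v n) (\<lambda>w. ennreal (pr v w))) borel (?X n)" for n
  let ?N = "normal_distribution 0 (sqrt s2)"
  have fin: "finite (words v n)" "\<And>w. w \<in> words v n \<Longrightarrow> 0 \<le> pr v w" "(\<Sum>w\<in>words v n. pr v w) = 1" for n
  proof -
    show "finite (words v n)" using vV by simp
    show "0 \<le> pr v w" if "w \<in> words v n" for w using pr_pos[OF vV, of w] that by (simp add: words_def)
    show "(\<Sum>w\<in>words v n. pr v w) = 1" using sum_pr[OF vV] .
  qed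
  have "char (M n) t = (\<Sum>w\<in>words v n. of_real (pr v w) * iexp (t * ?X n w))" for n t
    unfolding M_def by (rule finite_distribution(2)[OF fin])
  then have cM: "char (M n) t = charf g (t / sqrt n) (\<lambda>_. 1) n v" for n t
    unfolding charf_def by simp
  have cdfM: "cdf (M n) x = (\<Sum>w | w \<in> words v n \<and> ?X n w \<le> x. pr v w)" for n x
    unfolding M_def by (rule finite_distribution(3)[OF fin])
  have rN: "real_distribution ?N" using s2 by (intro real_distribution_normal) simp
  have "weak_conv_m M ?N"
  proof (rule levy_continuity)
    show "real_distribution (M n)" for n unfolding M_def by (rule finite_distribution(1)[OF fin])
    show "real_distribution ?N" by fact
    show "(\<lambda>n. char (M n) t) \<longlonglongrightarrow> char ?N t" for t
      using clt_data_charf(1)[OF U clt v] s2 by (simp add: cM char_normal_distribution)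
  qed
  then have cdf: "(\<lambda>n. cdf (M n) x) \<longlonglongrightarrow> cdf ?N x" if "s2 \<noteq> 0 \<or> x \<noteq> 0" for x
    using isCont_cdf_normal[of "sqrt s2" x] s2 that unfolding weak_conv_m_def weak_conv_def by auto
  have diff: "cdf (M n) b - cdf (M n) a = (\<Sum>w | w \<in> words v n \<and> ?X n w \<in> {a<..b}. pr v w)" for n
  proof -
    have "{w \<in> words v n. ?X n w \<in> {a<..b}} = {w \<in> words v n. ?X n w \<le> b} - {w \<in> words v n. ?X n w \<le> a}" by auto
    moreover have "{w \<in> words v n. ?X n w \<le> a} \<subseteq> {w \<in> words v n. ?X n w \<le> b}" using ab by auto
    ultimately show ?thesis unfolding cdfM using fin(1)[of n]
      by (simp add: sum_diff)
  qed
  interpret N: real_distribution ?N by fact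
  have "cdf ?N b - cdf ?N a = measure ?N {a<..b}"
    using ab(1) N.cdf_diff_eq[of a b] by (cases "a = b") auto
  moreover have "(\<lambda>n. cdf (M n) b - cdf (M n) a) \<longlonglongrightarrow> cdf ?N b - cdf ?N a"
    using cdf[of a] cdf[of b] ab(2) by (intro tendsto_diff) auto
  ultimately show ?thesis unfolding diff by simp
qed

end

section \<open>Comparison of recurrent classes\<close>

locale combable_group = combed_group G S \<kappa> L \<Gamma>
  for G :: "('a, 'b) monoid_scheme" (structure) and S \<kappa> L \<Gamma> +
  fixes \<Phi> :: "'a \<Rightarrow> real" and f :: "nat \<Rightarrow> real" and D :: real
  assumes \<Phi>_word: "full.acc v0 w \<Longrightarrow> \<Phi> (ev w) = f v0 + full.wsum f v0 w"
    and quasi: "a \<in> carrier G \<Longrightarrow> b \<in> carrier G \<Longrightarrow> \<bar>\<Phi> a + \<Phi> b - \<Phi> (a \<otimes> b)\<bar> \<le> D"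
begin

text \<open>A path from an accessible vertex is the end of a word of \<open>L\<close>, and the
  quasimorphism property splits off the beginning. So the sum along a path depends, up to
  \<open>D\<close>, only on the element that the path spells, whatever its starting vertex.\<close>

lemma word_value:
  assumes "v \<in> accessible" "full.acc v w"
  shows "\<bar>\<Phi> (ev w) - full.wsum f v w\<bar> \<le> D" "w \<in> lists S" "length w = len (ev w)"
proof -
  obtain u where u: "full.acc v0 u" "v = full.run v0 u" using assms(1) unfolding accessible_def by blast
  then have uw: "full.acc v0 (u @ w)" using assms(2) by simp
  have l: "u \<in> lists S" "w \<in> lists S" "length (u @ w) = len (ev (u @ w))" using acc_L[OF uw] by auto
  show "w \<in> lists S" by fact
  show "length w = len (ev w)" using geodesic_factor[of u w "[]"] l by simp
  have "\<Phi> (ev u \<otimes> ev w) = \<Phi> (ev u) + full.wsum f v w"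
    using \<Phi>_word[OF uw] \<Phi>_word[OF u(1)] u(2) ev_append[OF l(1,2)] by (simp add: full.wsum_append)
  then show "\<bar>\<Phi> (ev w) - full.wsum f v w\<bar> \<le> D" using quasi[of "ev u" "ev w"] l by simp
qed

lemma pos_accessible: "v \<in> pos_states \<Longrightarrow> v \<in> accessible"
  by (simp add: pos_states_def)

lemma rho_bounds: "\<exists>r R. 0 < r \<and> (\<forall>v\<in>pos_states. r \<le> rho v \<and> rho v \<le> R)"
proof -
  have fin: "finite (rho ` pos_states)" "rho ` pos_states \<noteq> {}" using pos.finite_V v0_pos by auto
  have "Min (rho ` pos_states) \<in> rho ` pos_states" using fin by (rule Min_in)
  then have "0 < Min (rho ` pos_states)" by (auto simp: pos_states_def)
  then show ?thesis using fin by (intro exI[of _ "Min (rho ` pos_states)"] exI[of _ "Max (rho ` pos_states)"]) auto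
qed

text \<open>The words of length \<open>n\<close> from \<open>c\<close> have total probability 1 and
  each has probability at most a constant over \<open>lam ^ n\<close>, so there are at least on the
  order of \<open>lam ^ n\<close> of them. They represent distinct elements, because they remain
  words of \<open>L\<close> after a common prefix. This is the growth that
  \<open>dense_language\<close> asks for.\<close>

lemma recurrent_class_dense:
  assumes c: "c \<in> pos.recurrent"
  shows "\<exists>\<Delta>. \<forall>h\<in>carrier G. \<exists>a\<in>carrier G. \<exists>b\<in>carrier G. \<exists>v\<in>pos.reach c. \<exists>w.
     pos.acc v w \<and> len a \<le> \<Delta> \<and> len b \<le> \<Delta> \<and> h = a \<otimes> ev w \<otimes> b"
proof -
  have cp: "c \<in> pos_states" using c by (simp add: pos.recurrent_def)
  have Cp: "pos.reach c \<subseteq> pos_states" using pos.reach_V[OF cp] .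
  define W where "W = {w. \<exists>v\<in>pos.reach c. pos.acc v w}"
  have Wacc: "\<exists>v\<in>accessible. full.acc v w" if "w \<in> W" for w
    using that Cp pos_accessible pos_acc_imp unfolding W_def by blast
  obtain K where K: "\<And>n. real (card (word_sphere G S n)) \<le> K * lam ^ n" using growth(3) by blast
  obtain R where R: "\<And>v. v \<in> pos_states \<Longrightarrow> rho v \<le> R" using rho_bounds by blast
  have c0: "0 < rho c" "rho c \<le> R" using cp R by (auto simp: pos_states_def)
  have "\<exists>\<Delta>. \<forall>h\<in>carrier G. \<exists>a\<in>carrier G. \<exists>b\<in>carrier G. \<exists>w\<in>W. len a \<le> \<Delta> \<and> len b \<le> \<Delta> \<and> h = a \<otimes> ev w \<otimes> b"
  proof (rule dense_language[OF growth(1) K])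
    show "W \<subseteq> lists S" using Wacc word_value(2) by blast
    show "length w = len (ev w)" if "w \<in> W" for w using Wacc[OF that] word_value(3) by blast
    show "v \<in> W" if "u @ v @ w \<in> W" for u v w
    proof -
      obtain x where x: "x \<in> pos.reach c" "pos.acc x (u @ v @ w)" using \<open>u @ v @ w \<in> W\<close> unfolding W_def by blast
      then have "pos.run x u \<in> pos.reach x" unfolding pos.reach_def by auto
      then have "pos.run x u \<in> pos.reach c" using pos.reach_trans x(1) by blast
      then show ?thesis using x(2) unfolding W_def by auto
    qed
    show "0 < rho c / R" using c0 by simp
    show "rho c / R * lam ^ n \<le> real (card (ev ` {w \<in> W. length w = n}))" for n
    proof -
      have fin: "finite (ev ` {w \<in> W. length w = n})"
      proof (rule finite_subset[OF _ finite_sphere[of n]])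
        show "ev ` {w \<in> W. length w = n} \<subseteq> word_sphere G S n"
          using Wacc word_value(2,3) unfolding word_sphere_def by fastforce
      qed
      obtain u where u: "full.acc v0 u" "c = full.run v0 u" using pos_accessible[OF cp] unfolding accessible_def by blast
      have "inj_on ev (pos.words c n)"
      proof (rule inj_onI)
        fix x y assume xy: "x \<in> pos.words c n" "y \<in> pos.words c n" "ev x = ev y"
        then have a: "full.acc v0 (u @ x)" "full.acc v0 (u @ y)" using u pos_acc_imp by (auto simp: pos.words_def)
        then have "ev (u @ x) = ev (u @ y)" using acc_L[OF a(1)] acc_L[OF a(2)] xy(3) by (simp add: ev_append)
        then show "x = y" using ev_inj[OF a] by simp
      qed
      then have "card (pos.words c n) = card (ev ` pos.words c n)" by (simp add: card_image)
      also have "\<dots> \<le> card (ev ` {w \<in> W. length w = n})"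
        by (rule card_mono[OF fin]) (auto simp: W_def pos.words_def)
      finally have card: "card (pos.words c n) \<le> card (ev ` {w \<in> W. length w = n})" .
      have "1 = (\<Sum>w\<in>pos.words c n. pos.pr c w)" using pos.sum_pr[OF cp] by simp
      also have "\<dots> \<le> (\<Sum>w\<in>pos.words c n. R / (lam ^ n * rho c))"
      proof (rule sum_mono)
        fix w assume "w \<in> pos.words c n"
        then have w: "pos.acc c w" "length w = n" by (auto simp: pos.words_def)
        then show "pos.pr c w \<le> R / (lam ^ n * rho c)"
          unfolding pr_eq[OF cp w(1)] w(2) using R[OF pos.run_in[OF cp w(1)]] c0 lam_pos
          by (intro divide_right_mono) auto
      qed
      finally have "rho c / R * lam ^ n \<le> real (card (pos.words c n))" using c0 lam_pos by (simp add: field_simps)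
      then show ?thesis using card by linarith
    qed
  qed
  then show ?thesis unfolding W_def by blast
qed

lemma \<Phi>_inv: "g \<in> carrier G \<Longrightarrow> \<bar>\<Phi> (inv g) + \<Phi> g\<bar> \<le> 2 * D"
  using quasi[of "inv g" g] quasi[of \<one> \<one>] by (simp add: abs_if split: if_splits)

lemma \<Phi>_conj_bound:
  assumes "a \<in> carrier G" "x \<in> carrier G" "b \<in> carrier G"
  shows "\<bar>\<Phi> (a \<otimes> x \<otimes> b) - \<Phi> x\<bar> \<le> 2 * D + \<bar>\<Phi> a\<bar> + \<bar>\<Phi> b\<bar>"
  using quasi[of a x] quasi[of "a \<otimes> x" b] assms by (simp add: abs_if split: if_splits)

text \<open>The inverse of \<open>ev w\<close> is spelled, up to bounded corrections, by a path
  \<open>y\<close> in the class of \<open>c'\<close>. A path from \<open>c'\<close> to its start is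
  put in front and a filler \<open>x\<close> behind, so that the length is exactly
  \<open>n + D'\<close>. The last conjunct keeps the bounded data from which \<open>w\<close> can be
  recovered; it is used to count fibres.\<close>

lemma reflected_word:
  assumes c: "c \<in> pos.recurrent" and c': "c' \<in> pos.recurrent"
  shows "\<exists>\<Delta> D1 D' K1. \<forall>n. \<forall>w\<in>pos.words c n. \<exists>w'\<in>pos.words c' (n + D').
      \<bar>pos.wsum f c w + pos.wsum f c' w'\<bar> \<le> K1 \<and>
      (\<exists>a b k l. a \<in> carrier G \<and> b \<in> carrier G \<and> len a \<le> \<Delta> \<and> len b \<le> \<Delta> \<and> k \<le> D1 \<and> n - 2 * \<Delta> \<le> l \<and> l \<le> n + 2 * \<Delta> \<and>
        inv (ev w) = a \<otimes> ev (take l (drop k w')) \<otimes> b)"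
proof -
  have cp: "c \<in> pos_states" "c' \<in> pos_states" using c c' by (auto simp: pos.recurrent_def)
  let ?C = "pos.reach c'"
  have Cp: "?C \<subseteq> pos_states" using pos.reach_V[OF cp(2)] .
  obtain \<Delta> where \<Delta>: "\<And>h. h \<in> carrier G \<Longrightarrow> \<exists>a\<in>carrier G. \<exists>b\<in>carrier G. \<exists>v\<in>?C. \<exists>w.
     pos.acc v w \<and> len a \<le> \<Delta> \<and> len b \<le> \<Delta> \<and> h = a \<otimes> ev w \<otimes> b"
    using recurrent_class_dense[OF c'] by blast
  have "\<forall>v\<in>?C. \<exists>z. pos.acc c' z \<and> pos.run c' z = v" unfolding pos.reach_def by blast
  then obtain z where z: "\<And>v. v \<in> ?C \<Longrightarrow> pos.acc c' (z v) \<and> pos.run c' (z v) = v" by metis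
  define D1 where "D1 = (\<Sum>v\<in>?C. length (z v))"
  have finC: "finite ?C" using Cp pos.finite_V finite_subset by blast
  have D1: "length (z v) \<le> D1" if "v \<in> ?C" for v
    unfolding D1_def using that finC by (intro member_le_sum) auto
  define MF where "MF = (\<Sum>v\<in>pos_states. \<bar>f v\<bar>)"
  have MF: "\<bar>f v\<bar> \<le> MF" if "v \<in> pos_states" for v
    unfolding MF_def using that pos.finite_V by (intro member_le_sum) auto
  have MF0: "0 \<le> MF" unfolding MF_def by (intro sum_nonneg) auto
  let ?B = "{g \<in> carrier G. len g \<le> \<Delta>}"
  define MB where "MB = (\<Sum>g\<in>?B. \<bar>\<Phi> g\<bar>)"
  have MB: "\<bar>\<Phi> g\<bar> \<le> MB" if "g \<in> carrier G" "len g \<le> \<Delta>" for g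
    unfolding MB_def using that finite_ball[of \<Delta>] by (intro member_le_sum) auto
  \<comment> \<open>\<open>D'\<close> leaves room for the longest connecting path and the largest
    excess of \<open>y\<close> over \<open>n\<close>. In \<open>K1\<close>, the connecting path has
    at most \<open>D1\<close> letters and the filler at most \<open>D1 + 4 * \<Delta>\<close>; each
    of the two path sums costs \<open>D\<close>, the corrections \<open>a\<close> and
    \<open>b\<close> cost \<open>2 * D + 2 * MB\<close>, and inversion costs
    \<open>2 * D\<close>.\<close>
  define D' where "D' = D1 + 2 * \<Delta>"
  define K1 where "K1 = MF * real (2 * D1 + 4 * \<Delta>) + 6 * D + 2 * MB"
  have main: "\<exists>w'\<in>pos.words c' (n + D').
      \<bar>pos.wsum f c w + pos.wsum f c' w'\<bar> \<le> K1 \<and>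
      (\<exists>a b k l. a \<in> carrier G \<and> b \<in> carrier G \<and> len a \<le> \<Delta> \<and> len b \<le> \<Delta> \<and> k \<le> D1 \<and> n - 2 * \<Delta> \<le> l \<and> l \<le> n + 2 * \<Delta> \<and>
        inv (ev w) = a \<otimes> ev (take l (drop k w')) \<otimes> b)" if w: "w \<in> pos.words c n" for n w
  proof -
    have aw: "pos.acc c w" "length w = n" using w by (auto simp: pos.words_def)
    note vw = word_value[OF pos_accessible[OF cp(1)] pos_acc_imp[OF aw(1)]]
    have g: "ev w \<in> carrier G" "len (ev w) = n" using vw aw by auto
    obtain a b v y where ab: "a \<in> carrier G" "b \<in> carrier G" "len a \<le> \<Delta>" "len b \<le> \<Delta>"
      and v: "v \<in> ?C" and y: "pos.acc v y" "inv (ev w) = a \<otimes> ev y \<otimes> b"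
      using \<Delta>[of "inv (ev w)"] g by blast
    have vp: "v \<in> pos_states" using v Cp by blast
    note vy = word_value[OF pos_accessible[OF vp] pos_acc_imp[OF y(1)]]
    have yc: "ev y \<in> carrier G" using vy by simp
    have ly: "n \<le> length y + 2 * \<Delta>" "length y \<le> n + 2 * \<Delta>"
    proof -
      have "len (a \<otimes> ev y \<otimes> b) \<le> len (a \<otimes> ev y) + len b" "len (a \<otimes> ev y) \<le> len a + len (ev y)"
        by (simp_all only: len_mult m_closed ab(1,2) yc)
      moreover have "len (a \<otimes> ev y \<otimes> b) = n" using len_inv[OF g(1)] unfolding y(2) g(2) .
      ultimately show "n \<le> length y + 2 * \<Delta>" using ab vy(3) by linarith
      have "ev y = inv a \<otimes> (a \<otimes> ev y \<otimes> b) \<otimes> inv b" using ab yc by (simp add: m_assoc inv_solve_left)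
      moreover have "len (inv a \<otimes> (a \<otimes> ev y \<otimes> b) \<otimes> inv b) \<le> len (inv a \<otimes> (a \<otimes> ev y \<otimes> b)) + len (inv b)"
        "len (inv a \<otimes> (a \<otimes> ev y \<otimes> b)) \<le> len (inv a) + len (a \<otimes> ev y \<otimes> b)"
        by (simp_all only: len_mult m_closed inv_closed ab(1,2) yc)
      ultimately have "len (ev y) \<le> \<Delta> + n + \<Delta>" using \<open>len (a \<otimes> ev y \<otimes> b) = n\<close> ab by simp
      then show "length y \<le> n + 2 * \<Delta>" using vy(3) by simp
    qed
    define j where "j = n + D' - (length (z v) + length y)"
    have j: "length (z v) + length y + j = n + D'" "j \<le> D1 + 4 * \<Delta>"
      using D1[OF v] ly unfolding j_def D'_def by linarith+
    let ?v' = "pos.run v y"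
    have v'p: "?v' \<in> pos_states" using pos.run_in[OF vp y(1)] .
    obtain x where x: "pos.acc ?v' x" "length x = j" using pos.words_nonempty[OF v'p, of j] by (auto simp: pos.words_def)
    define w' where "w' = z v @ y @ x"
    have w': "w' \<in> pos.words c' (n + D')" unfolding w'_def pos.words_def using z[OF v] y(1) x j(1) by simp
    have "pos.wsum f c' w' = pos.wsum f c' (z v) + (pos.wsum f v y + pos.wsum f ?v' x)"
      unfolding w'_def pos.wsum_append using z[OF v] by simp
    moreover have "\<bar>pos.wsum f c' (z v)\<bar> \<le> MF * length (z v)" by (rule pos.wsum_bound[of f MF c' "z v"]) (use MF cp z[OF v] in auto)
    moreover have "\<bar>pos.wsum f ?v' x\<bar> \<le> MF * length x" by (rule pos.wsum_bound[of f MF ?v' x]) (use MF v'p x in auto)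
    moreover have "MF * length (z v) + MF * length x \<le> MF * real (2 * D1 + 4 * \<Delta>)"
      unfolding distrib_left[symmetric] using D1[OF v] j(2) x(2) MF0 by (intro mult_left_mono) auto
    moreover have "\<bar>\<Phi> (ev y) - pos.wsum f v y\<bar> \<le> D" "\<bar>\<Phi> (ev w) - pos.wsum f c w\<bar> \<le> D" using vy(1) vw(1) by auto
    moreover have "\<bar>\<Phi> (inv (ev w)) - \<Phi> (ev y)\<bar> \<le> 2 * D + \<bar>\<Phi> a\<bar> + \<bar>\<Phi> b\<bar>"
      unfolding y(2) using \<Phi>_conj_bound ab yc by blast
    moreover have "\<bar>\<Phi> a\<bar> \<le> MB" "\<bar>\<Phi> b\<bar> \<le> MB" using MB ab by auto
    moreover have "\<bar>\<Phi> (inv (ev w)) + \<Phi> (ev w)\<bar> \<le> 2 * D" using \<Phi>_inv[OF g(1)] .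
    ultimately have "\<bar>pos.wsum f c w + pos.wsum f c' w'\<bar> \<le> K1" unfolding K1_def by linarith
    moreover have "take (length y) (drop (length (z v)) w') = y" unfolding w'_def by simp
    ultimately show ?thesis using w' ab y(2) D1[OF v] ly
      by (intro bexI[of _ w'] conjI exI[of _ a] exI[of _ b] exI[of _ "length (z v)"] exI[of _ "length y"]) auto
  qed
  show ?thesis by (intro exI[of _ \<Delta>] exI[of _ D1] exI[of _ D'] exI[of _ K1] allI ballI main)
qed

text \<open>The map from \<open>w\<close> to its reflected word changes probabilities by at most the
  factor \<open>q\<close>, since both lengths differ by \<open>D'\<close> and \<open>rho\<close> is
  bounded from both sides. Its fibres have at most \<open>m\<close> elements: \<open>w\<close> is
  determined by its image, two elements of a ball, and the position and length of a subword. Any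
  event \<open>Q\<close> that contains the reflection of \<open>P\<close> with a margin of
  \<open>K1\<close> can be used.\<close>

lemma reflected_probability:
  assumes c: "c \<in> pos.recurrent" and c': "c' \<in> pos.recurrent"
  shows "\<exists>\<kappa>' D' K1. 0 \<le> \<kappa>' \<and> (\<forall>n P Q. (\<forall>x y. P x \<longrightarrow> \<bar>x + y\<bar> \<le> K1 \<longrightarrow> Q y) \<longrightarrow>
      (\<Sum>w | w \<in> pos.words c n \<and> P (pos.wsum f c w). pos.pr c w) \<le>
      \<kappa>' * (\<Sum>w | w \<in> pos.words c' (n + D') \<and> Q (pos.wsum f c' w). pos.pr c' w))"
proof -
  have cp: "c \<in> pos_states" "c' \<in> pos_states" using c c' by (auto simp: pos.recurrent_def)
  obtain \<Delta> D1 D' K1 where rw: "\<And>n w. w \<in> pos.words c n \<Longrightarrow> \<exists>w'\<in>pos.words c' (n + D').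
      \<bar>pos.wsum f c w + pos.wsum f c' w'\<bar> \<le> K1 \<and>
      (\<exists>a b k l. a \<in> carrier G \<and> b \<in> carrier G \<and> len a \<le> \<Delta> \<and> len b \<le> \<Delta> \<and> k \<le> D1 \<and> n - 2 * \<Delta> \<le> l \<and> l \<le> n + 2 * \<Delta> \<and>
        inv (ev w) = a \<otimes> ev (take l (drop k w')) \<otimes> b)"
    using reflected_word[OF c c'] by blast
  obtain r R where rR: "0 < r" "\<And>v. v \<in> pos_states \<Longrightarrow> r \<le> rho v \<and> rho v \<le> R" using rho_bounds by blast
  let ?B = "{g \<in> carrier G. len g \<le> \<Delta>}"
  define m where "m = card ?B * (card ?B * ((D1 + 1) * (4 * \<Delta> + 1)))"
  define q where "q = R * rho c' * lam ^ D' / (rho c * r)"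
  have rc: "0 < rho c" "0 < rho c'" using cp by (auto simp: pos_states_def)
  have R0: "0 < R" using rR(1) rR(2)[OF v0_pos] by linarith
  have q0: "0 \<le> q" unfolding q_def using rc R0 rR(1) lam_pos by simp
  show ?thesis
  proof (rule exI[of _ "q * m"], rule exI[of _ D'], rule exI[of _ K1], intro conjI allI impI)
    show "0 \<le> q * real m" using q0 by simp
    fix n :: nat and P Q :: "real \<Rightarrow> bool" assume PQ: "\<forall>x y. P x \<longrightarrow> \<bar>x + y\<bar> \<le> K1 \<longrightarrow> Q y"
    define good where "good w w' \<longleftrightarrow> w' \<in> pos.words c' (n + D') \<and>
      \<bar>pos.wsum f c w + pos.wsum f c' w'\<bar> \<le> K1 \<and>
      (\<exists>a b k l. a \<in> carrier G \<and> b \<in> carrier G \<and> len a \<le> \<Delta> \<and> len b \<le> \<Delta> \<and> k \<le> D1 \<and> n - 2 * \<Delta> \<le> l \<and> l \<le> n + 2 * \<Delta> \<and>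
        inv (ev w) = a \<otimes> ev (take l (drop k w')) \<otimes> b)" for w w'
    have "\<exists>w'. good w w'" if "w \<in> pos.words c n" for w
      using rw[OF that] unfolding good_def Bex_def .
    then obtain \<psi> where \<psi>: "\<And>w. w \<in> pos.words c n \<Longrightarrow> good w (\<psi> w)" by metis
    have \<psi>1: "\<psi> w \<in> pos.words c' (n + D')" "\<bar>pos.wsum f c w + pos.wsum f c' (\<psi> w)\<bar> \<le> K1"
      if "w \<in> pos.words c n" for w
      using \<psi>[OF that] unfolding good_def by (simp_all only:)
    let ?A = "{w \<in> pos.words c n. P (pos.wsum f c w)}"
    let ?A' = "{w \<in> pos.words c' (n + D'). Q (pos.wsum f c' w)}"
    have finA: "finite ?A" "finite ?A'" using cp by auto
    have img: "\<psi> ` ?A \<subseteq> ?A'" using \<psi>1 PQ by blast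
    have fiber: "card {w \<in> ?A. \<psi> w = w'} \<le> m" for w'
    proof -
      let ?I = "?B \<times> ?B \<times> {..D1} \<times> {n - 2 * \<Delta>..n + 2 * \<Delta>}"
      let ?h = "\<lambda>(a, b, k, l). inv (a \<otimes> ev (take l (drop k w')) \<otimes> b)"
      have sub: "ev ` {w \<in> ?A. \<psi> w = w'} \<subseteq> ?h ` ?I"
      proof (rule image_subsetI)
        fix w assume w: "w \<in> {w \<in> ?A. \<psi> w = w'}"
        then have "good w w'" using \<psi>[of w] by auto
        then obtain a b k l where "a \<in> ?B" "b \<in> ?B" "k \<in> {..D1}" "l \<in> {n - 2 * \<Delta>..n + 2 * \<Delta>}"
          and e: "inv (ev w) = a \<otimes> ev (take l (drop k w')) \<otimes> b" unfolding good_def by auto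
        then have "(a, b, k, l) \<in> ?I" by simp
        moreover have "ev w \<in> carrier G"
          using w word_value(2)[OF pos_accessible[OF cp(1)] pos_acc_imp] by (auto simp: pos.words_def)
        then have "ev w = ?h (a, b, k, l)" unfolding prod.case e[symmetric] by simp
        ultimately show "ev w \<in> ?h ` ?I" by blast
      qed
      have "inj_on ev {w \<in> ?A. \<psi> w = w'}"
      proof (rule inj_onI)
        fix x y assume xy: "x \<in> {w \<in> ?A. \<psi> w = w'}" "y \<in> {w \<in> ?A. \<psi> w = w'}" "ev x = ev y"
        obtain u where u: "full.acc v0 u" "c = full.run v0 u" using pos_accessible[OF cp(1)] unfolding accessible_def by blast
        have a: "full.acc v0 (u @ x)" "full.acc v0 (u @ y)" using xy u pos_acc_imp by (auto simp: pos.words_def)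
        then have "ev (u @ x) = ev (u @ y)" using acc_L[OF a(1)] acc_L[OF a(2)] xy(3) by (simp add: ev_append)
        then show "x = y" using ev_inj[OF a] by simp
      qed
      then have "card {w \<in> ?A. \<psi> w = w'} = card (ev ` {w \<in> ?A. \<psi> w = w'})" by (simp add: card_image)
      also have "\<dots> \<le> card ?I"
        using finite_ball[of \<Delta>] by (intro surj_card_le[OF _ sub]) auto
      also have "\<dots> \<le> card ?B * (card ?B * ((D1 + 1) * (4 * \<Delta> + 1)))"
        unfolding card_cartesian_product by (intro mult_le_mono) auto
      finally show ?thesis unfolding m_def .
    qed
    have pq: "pos.pr c w \<le> q * pos.pr c' (\<psi> w)" if w: "w \<in> pos.words c n" for w
    proof -
      have a: "pos.acc c w" "length w = n" "pos.acc c' (\<psi> w)" "length (\<psi> w) = n + D'"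
        using w \<psi>1(1)[OF w] unfolding pos.words_def by auto
      have "pos.pr c w \<le> R / (lam ^ n * rho c)"
        unfolding pr_eq[OF cp(1) a(1)] a(2) using rR(2)[OF pos.run_in[OF cp(1) a(1)]] rc lam_pos
        by (intro divide_right_mono) auto
      also have "\<dots> = q * (r / (lam ^ (n + D') * rho c'))"
        unfolding q_def using rc lam_pos rR(1) by (simp add: field_simps power_add)
      also have "\<dots> \<le> q * pos.pr c' (\<psi> w)"
        unfolding pr_eq[OF cp(2) a(3)] a(4) using rR(2)[OF pos.run_in[OF cp(2) a(3)]] rc lam_pos q0
        by (intro mult_left_mono divide_right_mono) auto
      finally show ?thesis .
    qed
    have pr0: "0 \<le> pos.pr c' w" if "w \<in> pos.words c' k" for w k
      using that pos.pr_pos[OF cp(2)] by (auto simp: pos.words_def intro: less_imp_le)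
    have "(\<Sum>w\<in>?A. pos.pr c w) \<le> (\<Sum>w\<in>?A. q * pos.pr c' (\<psi> w))" using pq by (intro sum_mono) auto
    also have "\<dots> = (\<Sum>w'\<in>\<psi> ` ?A. \<Sum>w\<in>{w \<in> ?A. \<psi> w = w'}. q * pos.pr c' (\<psi> w))"
      by (rule sum.image_gen[OF finA(1)])
    also have "\<dots> = (\<Sum>w'\<in>\<psi> ` ?A. real (card {w \<in> ?A. \<psi> w = w'}) * (q * pos.pr c' w'))"
    proof (rule sum.cong[OF refl])
      fix w'
      have "(\<Sum>w\<in>{w \<in> ?A. \<psi> w = w'}. q * pos.pr c' (\<psi> w)) = (\<Sum>w\<in>{w \<in> ?A. \<psi> w = w'}. q * pos.pr c' w')"
        by (intro sum.cong) auto
      then show "(\<Sum>w\<in>{w \<in> ?A. \<psi> w = w'}. q * pos.pr c' (\<psi> w)) = real (card {w \<in> ?A. \<psi> w = w'}) * (q * pos.pr c' w')"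
        by (simp only: sum_constant)
    qed
    also have "\<dots> \<le> (\<Sum>w'\<in>\<psi> ` ?A. real m * (q * pos.pr c' w'))"
      using fiber img q0 pr0 by (intro sum_mono mult_right_mono) auto
    also have "\<dots> \<le> (\<Sum>w'\<in>?A'. real m * (q * pos.pr c' w'))"
      using img finA(2) q0 pr0 by (intro sum_mono2) auto
    also have "\<dots> = q * real m * (\<Sum>w'\<in>?A'. pos.pr c' w')" by (simp add: sum_distrib_left mult_ac)
    finally show "(\<Sum>w | w \<in> pos.words c n \<and> P (pos.wsum f c w). pos.pr c w) \<le>
      q * real m * (\<Sum>w | w \<in> pos.words c' (n + D') \<and> Q (pos.wsum f c' w). pos.pr c' w)" .
  qed
qed

end

section \<open>Common mean and variance of the recurrent classes, and the limit theorem\<close>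

context combable_group
begin

definition window_prob :: "nat \<Rightarrow> nat \<Rightarrow> (real \<Rightarrow> bool) \<Rightarrow> real" where
  "window_prob c n P = (\<Sum>w | w \<in> pos.words c n \<and> P (pos.wsum f c w). pos.pr c w)"

lemma window_prob_not:
  assumes "c \<in> pos_states"
  shows "window_prob c n (\<lambda>x. \<not> P x) = 1 - window_prob c n P"
proof -
  have "{w \<in> pos.words c n. \<not> P (pos.wsum f c w)} = pos.words c n - {w \<in> pos.words c n. P (pos.wsum f c w)}" by auto
  then show ?thesis unfolding window_prob_def using assms pos.sum_pr[OF assms, of n]
    by (simp add: sum_diff)
qed

lemma window_prob_limit:
  fixes E :: real
  assumes c: "c \<in> pos.recurrent" and clt: "pos.clt_data (\<lambda>v. f v - E) s2 (pos.reach c) a1 a2"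
    and ab: "a \<le> b" "s2 \<noteq> 0 \<or> a \<noteq> 0 \<and> b \<noteq> 0"
  shows "(\<lambda>n. window_prob c n (\<lambda>x. (x - n * E) / sqrt n \<in> {a<..b})) \<longlonglongrightarrow>
           measure (normal_distribution 0 (sqrt s2)) {a<..b}" and "0 \<le> s2"
proof -
  have cp: "c \<in> pos_states" using c by (simp add: pos.recurrent_def)
  have U: "pos.reach c \<subseteq> pos_states" "\<And>v s. v \<in> pos.reach c \<Longrightarrow> s \<in> pos_out v \<Longrightarrow> tr v s \<in> pos.reach c"
    using pos.reach_V[OF cp] pos.reach_closed by auto
  show "0 \<le> s2" by (rule pos.clt_data_charf(2)[OF U clt pos.reach_self])
  have "(\<Sum>w | w \<in> pos.words c n \<and> pos.wsum (\<lambda>v. f v - E) c w / sqrt n \<in> {a<..b}. pos.pr c w) =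
      window_prob c n (\<lambda>x. (x - n * E) / sqrt n \<in> {a<..b})" for n
    unfolding window_prob_def by (intro sum.cong) (auto simp: pos.wsum_shift pos.words_def)
  then show "(\<lambda>n. window_prob c n (\<lambda>x. (x - n * E) / sqrt n \<in> {a<..b})) \<longlonglongrightarrow>
           measure (normal_distribution 0 (sqrt s2)) {a<..b}"
    using pos.window_limit[OF U clt pos.reach_self ab] by simp
qed

lemma eventually_sqrt_ge: "\<forall>\<^sub>F n in sequentially. K \<le> sqrt (real n)"
proof -
  have "filterlim (\<lambda>n. sqrt (real n)) at_top sequentially" by real_asymp
  then show ?thesis by (simp add: filterlim_at_top)
qed

text \<open>
  A window for the class of \<open>c\<close> is carried by inversion to a window reflected at \<open>0\<close> for the class of \<open>c'\<close>;
  the means therefore satisfy \<open>E = - E'\<close> for all pairs of classes, so all of them vanish.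
\<close>

lemma recurrent_mean_zero:
  fixes E :: real
  assumes c: "c \<in> pos.recurrent" and clt: "pos.clt_data (\<lambda>v. f v - E) s2 (pos.reach c) a1 a2"
  shows "E = 0"
proof (rule ccontr)
  assume E: "E \<noteq> 0"
  have cp: "c \<in> pos_states" using c by (simp add: pos.recurrent_def)
  let ?N = "normal_distribution 0 (sqrt s2)"
  have s2: "0 \<le> s2" by (rule window_prob_limit(2)[OF c clt, of "-1" 1]) auto
  interpret N: real_distribution ?N using s2 by (intro real_distribution_normal) simp
  \<comment> \<open>Comparing the class with itself suffices, because inversion then forces
    \<open>E = - E\<close>.\<close>
  obtain \<kappa>' D' K1 where "0 \<le> \<kappa>'" and H: "\<forall>n P Q. (\<forall>x y. P x \<longrightarrow> \<bar>x + y\<bar> \<le> K1 \<longrightarrow> Q y) \<longrightarrow>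
      window_prob c n P \<le> \<kappa>' * window_prob c (n + D') Q"
    using reflected_probability[OF c c] unfolding window_prob_def by (elim exE conjE)
  note cmp = H[THEN spec, THEN spec, THEN spec, THEN mp]
  have lim: "(\<lambda>n. window_prob c n (\<lambda>x. (x - n * E) / sqrt n \<in> {- T<..T})) \<longlonglongrightarrow> measure ?N {- T<..T}" if "0 < T" for T
    using window_prob_limit(1)[OF c clt, of "- T" T] that by simp
  \<comment> \<open>The window of half-width \<open>T * sqrt n\<close> around \<open>n * E\<close>
    reflects to one around \<open>- n * E\<close>. As soon as \<open>2 * n * \<bar>E\<bar>\<close>
    exceeds both half-widths plus \<open>K1\<close>, the reflection misses the window around
    \<open>(n + D') * E\<close> and lies in its complement.\<close>
  have bound: "measure ?N {- T<..T} \<le> \<kappa>' * (1 - measure ?N {- T<..T})" if T: "0 < T" for T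
  proof -
    let ?p = "\<lambda>n. window_prob c n (\<lambda>x. (x - n * E) / sqrt n \<in> {- T<..T})"
    have "\<forall>\<^sub>F n in sequentially. ?p n \<le> \<kappa>' * (1 - ?p (n + D'))"
      using eventually_sqrt_ge[of "(T + T + \<bar>K1\<bar> + T * sqrt D' + 1) / (2 * \<bar>E\<bar>)"] eventually_sqrt_ge[of 1]
    proof eventually_elim
      case (elim n)
      let ?m = "n + D'"
      define s where "s = sqrt (real n)"
      have s: "1 \<le> s" "s * s = real n" unfolding s_def using elim(2) by auto
      define B where "B = \<bar>K1\<bar> + T * sqrt D'"
      have B: "0 \<le> B" unfolding B_def using T by simp
      have "T + T + B + 1 \<le> s * (2 * \<bar>E\<bar>)" using elim(1) E unfolding s_def B_def by (simp add: divide_le_eq algebra_simps)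
      then have "(T + T + B + 1) * s \<le> (s * (2 * \<bar>E\<bar>)) * s" using s by (intro mult_right_mono) auto
      moreover have "(s * (2 * \<bar>E\<bar>)) * s = 2 * real n * \<bar>E\<bar>" using s(2) by (simp add: mult_ac)
      moreover have "(T + T + B + 1) * s = T * s + T * s + B * s + s" by (simp add: algebra_simps)
      moreover have "B * 1 \<le> B * s" using s B by (intro mult_left_mono)
      ultimately have "T * s + T * s + B < 2 * real n * \<bar>E\<bar>" using s(1) by linarith
      then have far: "T * s + T * s + \<bar>K1\<bar> + T * sqrt D' < 2 * real n * \<bar>E\<bar>" unfolding B_def by linarith
      have rm: "T * sqrt ?m \<le> T * s + T * sqrt D'"
        using mult_left_mono[OF sqrt_add_le_add_sqrt[of "real n" "real D'"], of T] T unfolding s_def by (simp add: algebra_simps)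
      have "?p n \<le> \<kappa>' * window_prob c ?m (\<lambda>y. \<not> (y - ?m * E) / sqrt ?m \<in> {- T<..T})"
      proof (rule cmp, intro allI impI notI)
        fix x y assume x: "(x - n * E) / sqrt n \<in> {- T<..T}" and xy: "\<bar>x + y\<bar> \<le> K1"
          and y: "(y - ?m * E) / sqrt ?m \<in> {- T<..T}"
        have "\<bar>x - n * E\<bar> \<le> T * s"
          using x s(1) unfolding s_def[symmetric] by (simp add: less_divide_eq divide_le_eq abs_le_iff)
        moreover have m: "0 < sqrt (real ?m)" using s unfolding s_def by simp
        then have "\<bar>y - ?m * E\<bar> \<le> T * sqrt ?m" using y by (simp add: less_divide_eq divide_le_eq abs_le_iff)
        moreover have "2 * real n * \<bar>E\<bar> \<le> (real n + real ?m) * \<bar>E\<bar>" by (intro mult_right_mono) auto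
        moreover have "(real n + real ?m) * \<bar>E\<bar> = \<bar>n * E + ?m * E\<bar>"
          unfolding distrib_right[symmetric] abs_mult by simp
        ultimately show False using far rm xy by linarith
      qed
      also have "window_prob c ?m (\<lambda>y. \<not> (y - ?m * E) / sqrt ?m \<in> {- T<..T}) = 1 - ?p ?m"
        by (rule window_prob_not[OF cp])
      finally show ?case .
    qed
    moreover have "(\<lambda>n. \<kappa>' * (1 - ?p (n + D'))) \<longlonglongrightarrow> \<kappa>' * (1 - measure ?N {- T<..T})"
      using LIMSEQ_ignore_initial_segment[OF lim[OF T], of D'] by (intro tendsto_intros)
    ultimately show ?thesis using lim[OF T] by (intro tendsto_le[OF sequentially_bot])
  qed
  have "(\<lambda>i. measure ?N {- real (Suc i)<..real (Suc i)}) \<longlonglongrightarrow> 1 - 0"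
  proof -
    have "(\<lambda>i. cdf ?N (real (Suc i)) - cdf ?N (- real (Suc i))) \<longlonglongrightarrow> 1 - 0"
      using LIMSEQ_Suc[OF N.cdf_lim_infty_prob] LIMSEQ_Suc[OF N.cdf_lim_neg_infty] by (rule tendsto_diff)
    moreover have "cdf ?N (real (Suc i)) - cdf ?N (- real (Suc i)) = measure ?N {- real (Suc i)<..real (Suc i)}" for i
      by (rule N.cdf_diff_eq) simp
    ultimately show ?thesis by simp
  qed
  then have L: "(\<lambda>i. measure ?N {- real (Suc i)<..real (Suc i)}) \<longlonglongrightarrow> 1" by simp
  then have R: "(\<lambda>i. \<kappa>' * (1 - measure ?N {- real (Suc i)<..real (Suc i)})) \<longlonglongrightarrow> \<kappa>' * (1 - 1)" by (intro tendsto_intros)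
  \<comment> \<open>For growing windows the left side of \<open>bound\<close> tends to 1 and the
    right side to 0.\<close>
  have "1 \<le> \<kappa>' * (1 - 1)"
  proof (rule LIMSEQ_le[OF L R], intro exI allI impI)
    fix n
    show "measure ?N {- real (Suc n)<..real (Suc n)} \<le> \<kappa>' * (1 - measure ?N {- real (Suc n)<..real (Suc n)})"
      by (rule bound) simp
  qed
  then show False by simp
qed

text \<open>With both means zero, the reflection of a window for \<open>c\<close> falls, after
  scaling, into the reflected window for \<open>c'\<close> enlarged by 1 on both sides: the margin
  absorbs \<open>K1\<close> and the change from \<open>n\<close> to \<open>n + D'\<close>. The
  limits then satisfy the hypothesis of \<open>normal_tails_comparison\<close>. Exchanging the
  classes gives equality.\<close>

lemma recurrent_variance_le:
  fixes s2 s2' :: real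
  assumes c: "c \<in> pos.recurrent" and clt: "pos.clt_data f s2 (pos.reach c) a1 a2"
    and c': "c' \<in> pos.recurrent" and clt': "pos.clt_data f s2' (pos.reach c') a1' a2'"
  shows "s2 \<le> s2'"
proof -
  have lim: "(\<lambda>n. window_prob c n (\<lambda>x. x / sqrt n \<in> {a<..b})) \<longlonglongrightarrow> measure (normal_distribution 0 (sqrt s2)) {a<..b}"
     and s2: "0 \<le> s2" if "a \<le> b" "a \<noteq> 0" "b \<noteq> 0" for a b
    using window_prob_limit[OF c, of 0 s2 a1 a2 a b] clt that by simp_all
  have lim': "(\<lambda>n. window_prob c' n (\<lambda>x. x / sqrt n \<in> {a<..b})) \<longlonglongrightarrow> measure (normal_distribution 0 (sqrt s2')) {a<..b}"
     and s2': "0 \<le> s2'" if "a \<le> b" "a \<noteq> 0" "b \<noteq> 0" for a b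
    using window_prob_limit[OF c', of 0 s2' a1' a2' a b] clt' that by simp_all
  obtain \<kappa>' D' K1 where \<kappa>: "0 \<le> \<kappa>'" and H: "\<forall>n P Q. (\<forall>x y. P x \<longrightarrow> \<bar>x + y\<bar> \<le> K1 \<longrightarrow> Q y) \<longrightarrow>
      window_prob c n P \<le> \<kappa>' * window_prob c' (n + D') Q"
    using reflected_probability[OF c c'] unfolding window_prob_def by (elim exE conjE)
  note cmp = H[THEN spec, THEN spec, THEN spec, THEN mp]
  have le: "measure (normal_distribution 0 (sqrt s2)) {T<..T + 1} \<le> \<kappa>' * measure (normal_distribution 0 (sqrt s2')) {- T - 2<..- T + 1}"
    if T: "3 \<le> T" for T
  proof -
    let ?p = "\<lambda>n. window_prob c n (\<lambda>x. x / sqrt n \<in> {T<..T + 1})"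
    let ?q = "\<lambda>n. window_prob c' n (\<lambda>x. x / sqrt n \<in> {- T - 2<..- T + 1})"
    have "\<forall>\<^sub>F n in sequentially. ?p n \<le> \<kappa>' * ?q (n + D')"
      using eventually_sqrt_ge[of "\<bar>K1\<bar> + (T - 1) * sqrt D' + 1"] eventually_sqrt_ge[of 1]
    proof eventually_elim
      case (elim n)
      let ?m = "n + D'"
      define s where "s = sqrt (real n)"
      define r where "r = sqrt (real ?m)"
      have s: "1 \<le> s" "\<bar>K1\<bar> + (T - 1) * sqrt D' + 1 \<le> s" unfolding s_def using elim by auto
      have sr: "s \<le> r" unfolding s_def r_def by simp
      have rm: "(T - 1) * r \<le> (T - 1) * s + (T - 1) * sqrt D'"
        using mult_left_mono[OF sqrt_add_le_add_sqrt[of "real n" "real D'"], of "T - 1"] T unfolding s_def r_def by (simp add: algebra_simps)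
      show ?case
      proof (rule cmp, intro allI impI)
        fix x y assume x: "x / sqrt n \<in> {T<..T + 1}" and xy: "\<bar>x + y\<bar> \<le> K1"
        have "T * s < x" "x \<le> (T + 1) * s"
          using x s(1) unfolding s_def[symmetric] by (simp_all add: less_divide_eq divide_le_eq)
        moreover have "(T + 1) * s \<le> (T + 1) * r" using sr T by (intro mult_left_mono) auto
        moreover have "(T - 1) * s = T * s - s" "(T + 2) * r = (T + 1) * r + r" by (simp_all add: algebra_simps)
        moreover have "0 \<le> (T - 1) * sqrt D'" using T by simp
        ultimately have "- ((T + 2) * r) < y" "y \<le> - ((T - 1) * r)" using xy s sr rm by linarith+
        moreover have "(- T - 2) * r = - ((T + 2) * r)" "(- T + 1) * r = - ((T - 1) * r)" by (simp_all add: algebra_simps)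
        ultimately show "y / sqrt ?m \<in> {- T - 2<..- T + 1}"
          using s(1) sr unfolding r_def[symmetric] by (simp only: greaterThanAtMost_iff less_divide_eq divide_le_eq) simp
      qed
    qed
    moreover have "(\<lambda>n. \<kappa>' * ?q (n + D')) \<longlonglongrightarrow> \<kappa>' * measure (normal_distribution 0 (sqrt s2')) {- T - 2<..- T + 1}"
      using LIMSEQ_ignore_initial_segment[OF lim'[of "- T - 2" "- T + 1"], of D'] T by (intro tendsto_intros) auto
    moreover have "?p \<longlonglongrightarrow> measure (normal_distribution 0 (sqrt s2)) {T<..T + 1}" using T by (intro lim) auto
    ultimately show ?thesis by (intro tendsto_le[OF sequentially_bot])
  qed
  have "sqrt s2 \<le> sqrt s2'"
  proof (rule normal_tails_comparison[OF _ _ \<kappa>])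
    show "0 \<le> sqrt s2" "0 \<le> sqrt s2'" using s2[of 1 1] s2'[of 1 1] by simp_all
  qed (rule le)
  then show ?thesis by simp
qed

lemma clt_data_global: "\<exists>s2 a1 a2. pos.clt_data f s2 pos_states a1 a2"
proof -
  obtain c0 where c0: "c0 \<in> pos.recurrent" using pos.reaches_recurrent[OF v0_pos] by blast
  have data: "\<exists>s2 a1 a2. pos.clt_data f s2 (pos.reach c) a1 a2" if c: "c \<in> pos.recurrent" for c
  proof -
    obtain E s2 a1 a2 where E: "pos.clt_data (\<lambda>v. f v - E) s2 (pos.reach c) a1 a2"
      using pos.clt_data_recurrent_class[OF c, of f] by blast
    have "E = 0" by (rule recurrent_mean_zero[OF c E])
    then have "pos.clt_data f s2 (pos.reach c) a1 a2" using E by simp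
    then show ?thesis by (intro exI)
  qed
  obtain s2 a1 a2 where s2: "pos.clt_data f s2 (pos.reach c0) a1 a2" using data[OF c0] by (elim exE)
  have ex: "\<exists>a1 a2. pos.clt_data f s2 (pos.reach c) a1 a2" if c: "c \<in> pos.recurrent" for c
  proof -
    obtain t2 b1 b2 where t2: "pos.clt_data f t2 (pos.reach c) b1 b2" using data[OF c] by (elim exE)
    have "t2 = s2"
      using recurrent_variance_le[OF c t2 c0 s2] recurrent_variance_le[OF c0 s2 c t2] by (rule antisym)
    then show ?thesis using t2 by (intro exI) simp
  qed
  have "\<exists>a1 a2. pos.clt_data f s2 pos_states a1 a2" by (rule pos.clt_data_extend) (rule ex)
  then show ?thesis by (rule exI)
qed

text \<open>The normalized measure on the sphere of radius \<open>n\<close> is the law of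
  \<open>n\<close> steps of the chain from \<open>v0\<close>, since the total mass is
  \<open>rho v0\<close> for every \<open>n\<close>. The value at the initial vertex only contributes
  a phase that tends to 1 after scaling.\<close>

lemma nu_hat_central_limit:
  "\<exists>\<sigma>\<ge>0. weak_conv_m (\<lambda>n. distr (nu_hat_sphere G S L n) borel (\<lambda>g. real n powr (- 1 / 2) * \<Phi> g)) (normal_distribution 0 \<sigma>)"
proof -
  obtain s2 a1 a2 where clt: "pos.clt_data f s2 pos_states a1 a2" using clt_data_global by (elim exE)
  have lim: "(\<lambda>n. pos.charf f (t / sqrt n) (\<lambda>_. 1) n v0) \<longlonglongrightarrow> of_real (exp (- s2 * t\<^sup>2 / 2))" for t
    by (rule pos.clt_data_charf(1)[OF subset_refl pos.tr_closed clt v0_pos])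
  have s2: "0 \<le> s2" by (rule pos.clt_data_charf(2)[OF subset_refl pos.tr_closed clt v0_pos])
  have nu0: "0 \<le> nu_hat G S L g" if g: "g \<in> word_sphere G S n" for g n
  proof -
    obtain w where "w \<in> full.words v0 n" "g = ev w" using g bij_betw_imp_surj_on[OF sphere_words, of n] by blast
    moreover from this have "full.run v0 w \<in> accessible" unfolding accessible_def full.words_def by blast
    ultimately show ?thesis using nu_hat_eq rho_nonneg lam_pos by simp
  qed
  have total: "(\<Sum>g\<in>word_sphere G S n. nu_hat G S L g) = rho v0" for n
  proof -
    have "complex_of_real (\<Sum>g\<in>word_sphere G S n. nu_hat G S L g) = of_real (rho v0 * (\<Sum>w\<in>pos.words v0 n. pos.pr v0 w))"
      using sum_nu_hat_sphere[of "\<lambda>_. 1" n] by simp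
    then show ?thesis unfolding of_real_eq_iff using pos.sum_pr[OF v0_pos] by simp
  qed
  let ?M = "\<lambda>n. distr (nu_hat_sphere G S L n) borel (\<lambda>g. real n powr (- 1 / 2) * \<Phi> g)"
  let ?p = "\<lambda>n g. nu_hat G S L g / rho v0"
  have M: "?M n = distr (point_measure (word_sphere G S n) (\<lambda>g. ennreal (?p n g))) borel (\<lambda>g. real n powr (- 1 / 2) * \<Phi> g)" for n
    unfolding nu_hat_sphere_def total ..
  have p: "finite (word_sphere G S n)" "\<And>g. g \<in> word_sphere G S n \<Longrightarrow> 0 \<le> ?p n g" "(\<Sum>g\<in>word_sphere G S n. ?p n g) = 1" for n
  proof -
    show "finite (word_sphere G S n)" by (rule finite_sphere)
    show "0 \<le> ?p n g" if "g \<in> word_sphere G S n" for g using nu0[OF that] rho_v0 by simp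
    show "(\<Sum>g\<in>word_sphere G S n. ?p n g) = 1" using total[of n] rho_v0 by (simp add: sum_divide_distrib[symmetric])
  qed
  have rd: "real_distribution (?M n)" for n unfolding M by (rule finite_distribution(1)[OF p])
  have ch: "char (?M n) t = iexp (t / sqrt n * f v0) * pos.charf f (t / sqrt n) (\<lambda>_. 1) n v0" if n: "0 < n" for n t
  proof -
    have pw: "real n powr (- 1 / 2) = 1 / sqrt n" using n by (simp add: powr_minus_divide powr_half_sqrt[symmetric])
    have "char (?M n) t = (\<Sum>g\<in>word_sphere G S n. of_real (?p n g) * iexp (t * (real n powr (- 1 / 2) * \<Phi> g)))"
      unfolding M by (rule finite_distribution(2)[OF p])
    also have "\<dots> = (\<Sum>g\<in>word_sphere G S n. of_real (nu_hat G S L g) * iexp (t / sqrt n * \<Phi> g)) / of_real (rho v0)"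
      unfolding pw by (simp add: sum_divide_distrib)
    also have "\<dots> = (\<Sum>w\<in>pos.words v0 n. of_real (pos.pr v0 w) * iexp (t / sqrt n * \<Phi> (ev w)))"
      unfolding sum_nu_hat_sphere using rho_v0 by simp
    also have "\<dots> = (\<Sum>w\<in>pos.words v0 n. of_real (pos.pr v0 w) * (iexp (t / sqrt n * f v0) * iexp (t / sqrt n * pos.wsum f v0 w)))"
    proof (rule sum.cong[OF refl])
      fix w assume "w \<in> pos.words v0 n"
      then have "\<Phi> (ev w) = f v0 + pos.wsum f v0 w" using \<Phi>_word pos_acc_imp unfolding pos.words_def by blast
      then have "iexp (t / sqrt n * \<Phi> (ev w)) = iexp (t / sqrt n * f v0) * iexp (t / sqrt n * pos.wsum f v0 w)"
        by (simp only: exp_add[symmetric] distrib_left of_real_add)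
      then show "of_real (pos.pr v0 w) * iexp (t / sqrt n * \<Phi> (ev w)) = of_real (pos.pr v0 w) * (iexp (t / sqrt n * f v0) * iexp (t / sqrt n * pos.wsum f v0 w))"
        by (rule arg_cong)
    qed
    also have "\<dots> = iexp (t / sqrt n * f v0) * pos.charf f (t / sqrt n) (\<lambda>_. 1) n v0"
      unfolding pos.charf_def sum_distrib_left by (intro sum.cong) (simp_all add: mult_ac)
    finally show ?thesis .
  qed
  have "weak_conv_m ?M (normal_distribution 0 (sqrt s2))"
  proof (rule levy_continuity)
    show "real_distribution (?M n)" for n by (rule rd)
    show "real_distribution (normal_distribution 0 (sqrt s2))" using s2 by (intro real_distribution_normal) simp
    fix t
    have "(\<lambda>n. t / sqrt (real n) * f v0) \<longlonglongrightarrow> 0" by real_asymp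
    then have "(\<lambda>n. iexp (t / sqrt n * f v0)) \<longlonglongrightarrow> iexp 0" by (intro tendsto_intros)
    from tendsto_mult[OF this lim]
    have "(\<lambda>n. iexp (t / sqrt n * f v0) * pos.charf f (t / sqrt n) (\<lambda>_. 1) n v0) \<longlonglongrightarrow> of_real (exp (- s2 * t\<^sup>2 / 2))" by simp
    moreover have "\<forall>\<^sub>F n in sequentially. iexp (t / sqrt n * f v0) * pos.charf f (t / sqrt n) (\<lambda>_. 1) n v0 = char (?M n) t"
      using eventually_gt_at_top[of 0] by eventually_elim (use ch in simp)
    ultimately show "(\<lambda>n. char (?M n) t) \<longlonglongrightarrow> char (normal_distribution 0 (sqrt s2)) t"
      using s2 by (simp add: char_normal_distribution tendsto_cong)
  qed
  then show ?thesis using s2 by (intro exI[of _ "sqrt s2"]) simp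
qed

end

theorem corollary4p29:
  fixes G :: "('a, 'b) monoid_scheme"
    and S :: "'a set"
    and L :: "'a list set"
    and \<phi> :: "'a \<Rightarrow> int"
  assumes "group G"
    and "word_hyperbolic G"
    and "\<not> elementary G"
    and "finite S"
    and "symmetric_subset G S"
    and "semigroup_generates G S"
    and "combing G S L"
    and "quasimorphism G (\<lambda>g. real_of_int (\<phi> g))"
    and "bicombable G S L \<phi>"
  shows "\<exists>\<sigma>\<ge>0. weak_conv_m
           (\<lambda>n. distr (nu_hat_sphere G S L n) borel
                  (\<lambda>g. real n powr (- 1 / 2) * real_of_int (\<phi> g)))
           (normal_distribution 0 \<sigma>)"
proof -
  interpret marked_group G S
    using assms by (intro marked_group.intro marked_group_axioms.intro)
  obtain \<kappa> where "hyp_group G S \<kappa>"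
    using nonelementary_hyp_group assms by blast
  then interpret hyp_group G S \<kappa> .
  obtain \<Gamma> d\<phi> where \<Gamma>: "parameterizes S \<Gamma> L"
    and d\<phi>: "\<And>w \<gamma>. w \<in> L \<Longrightarrow> reads \<Gamma> w \<gamma> \<Longrightarrow> \<phi> (ev w) = (\<Sum>i = 0..length w. d\<phi> (\<gamma> ! i))"
    using assms(9) unfolding bicombable_def weakly_combable_def by blast
  obtain D where D: "\<And>a b. a \<in> carrier G \<Longrightarrow> b \<in> carrier G \<Longrightarrow>
      \<bar>real_of_int (\<phi> a) + real_of_int (\<phi> b) - real_of_int (\<phi> (a \<otimes>\<^bsub>G\<^esub> b))\<bar> \<le> D"
    using assms(8) unfolding quasimorphism_def by blast
  interpret combed_group G S \<kappa> L \<Gamma>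
    using assms(7) \<Gamma> by unfold_locales
  interpret combable_group G S \<kappa> L \<Gamma> "\<lambda>g. real_of_int (\<phi> g)" "\<lambda>v. real_of_int (d\<phi> v)" D
  proof
    fix w assume w: "full.acc v0 w"
    let ?\<gamma> = "map (\<lambda>i. full.run v0 (take i w)) [0..<Suc (length w)]"
    have "\<phi> (ev w) = (\<Sum>i = 0..length w. d\<phi> (?\<gamma> ! i))"
      using w parameterizes_automaton(5)[OF \<Gamma> w] by (intro d\<phi>) (simp add: L_eq)
    also have "\<dots> = (\<Sum>i<Suc (length w). d\<phi> (full.run v0 (take i w)))"
      by (intro sum.cong) (auto simp del: upt_Suc)
    \<comment> \<open>The term of index 0 is the initial vertex, which \<open>wsum\<close> leaves
      out.\<close>
    also have "\<dots> = d\<phi> v0 + (\<Sum>i<length w. d\<phi> (full.run v0 (take (Suc i) w)))"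
      by (subst sum.lessThan_Suc_shift) simp
    finally show "real_of_int (\<phi> (ev w)) = real_of_int (d\<phi> v0) + full.wsum (\<lambda>v. real_of_int (d\<phi> v)) v0 w"
      unfolding full.wsum_nth by simp
  qed (rule D)
  show ?thesis by (rule nu_hat_central_limit)
qed

end
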